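(* Let $(T,\mathcal{A},\mu)$ be a complete finite measure space with a decomposition $T=T_{pa}\sqcup T_{na}$ into purely atomic and nonatomic parts, let $\varphi\colon T\times\mathbb{R}^n\times\mathbb{R}^m\to\overline{\mathbb{R}}$ be a normal integrand for which there exists $\nu\in L^1(T,\mathbb{R}_+)$ with $\varphi_t(v,w)\ge-\nu(t)$ for all $t\in T$, $v\in\mathbb{R}^n$, $w\in\mathbb{R}^m$, and let $E_\varphi(x,\mathbf{y}):=\int_T\varphi_t(x,\mathbf{y}(t))\,\mu(dt)$ on $\mathbb{R}^n\times L^1(T,\mathbb{R}^m)$. Let $p,q\in(1,\infty)$ with $1/p+1/q=1$, and let $(\bar x,\bar{\mathbf{y}})\in\operatorname{dom}E_\varphi$ be such that for some $\rho>0$ the function $\varphi_t(v,\cdot)$ is convex whenever $v\in\mathbb{B}_\rho(\bar x)$ and $t\in T_{na}$. Let $(\bar x^*,\bar{\mathbf{y}}^* )\in\widehat\partial E_\varphi(\bar x,\bar{\mathbf{y}})$ be such that the function $t\mapsto\inf_{(v,w)\in\mathbb{R}^n\times\mathbb{R}^m}\{\varphi_t(v,w)-\langle\bar{\mathbf{y}}^*(t),w\rangle\}$ is integrable on $T$. Then there exist sequences $\{x_k\}\subset\mathbb{R}^n$, $\{\mathbf{x}_k\}\subset L^p(T,\mathbb{R}^n)$, $\{\mathbf{x}_k^*\}\subset L^q(T,\mathbb{R}^n)$, $\{\mathbf{y}_k\}\subset L^1(T,\mathbb{R}^m)$, and $\{\mathbf{y}_k^*\}\subset L^\infty(T,\mathbb{R}^m)$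 such that: (i) $(\mathbf{x}_k^*(t),\mathbf{y}_k^*(t))\in\widehat\partial\varphi_t(\mathbf{x}_k(t),\mathbf{y}_k(t))$ for a.e. $t\in T$ and all $k\in\mathbb{N}$; (ii) $\|\bar x-x_k\|\to0$, $\|\bar x-\mathbf{x}_k\|_p\to0$, $\|\bar{\mathbf{y}}-\mathbf{y}_k\|_1\to0$, and $\|\bar{\mathbf{y}}^*-\mathbf{y}_k^*\|_\infty\to0$ as $k\to\infty$; (iii) $\big\|\int_T\mathbf{x}_k^*(t)\,\mu(dt)-\bar x^*\big\|\to0$ and $\|\mathbf{x}_k^*\|_q\,\|\mathbf{x}_k-x_k\|_p\to0$ as $k\to\infty$; (iv) $\int_T\big|\varphi_t(\mathbf{x}_k(t),\mathbf{y}_k(t))-\varphi_t(\bar x,\bar{\mathbf{y}}(t))\big|\,\mu(dt)\to0$ as $k\to\infty$.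
   Context: $\overline{\mathbb{R}}=[-\infty,\infty]$; $\|\cdot\|$ is the Euclidean norm; $\mathbb{B}_\rho(\bar x)$ is the closed ball. Boldface letters denote measurable functions on $T$; points $x\in\mathbb{R}^n$ are identified with constant functions, so $\|x-\mathbf{x}\|_p=(\int_T\|x-\mathbf{x}(t)\|^p\mu(dt))^{1/p}$. The integral of a measurable $\alpha\colon T\to\overline{\mathbb{R}}$ is $\int_T\max\{\alpha,0\}\,d\mu+\int_T\min\{\alpha,0\}\,d\mu$ with $\infty+(-\infty)=\infty$. Normal integrand: $\varphi$ is $\mathcal{A}\otimes\mathcal{B}(\mathbb{R}^{n+m})$-measurable and $\varphi_t:=\varphi(t,\cdot,\cdot)$ is lower semicontinuous for every $t\in T$. $\operatorname{dom}E_\varphi=\{(x,\mathbf{y})\mid E_\varphi(x,\mathbf{y})<\infty\}$. Decomposition of the measure: $T_{pa},T_{na}\in\mathcal{A}$ are disjoint with union $T$, $\mu(\cdot\cap T_{pa})$ is purely atomic with countably many disjoint atoms, and $\mu(\cdot\cap T_{na})$ is nonatomic. Regular subdifferential on $\mathbb{R}^d$: for $\psi\colon\mathbb{R}^d\to\overline{\mathbb{R}}$ and $\bar z$ with $\psi(\bar z)$ finite, $\widehat\partial\psi(\bar z):=\{z^*\in\mathbb{R}^d\mid(z^*,-1)\in\widehat N((\bar z,\psi(\bar z));\operatorname{epi}\psi)\}$, where $\operatorname{epi}\psi=\{(z,\alpha)\mid\alpha\ge\psi(z)\}$ and $\widehat N(\bar u;\Omega):=\{u^*\mid\limsup_{u\to\bar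 u,\,u\in\Omega}\langle u^*,u-\bar u\rangle/\|u-\bar u\|\le0\}$ for $\bar u\in\Omega$; $\widehat\partial\psi(\bar z)=\emptyset$ if $\psi(\bar z)$ is not finite. Regular subdifferential of $E_\varphi$ at $(\bar x,\bar{\mathbf{y}})\in\operatorname{dom}E_\varphi$: $\widehat\partial E_\varphi(\bar x,\bar{\mathbf{y}})$ is the set of all $(\bar x^*,\bar{\mathbf{y}}^* )\in\mathbb{R}^n\times L^\infty(T,\mathbb{R}^m)$ such that $$\liminf_{(x,\mathbf{y})\to(\bar x,\bar{\mathbf{y}})}\frac{E_\varphi(x,\mathbf{y})-E_\varphi(\bar x,\bar{\mathbf{y}})-\langle\bar x^*,x-\bar x\rangle-\int_T\langle\bar{\mathbf{y}}^*(t),\mathbf{y}(t)-\bar{\mathbf{y}}(t)\rangle\mu(dt)}{\|x-\bar x\|+\|\mathbf{y}-\bar{\mathbf{y}}\|_1}\ge0,$$ where the convergence is in $\mathbb{R}^n\times L^1(T,\mathbb{R}^m)$. *)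

theory Defs
  imports "HOL-Analysis.Analysis" "HOL-Probability.Essential_Supremum"
begin

section \<open>Atomic and nonatomic measures\<close>

definition measure_atom :: "'t measure \<Rightarrow> 't set \<Rightarrow> bool" where
  "measure_atom N A \<longleftrightarrow> A \<in> sets N \<and> 0 < emeasure N A \<and>
     (\<forall>B\<in>sets N. B \<subseteq> A \<longrightarrow> emeasure N B = 0 \<or> emeasure N B = emeasure N A)"

definition nonatomic :: "'t measure \<Rightarrow> bool" where
  "nonatomic N \<longleftrightarrow> (\<nexists>A. measure_atom N A)"

text \<open>
  The atoms exhaust the space only up to a null set. For a finite measure, this is the same as
  requiring that every set of positive measure contains an atom.
\<close>

definition countably_purely_atomic :: "'t measure \<Rightarrow> bool" where
  "countably_purely_atomic N \<longleftrightarrow>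
     (\<exists>C. countable C \<and> disjoint C \<and> (\<forall>A\<in>C. measure_atom N A) \<and> space N - \<Union>C \<in> null_sets N)"

text \<open>\<^term>\<open>density M (indicator S)\<close> is the measure sending \<open>A\<close> to the \<open>M\<close>-measure of \<open>A \<inter> S\<close>.\<close>

definition atomic_decomposition :: "'t measure \<Rightarrow> 't set \<Rightarrow> 't set \<Rightarrow> bool" where
  "atomic_decomposition M Tpa Tna \<longleftrightarrow>
     Tpa \<in> sets M \<and> Tna \<in> sets M \<and> Tpa \<inter> Tna = {} \<and> Tpa \<union> Tna = space M \<and>
     countably_purely_atomic (density M (indicator Tpa)) \<and>
     nonatomic (density M (indicator Tna))"


section \<open>Lebesgue spaces\<close>

text \<open>
  Elements are functions rather than equivalence classes; everything below is invariant under
  changes on null sets.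
\<close>

definition Lp_space :: "'t measure \<Rightarrow> real \<Rightarrow> ('t \<Rightarrow> 'b::euclidean_space) set" where
  "Lp_space M p = {f \<in> borel_measurable M. integrable M (\<lambda>t. norm (f t) powr p)}"

definition Lp_norm :: "'t measure \<Rightarrow> real \<Rightarrow> ('t \<Rightarrow> 'b::euclidean_space) \<Rightarrow> real" where
  "Lp_norm M p f = (LINT t|M. norm (f t) powr p) powr (1 / p)"

definition Linf_norm :: "'t measure \<Rightarrow> ('t \<Rightarrow> 'b::euclidean_space) \<Rightarrow> ennreal" where
  "Linf_norm M f = esssup M (\<lambda>t. ennreal (norm (f t)))"

definition Linf_space :: "'t measure \<Rightarrow> ('t \<Rightarrow> 'b::euclidean_space) set" where
  "Linf_space M = {f \<in> borel_measurable M. Linf_norm M f < \<infinity>}"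


section \<open>Extended-real-valued functions and their integrals\<close>

text \<open>
  The integral is that of the positive part minus that of the negative part
  (\<^const>\<open>e2ennreal\<close> sends negative values to \<open>0\<close>). The convention \<open>\<infinity> + (-\<infinity>) = \<infinity>\<close> is the one
  built into addition and subtraction on \<^typ>\<open>ereal\<close>.
\<close>

definition ext_integral :: "'t measure \<Rightarrow> ('t \<Rightarrow> ereal) \<Rightarrow> ereal" where
  "ext_integral M \<alpha> =
     enn2ereal (\<integral>\<^sup>+t. e2ennreal (\<alpha> t) \<partial>M) - enn2ereal (\<integral>\<^sup>+t. e2ennreal (- \<alpha> t) \<partial>M)"

definition ext_integrable :: "'t measure \<Rightarrow> ('t \<Rightarrow> ereal) \<Rightarrow> bool" where
  "ext_integrable M \<alpha> \<longleftrightarrow> \<alpha> \<in> borel_measurable M \<and> (\<integral>\<^sup>+t. e2ennreal \<bar>\<alpha> t\<bar> \<partial>M) < \<infinity>"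

definition lower_semicontinuous :: "('a::topological_space \<Rightarrow> ereal) \<Rightarrow> bool" where
  "lower_semicontinuous f \<longleftrightarrow> (\<forall>z. f z \<le> Liminf (at z) f)"

definition epi :: "('a \<Rightarrow> ereal) \<Rightarrow> ('a \<times> real) set" where
  "epi f = {(z, \<alpha>). f z \<le> ereal \<alpha>}"

definition ext_convex :: "('a::real_vector \<Rightarrow> ereal) \<Rightarrow> bool" where
  "ext_convex f \<longleftrightarrow> convex (epi f)"

definition normal_integrand ::
    "'t measure \<Rightarrow> ('t \<Rightarrow> 'a::euclidean_space \<times> 'b::euclidean_space \<Rightarrow> ereal) \<Rightarrow> bool" where
  "normal_integrand M \<phi> \<longleftrightarrow>
     (\<lambda>(t, z). \<phi> t z) \<in> borel_measurable (M \<Otimes>\<^sub>M borel) \<and>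
     (\<forall>t\<in>space M. lower_semicontinuous (\<phi> t))"


section \<open>Regular subdifferential in finite dimensions\<close>

definition regular_normal_cone :: "'a::euclidean_space \<Rightarrow> 'a set \<Rightarrow> 'a set" where
  "regular_normal_cone u0 \<Omega> =
     {u'. u0 \<in> \<Omega> \<and>
        Limsup (at u0 within \<Omega>) (\<lambda>u. ereal (u' \<bullet> (u - u0) / norm (u - u0))) \<le> 0}"

definition regular_subdiff :: "('a::euclidean_space \<Rightarrow> ereal) \<Rightarrow> 'a \<Rightarrow> 'a set" where
  "regular_subdiff \<psi> z0 =
     (if \<bar>\<psi> z0\<bar> = \<infinity> then {}
      else {z'. (z', - 1) \<in> regular_normal_cone (z0, real_of_ereal (\<psi> z0)) (epi \<psi>)})"


section \<open>Integral functionals and their regular subdifferential\<close>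

definition integral_functional ::
    "'t measure \<Rightarrow> ('t \<Rightarrow> 'a \<times> 'b \<Rightarrow> ereal) \<Rightarrow> 'a \<Rightarrow> ('t \<Rightarrow> 'b) \<Rightarrow> ereal" where
  "integral_functional M \<phi> x y = ext_integral M (\<lambda>t. \<phi> t (x, y t))"

definition dom_functional ::
    "'t measure \<Rightarrow> ('a::euclidean_space \<Rightarrow> ('t \<Rightarrow> 'b::euclidean_space) \<Rightarrow> ereal) \<Rightarrow>
      ('a \<times> ('t \<Rightarrow> 'b)) set" where
  "dom_functional M E = {(x, y). y \<in> Lp_space M 1 \<and> E x y < \<infinity>}"

text \<open>
  The filter of punctured neighbourhoods of \<open>(x0, y0)\<close> in the product of a Euclidean space and
  \<open>L\<^sup>1\<close>. Functions almost everywhere equal to \<open>y0\<close> are identified with \<open>y0\<close>, so puncturing means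
  that the distance is positive.
\<close>

definition at_L1 ::
    "'t measure \<Rightarrow> 'a::euclidean_space \<Rightarrow> ('t \<Rightarrow> 'b::euclidean_space) \<Rightarrow>
      ('a \<times> ('t \<Rightarrow> 'b)) filter" where
  "at_L1 M x0 y0 =
     (INF \<epsilon>\<in>{0<..}. principal {(x, y). y \<in> Lp_space M 1 \<and>
        0 < norm (x - x0) + Lp_norm M 1 (\<lambda>t. y t - y0 t) \<and>
        norm (x - x0) + Lp_norm M 1 (\<lambda>t. y t - y0 t) < \<epsilon>})"

definition regular_subdiff_functional ::
    "'t measure \<Rightarrow> ('a::euclidean_space \<Rightarrow> ('t \<Rightarrow> 'b::euclidean_space) \<Rightarrow> ereal) \<Rightarrow>
      'a \<Rightarrow> ('t \<Rightarrow> 'b) \<Rightarrow> ('a \<times> ('t \<Rightarrow> 'b)) set" where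
  "regular_subdiff_functional M E x0 y0 =
     {(x', y'). y' \<in> Linf_space M \<and>
        0 \<le> Liminf (at_L1 M x0 y0) (\<lambda>(x, y).
          (E x y - E x0 y0 - ereal (x' \<bullet> (x - x0)) - ereal (LINT t|M. y' t \<bullet> (y t - y0 t)))
            / ereal (norm (x - x0) + Lp_norm M 1 (\<lambda>t. y t - y0 t)))}"

end

theory Submission
  imports Defs
begin

text \<open>
  Write \<open>x\<^sup>*\<close>, \<open>y\<^sup>*\<close> for the given subgradient. Subtracting from \<open>\<phi>\<^sub>t(v, w)\<close> the linear term
  \<open>\<langle>y\<^sup>*(t), w\<rangle>\<close> and the infimum of the difference, which is integrable by assumption, turns \<open>\<phi>\<close>
  into a nonnegative normal integrand \<open>G\<close>. In terms of \<open>G\<close> the subgradient condition says that for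
  every \<open>\<epsilon> > 0\<close> the point \<open>(x, y)\<close> at which the subgradient is taken minimizes
  \<open>(v, w) \<mapsto> \<integral> G\<^sub>t(v, w(t)) - \<langle>x\<^sup>*, v\<rangle>\<close> locally, up to \<open>\<epsilon>\<close> times the distance.

  The vector variable is then decoupled from the integrand by a penalty. For large \<open>r\<close> and small \<open>s\<close>
  one minimizes
  \<open>\<integral> (G\<^sub>t(X(t), Y(t)) + 2\<epsilon> h\<^sub>s(Y(t) - y(t)) + r \<parallel>X(t) - v\<parallel>\<^sup>p) - \<langle>x\<^sup>*, v\<rangle> + 2\<epsilon> h\<^sub>s(v - x)\<close>
  over \<open>v\<close> in a small ball and over all measurable \<open>X\<close>, \<open>Y\<close>, where \<open>h\<^sub>s\<close> is a smooth approximation of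
  the norm. For fixed \<open>v\<close> this is a minimization at each \<open>t\<close> separately, and a minimizer can be
  chosen measurably in \<open>t\<close> (\<open>measurable_argmin\<close>). All terms except \<open>G\<close> are differentiable, so Fermat's
  rule is exact: at almost every \<open>t\<close> it gives a regular subgradient of \<open>\<phi>\<^sub>t\<close> at \<open>(X(t), Y(t))\<close> with
  components \<open>X\<^sup>*(t) = r p \<parallel>X(t) - v\<parallel>\<^sup>p\<^sup>-\<^sup>2 (v - X(t))\<close> and \<open>Y\<^sup>*(t)\<close> within \<open>2\<epsilon>\<close> of \<open>y\<^sup>*(t)\<close>, and in
  the variable \<open>v\<close> it gives \<open>\<parallel>\<integral> X\<^sup>* - x\<^sup>*\<parallel> \<le> 2\<epsilon>\<close>. With \<open>q\<close> the conjugate exponent,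
  \<open>\<parallel>X\<^sup>*\<parallel>\<^sub>q \<parallel>X - v\<parallel>\<^sub>p = p r \<integral> \<parallel>X - v\<parallel>\<^sup>p\<close> is a multiple of the penalty term, and penalty terms vanish
  as \<open>r\<close> tends to infinity.

  It remains to see that the minimizers converge to \<open>(x, y)\<close> (\<open>approximate_solutions\<close>). The slope
  \<open>2\<epsilon>\<close> of the added terms exceeds the slope \<open>\<epsilon>\<close> lost in the minimality of \<open>(x, y)\<close>; hence \<open>(x, y)\<close>
  is the strict minimizer of the limit problem. Lower semicontinuity and Fatou's lemma bound the
  values from below, minimality bounds their integrals from above, and together they force the
  values to converge in \<open>L\<^sup>1\<close> (\<open>value_convergence\<close>). Since the values dominate \<open>2\<epsilon>\<parallel>Y - y\<parallel>\<close>
  up to a vanishing term, \<open>Y\<close> converges in \<open>L\<^sup>1\<close> as well.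

  Two points need more than this. First, choosing minimizers measurably rests on the theorem that
  projections of measurable sets along a Euclidean space are measurable when the measure is complete
  and finite (\<open>measurable_projection\<close>); it is proved by approximating the projection from inside by
  compactness, as in Choquet's capacity theorem. Second, minimality holds only for \<open>w\<close> close to \<open>y\<close>
  in \<open>L\<^sup>1\<close>, whereas the convergence argument needs the inequality
  \<open>G\<^sub>t(x, y(t)) \<le> G\<^sub>t(x, w) + \<epsilon>\<parallel>w - y(t)\<parallel>\<close> pointwise and for all \<open>w\<close>. Where it fails, some
  measurable function \<open>s\<close> is strictly better than \<open>y\<close>; as \<open>s\<close> may replace \<open>y\<close> on any part of that set
  over which \<open>\<parallel>s - y\<parallel>\<close> has small integral, all such parts are null (\<open>localization\<close>). So on that set
  \<open>w\<close> can be confined to a fixed ball around \<open>y(t)\<close>, and this constraint is active on smaller and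
  smaller sets along the minimizers, hence eventually on a null set only.
\<close>

section \<open>Projections of measurable sets\<close>

definition closed_rectangles :: "'t measure \<Rightarrow> ('t \<times> 'b::euclidean_space) set set" where
  "closed_rectangles M = {A \<times> K | A K. A \<in> sets M \<and> closed K}"

text \<open>
  The rectangle \<open>R n \<sigma>\<close> depends on the sequence \<open>\<sigma>\<close> only through its first \<open>N n\<close> terms. Leaving
  \<open>N\<close> arbitrary, instead of fixing it to be the identity, makes the closure properties below a matter
  of reindexing \<open>\<sigma>\<close>.
\<close>

definition suslin_scheme ::
    "'t measure \<Rightarrow> (nat \<Rightarrow> (nat \<Rightarrow> nat) \<Rightarrow> ('t \<times> 'b::euclidean_space) set) \<Rightarrow> (nat \<Rightarrow> nat) \<Rightarrow> bool" where
  "suslin_scheme M R N \<longleftrightarrow> (\<forall>n \<sigma>. R n \<sigma> \<in> closed_rectangles M) \<and>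
     (\<forall>n \<sigma> \<tau>. (\<forall>i<N n. \<sigma> i = \<tau> i) \<longrightarrow> R n \<sigma> = R n \<tau>)"

text \<open>
  These are the results of the Suslin operation applied to closed rectangles.
\<close>

definition suslin :: "'t measure \<Rightarrow> ('t \<times> 'b::euclidean_space) set \<Rightarrow> bool" where
  "suslin M S \<longleftrightarrow> (\<exists>R N. suslin_scheme M R N \<and> S = (\<Union>\<sigma>. \<Inter>n. R n \<sigma>))"

lemma suslin_schemeD:
  assumes "suslin_scheme M R N"
  shows "R n \<sigma> \<in> closed_rectangles M" "(\<And>i. i < N n \<Longrightarrow> \<sigma> i = \<tau> i) \<Longrightarrow> R n \<sigma> = R n \<tau>"
  using assms by (auto simp: suslin_scheme_def)

lemma suslin_rectangle: "P \<in> closed_rectangles M \<Longrightarrow> suslin M P"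
  unfolding suslin_def suslin_scheme_def
  by (intro exI[of _ "\<lambda>n \<sigma>. P"] exI[of _ "\<lambda>n. 0"]) auto

text \<open>
  A single sequence encodes countably many sequences, one for each of the intersected sets.
\<close>

lemma suslin_INT:
  assumes "\<And>m::nat. suslin M (S m)"
  shows "suslin M (\<Inter>m. S m)"
proof -
  obtain R N where RN: "\<And>m. suslin_scheme M (R m) (N m)"
    and S: "\<And>m. S m = (\<Union>\<sigma>. \<Inter>n. R m n \<sigma>)"
    using assms unfolding suslin_def by metis
  note R = suslin_schemeD(1)[OF RN] and N = suslin_schemeD(2)[OF RN]
  define G where "G k \<sigma> = (case prod_decode k of (m, n) \<Rightarrow> R m n (\<lambda>j. \<sigma> (prod_encode (m, j))))" for k \<sigma>
  define N' where "N' k = (case prod_decode k of (m, n) \<Rightarrow> \<Sum>j<N m n. Suc (prod_encode (m, j)))" for k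
  have G_rect: "G k \<sigma> \<in> closed_rectangles M" for k \<sigma>
    by (simp add: G_def R split: prod.split)
  have G_dep: "G k \<sigma> = G k \<tau>" if eq: "\<forall>i<N' k. \<sigma> i = \<tau> i" for k \<sigma> \<tau>
  proof -
    obtain m n where k: "prod_decode k = (m, n)" by fastforce
    have "\<sigma> (prod_encode (m, j)) = \<tau> (prod_encode (m, j))" if "j < N m n" for j
    proof -
      have "Suc (prod_encode (m, j)) \<le> (\<Sum>j<N m n. Suc (prod_encode (m, j)))"
        using that by (intro member_le_sum) auto
      then show ?thesis using eq k by (simp add: N'_def)
    qed
    then show ?thesis by (auto simp: G_def k intro!: N)
  qed
  have "(\<Inter>m. S m) = (\<Union>\<sigma>. \<Inter>k. G k \<sigma>)"
  proof (intro equalityI subsetI)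
    fix u assume "u \<in> (\<Inter>m. S m)"
    then have "\<forall>m. \<exists>\<sigma>. \<forall>n. u \<in> R m n \<sigma>" by (auto simp: S)
    then obtain s where s: "\<And>m n. u \<in> R m n (s m)" by metis
    have "u \<in> G k (\<lambda>i. case prod_decode i of (m, j) \<Rightarrow> s m j)" for k
      by (simp add: G_def s split: prod.split)
    then show "u \<in> (\<Union>\<sigma>. \<Inter>k. G k \<sigma>)" by blast
  next
    fix u assume "u \<in> (\<Union>\<sigma>. \<Inter>k. G k \<sigma>)"
    then obtain \<sigma> where \<sigma>: "\<And>k. u \<in> G k \<sigma>" by blast
    have "u \<in> R m n (\<lambda>j. \<sigma> (prod_encode (m, j)))" for m n
      using \<sigma>[of "prod_encode (m, n)"] by (simp add: G_def)
    then show "u \<in> (\<Inter>m. S m)" by (auto simp: S)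
  qed
  then show ?thesis
    unfolding suslin_def suslin_scheme_def using G_rect G_dep
    by (intro exI[of _ G] exI[of _ N']) blast
qed

text \<open>
  The first term of the sequence selects the member of the union and the remaining terms serve as the
  sequence for that member. The number of terms on which a rectangle of the selected scheme depends
  varies with the member and may be too large; the rectangle is therefore delayed until enough terms
  are visible, with the whole space in its place before.
\<close>

lemma suslin_UN:
  assumes "\<And>m::nat. suslin M (S m)"
  shows "suslin M (\<Union>m. S m)"
proof -
  obtain R N where RN: "\<And>m. suslin_scheme M (R m) (N m)"
    and S: "\<And>m. S m = (\<Union>\<sigma>. \<Inter>n. R m n \<sigma>)"
    using assms unfolding suslin_def by metis
  note R = suslin_schemeD(1)[OF RN] and N = suslin_schemeD(2)[OF RN]
  define G where "G k \<sigma> = (case prod_decode k of (n, j) \<Rightarrow>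
      if N (\<sigma> 0) n \<le> j then R (\<sigma> 0) n (\<lambda>i. \<sigma> (Suc i)) else space M \<times> UNIV)" for k \<sigma>
  have rect_sub: "P \<subseteq> space M \<times> UNIV" if "P \<in> closed_rectangles M" for P :: "('a \<times> 'b) set"
    using that sets.sets_into_space by (fastforce simp: closed_rectangles_def)
  have whole: "space M \<times> (UNIV::'b set) \<in> closed_rectangles M"
    unfolding closed_rectangles_def by blast
  have G_rect: "G k \<sigma> \<in> closed_rectangles M" for k \<sigma>
    by (simp add: G_def R whole split: prod.split)
  have G_dep: "G k \<sigma> = G k \<tau>" if eq: "\<forall>i<Suc (snd (prod_decode k)). \<sigma> i = \<tau> i" for k \<sigma> \<tau>
  proof -
    obtain n j where k: "prod_decode k = (n, j)" by fastforce
    have "\<sigma> 0 = \<tau> 0" using eq by simp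
    moreover have "R (\<tau> 0) n (\<lambda>i. \<sigma> (Suc i)) = R (\<tau> 0) n (\<lambda>i. \<tau> (Suc i))" if "N (\<tau> 0) n \<le> j"
      using eq k that by (intro N) auto
    ultimately show ?thesis by (simp add: G_def k)
  qed
  have "(\<Union>m. S m) = (\<Union>\<sigma>. \<Inter>k. G k \<sigma>)"
  proof (intro equalityI subsetI)
    fix u assume "u \<in> (\<Union>m. S m)"
    then obtain m s where s: "\<And>n. u \<in> R m n s" by (auto simp: S)
    have "u \<in> G k (case_nat m s)" for k
      using s[of "fst (prod_decode k)"] rect_sub[OF R] by (auto simp: G_def split: prod.split)
    then show "u \<in> (\<Union>\<sigma>. \<Inter>k. G k \<sigma>)" by blast
  next
    fix u assume "u \<in> (\<Union>\<sigma>. \<Inter>k. G k \<sigma>)"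
    then obtain \<sigma> where \<sigma>: "\<And>k. u \<in> G k \<sigma>" by blast
    have "u \<in> R (\<sigma> 0) n (\<lambda>i. \<sigma> (Suc i))" for n
      using \<sigma>[of "prod_encode (n, N (\<sigma> 0) n)"] by (simp add: G_def)
    then show "u \<in> (\<Union>m. S m)" by (auto simp: S)
  qed
  then show ?thesis
    unfolding suslin_def suslin_scheme_def using G_rect G_dep
    by (intro exI[of _ G] exI[of _ "\<lambda>k. Suc (snd (prod_decode k))"]) blast
qed

text \<open>
  The sets that are Suslin together with their complements form a \<open>\<sigma>\<close>-algebra, and it contains the
  measurable rectangles because open sets are countable unions of closed ones.
\<close>

lemma suslin_measurable:
  assumes "S \<in> sets (M \<Otimes>\<^sub>M (borel :: 'b::euclidean_space measure))"
  shows "suslin M S"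
proof -
  let ?\<Omega> = "space M \<times> (UNIV :: 'b set)"
  define D where "D = {S. S \<subseteq> ?\<Omega> \<and> suslin M S \<and> suslin M (?\<Omega> - S)}"
  have rect: "suslin M (A \<times> K)" if "A \<in> sets M" "closed K" for A and K :: "'b set"
    using that by (intro suslin_rectangle) (auto simp: closed_rectangles_def)
  have opn: "suslin M (A \<times> U)" if A: "A \<in> sets M" and U: "open U" for A and U :: "'b set"
  proof -
    obtain \<D> where \<D>: "countable \<D>" "\<And>X. X \<in> \<D> \<Longrightarrow> \<exists>a b. X = cbox a b" "\<Union>\<D> = U"
      using open_countable_Union_open_cbox[OF U] by metis
    define F where "F = from_nat_into (insert {} \<D>)"
    have range_F: "range F = insert {} \<D>"
      unfolding F_def using \<D>(1) by (intro range_from_nat_into) auto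
    have F: "closed (F n)" for n
      using range_F \<D>(2) by (metis closed_cbox closed_empty insertE rangeI)
    have UF: "U = (\<Union>n. F n)" using range_F \<D>(3) by auto
    have "A \<times> U = (\<Union>n. A \<times> F n)" using UF by auto
    then show ?thesis using suslin_UN[of M "\<lambda>n. A \<times> F n"] rect[OF A F] by simp
  qed
  have D_UN: "(\<Union>n. X n) \<in> D" if X: "range X \<subseteq> D" for X :: "nat \<Rightarrow> _"
  proof -
    have "suslin M (\<Union>n. X n)" using X by (intro suslin_UN) (auto simp: D_def)
    moreover have "?\<Omega> - (\<Union>n. X n) = (\<Inter>n. ?\<Omega> - X n)" by blast
    then have "suslin M (?\<Omega> - (\<Union>n. X n))"
      using suslin_INT[of M "\<lambda>n. ?\<Omega> - X n"] X by (auto simp: D_def)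
    ultimately show ?thesis using X by (auto simp: D_def)
  qed
  have D_cl: "?\<Omega> - X \<in> D" if "X \<in> D" for X
    using that by (auto simp: D_def double_diff)
  have D_empty: "{} \<in> D"
    using rect[OF sets.empty_sets closed_UNIV] rect[OF sets.top closed_UNIV] by (auto simp: D_def)
  have D_Int: "X \<inter> Y \<in> D" if "X \<in> D" "Y \<in> D" for X Y
  proof -
    have "(?\<Omega> - X) \<union> (?\<Omega> - Y) = (\<Union>n. if n = (0::nat) then ?\<Omega> - X else ?\<Omega> - Y)"
      by (auto split: if_splits)
    also have "\<dots> \<in> D" using D_cl that by (intro D_UN) auto
    finally have "?\<Omega> - ((?\<Omega> - X) \<union> (?\<Omega> - Y)) \<in> D" by (rule D_cl)
    moreover have "?\<Omega> - ((?\<Omega> - X) \<union> (?\<Omega> - Y)) = X \<inter> Y" using that by (auto simp: D_def)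
    ultimately show ?thesis by simp
  qed
  have D_left: "A \<times> UNIV \<in> D" if A: "A \<in> sets M" for A
  proof -
    have "?\<Omega> - A \<times> UNIV = (space M - A) \<times> UNIV" by auto
    then show ?thesis using rect[OF A closed_UNIV] rect[OF sets.compl_sets[OF A] closed_UNIV]
        sets.sets_into_space[OF A] by (auto simp: D_def)
  qed
  have D_right: "space M \<times> B \<in> D" if "B \<in> sets borel" for B
  proof -
    have "B \<in> sigma_sets UNIV {U. open U}" using that by (simp add: borel_def)
    then show ?thesis
    proof induction
      case (Basic U)
      have "?\<Omega> - space M \<times> U = space M \<times> (- U)" by auto
      then show ?case using opn[OF sets.top, of U] rect[OF sets.top, of "- U"] Basic
        by (auto simp: D_def)
    next
      case Empty then show ?case using D_empty by simp
    next
      case (Compl B)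
      have "space M \<times> (UNIV - B) = ?\<Omega> - space M \<times> B" by auto
      then show ?case using D_cl[OF Compl.IH] by simp
    next
      case (Union B)
      have "space M \<times> (\<Union>i. B i) = (\<Union>i. space M \<times> B i)" by auto
      then show ?case using D_UN[of "\<lambda>i. space M \<times> B i"] Union.IH by auto
    qed
  qed
  have "S \<in> sigma_sets ?\<Omega> {a \<times> b | a b. a \<in> sets M \<and> b \<in> sets borel}"
    using assms by (simp add: sets_pair_measure)
  then have "S \<in> D"
  proof induction
    case (Basic P)
    then obtain A B where P: "P = A \<times> B" "A \<in> sets M" "B \<in> sets borel" by auto
    then have "P = A \<times> UNIV \<inter> space M \<times> B" using sets.sets_into_space by fastforce
    then show ?case using D_Int[OF D_left D_right] P by simp
  next
    case Empty then show ?case by (rule D_empty)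
  next
    case (Compl B) then show ?case using D_cl by simp
  next
    case (Union B) then show ?case using D_UN[of B] by auto
  qed
  then show ?thesis by (simp add: D_def)
qed

lemma compact_nat_box: "compact {\<sigma>::nat \<Rightarrow> nat. \<forall>i. \<sigma> i \<le> b i}"
proof -
  have "compactin (product_topology (\<lambda>i. euclidean) UNIV) (PiE UNIV (\<lambda>i. {..b i}))"
    by (simp add: compactin_PiE finite_imp_compact)
  moreover have "PiE UNIV (\<lambda>i. {..b i}) = {\<sigma>. \<forall>i. \<sigma> i \<le> b i}"
    by (auto simp: PiE_def Pi_def)
  ultimately show ?thesis by (simp add: euclidean_product_topology)
qed

text \<open>
  This is Choquet's capacity argument for the set function that sends a set to the outer measure of its
  projection. That function is continuous along increasing unions, so the terms of \<open>\<sigma>\<close> can be bounded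
  one after the other, \<open>\<sigma> i \<le> b i\<close>, while the outer measure of the projection stays above \<open>c\<close>. For
  bounded \<open>\<sigma>\<close> the first \<open>k\<close> conditions define a finite union of rectangles, and the projection \<open>Q k\<close> of
  its part over \<open>C\<close> is measurable. Compactness of the box of bounded sequences and of \<open>C\<close> shows
  that the intersection of the sets \<open>Q k\<close> still lies in the projection.
\<close>

lemma suslin_projection_inner_approx:
  assumes M: "finite_measure M" and S: "suslin M S" and C: "compact (C :: 'b::euclidean_space set)"
    and c: "c < outer_measure_of M (fst ` (S \<inter> space M \<times> C))"
  shows "\<exists>K\<in>sets M. K \<subseteq> fst ` (S \<inter> space M \<times> C) \<and> c \<le> emeasure M K"
proof -
  interpret finite_measure M by fact
  obtain R N where RN: "suslin_scheme M R N" and S: "S = (\<Union>\<sigma>. \<Inter>n. R n \<sigma>)"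
    using S unfolding suslin_def by blast
  note R = suslin_schemeD(1)[OF RN] and N = suslin_schemeD(2)[OF RN]
  (* the projection of the part of the Suslin set in which the first k terms of the sequence are bounded by b *)
  define D where "D b k = {t \<in> space M. \<exists>z\<in>C. \<exists>\<sigma>. (\<forall>i<k. \<sigma> i \<le> b i) \<and> (\<forall>n. (t, z) \<in> R n \<sigma>)}"
    for b :: "nat \<Rightarrow> nat" and k :: nat
  have D_I: "t \<in> D b k" if "t \<in> space M" "z \<in> C" "\<And>i. i < k \<Longrightarrow> \<sigma> i \<le> b i" "\<And>n. (t, z) \<in> R n \<sigma>"
    for t z b k \<sigma>
    using that unfolding D_def by blast
  have D_E: "\<exists>z\<in>C. \<exists>\<sigma>. (\<forall>i<k. \<sigma> i \<le> b i) \<and> (\<forall>n. (t, z) \<in> R n \<sigma>)" "t \<in> space M"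
    if "t \<in> D b k" for t b k
    using that unfolding D_def by blast+
  have D0: "D b 0 = fst ` (S \<inter> space M \<times> C)" for b
  proof (intro equalityI subsetI)
    fix t assume t: "t \<in> D b 0"
    then obtain z \<sigma> where h: "z \<in> C" "\<forall>n. (t, z) \<in> R n \<sigma>" using D_E(1) by blast
    then have "(t, z) \<in> S \<inter> space M \<times> C" using D_E(2)[OF t] unfolding S by blast
    then show "t \<in> fst ` (S \<inter> space M \<times> C)" by (metis fst_conv image_eqI)
  next
    fix t assume "t \<in> fst ` (S \<inter> space M \<times> C)"
    then obtain z where "(t, z) \<in> S \<inter> space M \<times> C" by auto
    then show "t \<in> D b 0" unfolding S by (auto intro: D_I)
  qed
  have D_sup: "(SUP j. outer_measure_of M (D (b(k := j)) (Suc k))) = outer_measure_of M (D b k)" for b k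
  proof -
    have "incseq (\<lambda>j. D (b(k := j)) (Suc k))"
    proof (rule incseq_SucI, rule subsetI)
      fix j t assume t: "t \<in> D (b(k := j)) (Suc k)"
      then obtain z \<sigma> where h: "z \<in> C" "\<forall>n. (t, z) \<in> R n \<sigma>" "\<forall>i<Suc k. \<sigma> i \<le> (b(k := j)) i"
        using D_E(1) by blast
      show "t \<in> D (b(k := Suc j)) (Suc k)"
      proof (rule D_I[OF D_E(2)[OF t] h(1)])
        fix i assume "i < Suc k"
        with h(3) have "\<sigma> i \<le> (b(k := j)) i" by blast
        then show "\<sigma> i \<le> (b(k := Suc j)) i" by (simp split: if_splits)
      qed (use h in blast)
    qed
    moreover have "(\<Union>j. D (b(k := j)) (Suc k)) = D b k"
    proof (intro equalityI subsetI)
      fix t assume "t \<in> (\<Union>j. D (b(k := j)) (Suc k))"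
      then obtain j where t: "t \<in> D (b(k := j)) (Suc k)" by blast
      then obtain z \<sigma> where h: "z \<in> C" "\<forall>n. (t, z) \<in> R n \<sigma>" "\<forall>i<Suc k. \<sigma> i \<le> (b(k := j)) i"
        using D_E(1) by blast
      show "t \<in> D b k"
      proof (rule D_I[OF D_E(2)[OF t] h(1)])
        fix i assume "i < k"
        then have "i < Suc k" "(b(k := j)) i = b i" by auto
        then show "\<sigma> i \<le> b i" using h(3) by metis
      qed (use h in blast)
    next
      fix t assume t: "t \<in> D b k"
      then obtain z \<sigma> where h: "z \<in> C" "\<forall>n. (t, z) \<in> R n \<sigma>" "\<forall>i<k. \<sigma> i \<le> b i"
        using D_E(1) by blast
      have "t \<in> D (b(k := \<sigma> k)) (Suc k)"
      proof (rule D_I[OF D_E(2)[OF t] h(1)])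
        show "\<sigma> i \<le> (b(k := \<sigma> k)) i" if "i < Suc k" for i
          using that h(3) by (cases "i = k") auto
      qed (use h in blast)
      then show "t \<in> (\<Union>j. D (b(k := j)) (Suc k))" by blast
    qed
    moreover have "D b' k' \<subseteq> space M" for b' k' using D_E(2) by blast
    ultimately show ?thesis
      using SUP_outer_measure_of_incseq[of "\<lambda>j. D (b(k := j)) (Suc k)" M] by simp
  qed
  have "\<exists>B. \<forall>k. c < outer_measure_of M (D (B k) k) \<and> (\<exists>j. B (Suc k) = (B k)(k := j))"
  proof (rule dependent_nat_choice)
    show "\<exists>b. c < outer_measure_of M (D b 0)" using c by (simp add: D0)
  next
    fix b k assume "c < outer_measure_of M (D b k)"
    then have "c < (SUP j. outer_measure_of M (D (b(k := j)) (Suc k)))" by (simp add: D_sup)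
    then obtain j where "c < outer_measure_of M (D (b(k := j)) (Suc k))" by (auto simp: less_SUP_iff)
    then show "\<exists>b'. c < outer_measure_of M (D b' (Suc k)) \<and> (\<exists>j. b' = b(k := j))" by blast
  qed
  then obtain B where B: "\<And>k. c < outer_measure_of M (D (B k) k)" "\<And>k. \<exists>j. B (Suc k) = (B k)(k := j)"
    by blast
  (* B k fixes the bounds of index below k and later choices leave them unchanged *)
  define b where "b i = B (Suc i) i" for i
  have bB: "B k i = b i" if "i < k" for k i
    using that
  proof (induction k)
    case (Suc k)
    obtain j where j: "B (Suc k) = (B k)(k := j)" using B(2) by blast
    show ?case
    proof (cases "i = k")
      case True then show ?thesis by (simp add: b_def)
    next
      case False then show ?thesis using Suc j by simp
    qed
  qed simp
  define Q where "Q k = {t \<in> space M. \<exists>z\<in>C. \<exists>\<sigma>. (\<forall>i. \<sigma> i \<le> b i) \<and> (\<forall>n<k. (t, z) \<in> R n \<sigma>)}" for k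
  have Q_I: "t \<in> Q k" if "t \<in> space M" "z \<in> C" "\<And>i. \<sigma> i \<le> b i" "\<And>n. n < k \<Longrightarrow> (t, z) \<in> R n \<sigma>" for t z k \<sigma>
    using that unfolding Q_def by blast
  have Q_E: "\<exists>z\<in>C. \<exists>\<sigma>. (\<forall>i. \<sigma> i \<le> b i) \<and> (\<forall>n<k. (t, z) \<in> R n \<sigma>)" "t \<in> space M"
    if "t \<in> Q k" for t k
    using that unfolding Q_def by blast+
  have Q_dec: "decseq Q" unfolding decseq_def Q_def by (blast intro: less_le_trans)
  have Q_meas: "Q k \<in> sets M" for k
  proof -
    define L where "L = (\<Sum>n<k. N n)"
    have L: "N n \<le> L" if "n < k" for n unfolding L_def using that by (intro member_le_sum) auto
    define \<Sigma> where "\<Sigma> = {\<sigma>::nat \<Rightarrow> nat. (\<forall>i\<in>{..<L}. \<sigma> i \<in> {..b i}) \<and> (\<forall>i. i \<notin> {..<L} \<longrightarrow> \<sigma> i = 0)}"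
    have fin: "finite \<Sigma>"
    proof -
      have "\<Sigma> \<subseteq> {\<sigma>. \<forall>i. (i \<in> {..<L} \<longrightarrow> \<sigma> i \<in> (\<Union>i<L. {..b i})) \<and> (i \<notin> {..<L} \<longrightarrow> \<sigma> i = 0)}"
        by (auto simp: \<Sigma>_def)
      moreover have "finite \<dots>" by (rule finite_set_of_finite_funs) auto
      ultimately show ?thesis by (rule finite_subset)
    qed
    have "Q k = (\<Union>\<sigma>\<in>\<Sigma>. {t \<in> space M. \<exists>z\<in>C. \<forall>n<k. (t, z) \<in> R n \<sigma>})"
    proof (intro equalityI subsetI)
      fix t assume t: "t \<in> Q k"
      then obtain z \<sigma> where h: "z \<in> C" "\<forall>i. \<sigma> i \<le> b i" "\<forall>n<k. (t, z) \<in> R n \<sigma>"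
        using Q_E(1) by blast
      let ?\<tau> = "\<lambda>i. if i < L then \<sigma> i else 0"
      have "?\<tau> \<in> \<Sigma>" using h by (auto simp: \<Sigma>_def)
      moreover have "(t, z) \<in> R n ?\<tau>" if "n < k" for n
      proof -
        have "R n \<sigma> = R n ?\<tau>" using L[OF that] by (intro N) auto
        then show ?thesis using h(3) that by blast
      qed
      ultimately show "t \<in> (\<Union>\<sigma>\<in>\<Sigma>. {t \<in> space M. \<exists>z\<in>C. \<forall>n<k. (t, z) \<in> R n \<sigma>})"
        using h(1) Q_E(2)[OF t] by blast
    next
      fix t assume "t \<in> (\<Union>\<sigma>\<in>\<Sigma>. {t \<in> space M. \<exists>z\<in>C. \<forall>n<k. (t, z) \<in> R n \<sigma>})"
      then obtain \<sigma> z where h: "\<sigma> \<in> \<Sigma>" "t \<in> space M" "z \<in> C" "\<forall>n<k. (t, z) \<in> R n \<sigma>" by blast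
      have "\<sigma> i \<le> b i" for i using h(1) by (cases "i < L") (auto simp: \<Sigma>_def)
      then show "t \<in> Q k" using h(2-4) by (intro Q_I[of t z \<sigma>]) auto
    qed
    moreover have "{t \<in> space M. \<exists>z\<in>C. \<forall>n<k. (t, z) \<in> R n \<sigma>} \<in> sets M" for \<sigma>
    proof -
      have "\<exists>A F. R n \<sigma> = A \<times> F \<and> A \<in> sets M" for n
        using R[of n \<sigma>] unfolding closed_rectangles_def by blast
      then obtain A F where AF: "\<And>n. R n \<sigma> = A n \<times> F n" "\<And>n. A n \<in> sets M"
        by metis
      have "{t \<in> space M. \<exists>z\<in>C. \<forall>n<k. (t, z) \<in> R n \<sigma>} =
          (if \<exists>z\<in>C. \<forall>n<k. z \<in> F n then {t \<in> space M. \<forall>n\<in>{..<k}. t \<in> A n} else {})"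
        by (auto simp: AF(1))
      then show ?thesis using AF(2) by simp
    qed
    ultimately show ?thesis using fin by auto
  qed
  have c_le: "c \<le> emeasure M (Q k)" for k
  proof -
    define L where "L = (\<Sum>n<k. N n)"
    have L: "N n \<le> L" if "n < k" for n unfolding L_def using that by (intro member_le_sum) auto
    have "D (B L) L \<subseteq> Q k"
    proof
      fix t assume t: "t \<in> D (B L) L"
      then obtain z \<sigma> where h: "z \<in> C" "\<forall>i<L. \<sigma> i \<le> B L i" "\<forall>n. (t, z) \<in> R n \<sigma>"
        using D_E(1) by blast
      let ?\<tau> = "\<lambda>i. if i < L then \<sigma> i else 0"
      show "t \<in> Q k"
      proof (rule Q_I[OF D_E(2)[OF t] h(1)])
        show "?\<tau> i \<le> b i" for i using h(2) bB by auto
        fix n assume "n < k"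
        have "R n \<sigma> = R n ?\<tau>" using L[OF \<open>n < k\<close>] by (intro N) auto
        then show "(t, z) \<in> R n ?\<tau>" using h(3) by blast
      qed
    qed
    then have "outer_measure_of M (D (B L) L) \<le> emeasure M (Q k)"
      using outer_measure_of_mono[of _ "Q k" M] Q_meas by simp
    then show ?thesis using B(1)[of L] by simp
  qed
  have "c \<le> emeasure M (\<Inter>k. Q k)"
  proof -
    have "c \<le> (INF k. emeasure M (Q k))" using c_le by (rule INF_greatest)
    also have "\<dots> = emeasure M (\<Inter>k. Q k)"
      using Q_meas Q_dec by (intro INF_emeasure_decseq) (auto simp: emeasure_finite)
    finally show ?thesis .
  qed
  moreover have "(\<Inter>k. Q k) \<subseteq> fst ` (S \<inter> space M \<times> C)"
  proof
    fix t assume t: "t \<in> (\<Inter>k. Q k)"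
    define W where "W k x \<longleftrightarrow> fst x \<in> C \<and> (\<forall>i. snd x i \<le> b i) \<and> (\<forall>n<k. (t, fst x) \<in> R n (snd x))"
      for k and x :: "'b \<times> (nat \<Rightarrow> nat)"
    have "\<exists>x. W k x" for k
    proof -
      obtain z \<sigma> where "z \<in> C" "\<forall>i. \<sigma> i \<le> b i" "\<forall>n<k. (t, z) \<in> R n \<sigma>" 
        using Q_E(1)[of t k] t by blast
      then have "W k (z, \<sigma>)" by (simp add: W_def)
      then show ?thesis by blast
    qed
    then obtain X where X: "\<And>k. W k (X k)" by metis
    define Z where "Z k = fst (X k)" for k
    define \<Sigma> where "\<Sigma> k = snd (X k)" for k
    have Z: "Z k \<in> C" "\<forall>i. \<Sigma> k i \<le> b i" "n < k \<Longrightarrow> (t, Z k) \<in> R n (\<Sigma> k)" for k n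
      using X[of k] unfolding W_def Z_def \<Sigma>_def by blast+
    have cpt: "seq_compact (C \<times> {\<sigma>::nat \<Rightarrow> nat. \<forall>i. \<sigma> i \<le> b i})"
      by (intro compact_imp_seq_compact compact_Times C compact_nat_box)
    have "(Z k, \<Sigma> k) \<in> C \<times> {\<sigma>. \<forall>i. \<sigma> i \<le> b i}" for k using Z by simp
    then have "\<exists>l\<in>C \<times> {\<sigma>. \<forall>i. \<sigma> i \<le> b i}. \<exists>r. strict_mono (r::nat \<Rightarrow> nat) \<and> ((\<lambda>k. (Z k, \<Sigma> k)) \<circ> r) \<longlonglongrightarrow> l"
      by (rule cpt[unfolded seq_compact_def, rule_format])
    then obtain l and r :: "nat \<Rightarrow> nat" where l: "l \<in> C \<times> {\<sigma>. \<forall>i. \<sigma> i \<le> b i}" and r: "strict_mono r"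
      and lim: "((\<lambda>k. (Z k, \<Sigma> k)) \<circ> r) \<longlonglongrightarrow> l"
      by blast
    obtain z \<sigma> where l_eq: "l = (z, \<sigma>)" by fastforce
    have Zlim: "(\<lambda>k. Z (r k)) \<longlonglongrightarrow> z" using tendsto_fst[OF lim] by (simp add: o_def l_eq)
    have "(\<lambda>k. \<Sigma> (r k)) \<longlonglongrightarrow> \<sigma>" using tendsto_snd[OF lim] by (simp add: o_def l_eq)
    then have "(\<lambda>k. \<Sigma> (r k) i) \<longlonglongrightarrow> \<sigma> i" for i 
      using continuous_on_tendsto_compose[OF continuous_on_product_coordinates[of i]] by auto
    then have ev: "eventually (\<lambda>k. \<Sigma> (r k) i = \<sigma> i) sequentially" for i
      by (simp add: nhds_discrete filterlim_principal)
    have "(t, z) \<in> R n \<sigma>" for n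
    proof -
      obtain A F where AF: "R n \<sigma> = A \<times> F" "closed F" using R[of n \<sigma>] by (auto simp: closed_rectangles_def)
      have "eventually (\<lambda>k. \<forall>i\<in>{..<N n}. \<Sigma> (r k) i = \<sigma> i) sequentially"
        by (intro eventually_ball_finite) (auto simp: ev)
      then have *: "eventually (\<lambda>k. (t, Z (r k)) \<in> A \<times> F) sequentially"
        using eventually_gt_at_top[of n]
      proof eventually_elim
        case (elim k)
        have "R n (\<Sigma> (r k)) = R n \<sigma>" using elim by (intro N) auto
        then show ?case using Z(3)[of n "r k"] elim seq_suble[OF r, of k] AF by simp
      qed
      then have "z \<in> F"
        by (intro Lim_in_closed_set[OF AF(2) _ _ Zlim]) (auto elim: eventually_mono)
      moreover have "t \<in> A" using eventually_happens'[OF _ *] by auto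
      ultimately show ?thesis by (simp add: AF)
    qed
    moreover have "t \<in> space M" "z \<in> C" using t l by (auto simp: Q_def l_eq)
    ultimately have "(t, z) \<in> S \<inter> space M \<times> C" unfolding S by blast
    then show "t \<in> fst ` (S \<inter> space M \<times> C)" by (metis fst_conv image_eqI)
  qed
  ultimately show ?thesis using Q_meas by (intro bexI[of _ "\<Inter>k. Q k"]) auto
qed

text \<open>
  The projection has a measurable hull of the same outer measure and, by inner approximation, contains
  a measurable set of that measure. The difference is null, and completeness finishes the proof. The
  fibre is exhausted by balls to reduce to a compact one.
\<close>

theorem measurable_projection:
  assumes M: "finite_measure M" "complete_measure M"
    and S: "S \<in> sets (M \<Otimes>\<^sub>M (borel :: 'b::euclidean_space measure))"
  shows "fst ` S \<in> sets M"
proof -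
  interpret finite_measure M by fact
  interpret complete_measure M by fact
  have sub: "S \<subseteq> space M \<times> UNIV" using sets.sets_into_space[OF S] by (simp add: space_pair_measure)
  have bdd: "fst ` (S \<inter> space M \<times> C) \<in> sets M" if C: "compact C" for C
  proof -
    define D where "D = fst ` (S \<inter> space M \<times> C)"
    have D_sub: "D \<subseteq> space M" by (auto simp: D_def)
    obtain U where U: "U \<in> sets M" "D \<subseteq> U" "outer_measure_of M D = emeasure M U"
      using outer_measure_of_attain[OF D_sub] by blast
    have "\<exists>L\<in>sets M. L \<subseteq> D \<and> emeasure M U \<le> emeasure M L"
    proof (cases "emeasure M U = 0")
      case True then show ?thesis by (intro bexI[of _ "{}"]) auto
    next
      case False
      then obtain c :: "nat \<Rightarrow> ennreal" where c: "\<And>n. c n < emeasure M U" "c \<longlonglongrightarrow> emeasure M U"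
        using approx_from_below_dense_linorder[of 0 "emeasure M U"] zero_less_iff_neq_zero by metis
      have "\<exists>K\<in>sets M. K \<subseteq> D \<and> c n \<le> emeasure M K" for n
        using suslin_projection_inner_approx[OF M(1) suslin_measurable[OF S] C, of "c n"] c(1)[of n] U(3)
        by (simp add: D_def)
      then obtain K where K: "\<And>n. K n \<in> sets M" "\<And>n. K n \<subseteq> D" "\<And>n. c n \<le> emeasure M (K n)" by metis
      have "c n \<le> emeasure M (\<Union>n. K n)" for n
        using K by (intro order_trans[OF K(3)] emeasure_mono) auto
      then have "emeasure M U \<le> emeasure M (\<Union>n. K n)"
        using c(2) by (intro LIMSEQ_le_const2) auto
      then show ?thesis using K by (intro bexI[of _ "\<Union>n. K n"]) auto
    qed
    then obtain L where L: "L \<in> sets M" "L \<subseteq> D" "emeasure M U \<le> emeasure M L" by blast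
    have "emeasure M (U - L) = 0"
      using L U by (subst emeasure_Diff) (auto simp: diff_eq_0_iff_ennreal less_top[symmetric])
    then have "U - L \<in> null_sets M" using U L by auto
    then have "D - L \<in> sets M" using U by (intro complete[of "D - L" "U - L"]) auto
    then have "L \<union> (D - L) \<in> sets M" using L by blast
    moreover have "L \<union> (D - L) = D" using L by auto
    ultimately show ?thesis by (simp add: D_def)
  qed
  have "fst ` S = (\<Union>n::nat. fst ` (S \<inter> space M \<times> cball 0 (real n)))"
  proof (intro equalityI subsetI)
    fix t assume "t \<in> fst ` S"
    then obtain z where z: "(t, z) \<in> S" by auto
    obtain n where "norm z \<le> real n" using real_arch_simple by blast
    then show "t \<in> (\<Union>n::nat. fst ` (S \<inter> space M \<times> cball 0 (real n)))" using z sub by force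
  qed auto
  then show ?thesis using bdd[OF compact_cball] by auto
qed

section \<open>Measurable selections\<close>

text \<open>
  One step of a lexicographic selection: keep the points of each section at which the coordinate
  along \<open>i\<close> is minimal. The minimal value is measurable because its sublevel sets are projections.
\<close>

lemma coordinate_refinement:
  fixes S :: "('t \<times> 'b::euclidean_space) set"
  assumes M: "finite_measure M" "complete_measure M"
    and S: "S \<in> sets (M \<Otimes>\<^sub>M borel)"
    and cpt: "\<And>t. t \<in> space M \<Longrightarrow> compact {z. (t, z) \<in> S}"
  shows "\<exists>S' g. S' \<in> sets (M \<Otimes>\<^sub>M borel) \<and> S' \<subseteq> S \<and> fst ` S' = fst ` S \<and>
     (\<forall>t\<in>space M. compact {z. (t, z) \<in> S'}) \<and>
     g \<in> borel_measurable M \<and> (\<forall>(t, z)\<in>S'. z \<bullet> i = (g t :: real))"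
proof -
  have sub: "S \<subseteq> space M \<times> UNIV" using sets.sets_into_space[OF S] by (simp add: space_pair_measure)
  define D where "D = fst ` S"
  have D: "D \<in> sets M" unfolding D_def by (rule measurable_projection[OF M S])
  define g where "g t = (if t \<in> D then Inf ((\<lambda>z. z \<bullet> i) ` {z. (t, z) \<in> S}) else 0)" for t
  have cpt_img: "compact ((\<lambda>z. z \<bullet> i) ` {z. (t, z) \<in> S})" if "t \<in> space M" for t
    by (intro compact_continuous_image cpt[OF that] continuous_intros)
  have g_less: "g t < c \<longleftrightarrow> (\<exists>z. (t, z) \<in> S \<and> z \<bullet> i < c)" if "t \<in> D" for t c
  proof -
    have t: "t \<in> space M" using that sub by (auto simp: D_def)
    have "Inf ((\<lambda>z. z \<bullet> i) ` {z. (t, z) \<in> S}) < c \<longleftrightarrow> (\<exists>y\<in>(\<lambda>z. z \<bullet> i) ` {z. (t, z) \<in> S}. y < c)"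
      using that by (intro cInf_less_iff compact_imp_bounded bounded_imp_bdd_below cpt_img[OF t]) (auto simp: D_def)
    then show ?thesis using that by (auto simp: g_def)
  qed
  have g_meas: "g \<in> borel_measurable M"
  proof (rule borel_measurableI_less)
    fix c
    have "S \<inter> {x \<in> space (M \<Otimes>\<^sub>M borel). snd x \<bullet> i < c} \<in> sets (M \<Otimes>\<^sub>M borel)"
      by (intro sets.Int S) measurable
    then have "fst ` (S \<inter> {x \<in> space (M \<Otimes>\<^sub>M borel). snd x \<bullet> i < c}) \<in> sets M"
      by (rule measurable_projection[OF M])
    moreover have "{t \<in> space M. g t < c} = fst ` (S \<inter> {x \<in> space (M \<Otimes>\<^sub>M borel). snd x \<bullet> i < c})
        \<union> (if 0 < c then space M - D else {})"
      (is "_ = fst ` ?X \<union> ?Y")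
    proof (intro set_eqI)
      fix t
      have X: "t \<in> fst ` ?X \<longleftrightarrow> (\<exists>z. (t, z) \<in> S \<and> z \<bullet> i < c)"
        using sub by (force simp: space_pair_measure image_iff)
      show "t \<in> {t \<in> space M. g t < c} \<longleftrightarrow> t \<in> fst ` ?X \<union> ?Y"
      proof (cases "t \<in> D")
        case True
        then have "t \<in> space M" using sub by (auto simp: D_def)
        then show ?thesis using True X g_less[OF True, of c] by simp
      next
        case False
        then have "\<not> (\<exists>z. (t, z) \<in> S \<and> z \<bullet> i < c)" by (force simp: D_def)
        then show ?thesis unfolding X Un_iff using False by (auto simp: g_def)
      qed
    qed
    ultimately show "{t \<in> space M. g t < c} \<in> sets M" using D by auto
  qed
  define S' where "S' = S \<inter> {x \<in> space (M \<Otimes>\<^sub>M borel). snd x \<bullet> i = g (fst x)}"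
  note [measurable] = g_meas
  have "S' \<in> sets (M \<Otimes>\<^sub>M borel)"
    unfolding S'_def by (intro sets.Int S) measurable
  moreover have "fst ` S' = fst ` S"
  proof (intro equalityI subsetI)
    fix t assume "t \<in> fst ` S"
    then obtain z0 where z0: "(t, z0) \<in> S" by auto
    then have t: "t \<in> space M" "t \<in> D" using sub by (auto simp: D_def image_iff intro: bexI[of _ "(t, z0)"])
    have "\<exists>z\<in>{z. (t, z) \<in> S}. \<forall>y\<in>{z. (t, z) \<in> S}. z \<bullet> i \<le> y \<bullet> i"
      by (rule continuous_attains_inf[OF cpt[OF t(1)]]) (use z0 in \<open>auto intro!: continuous_intros\<close>)
    then obtain z where z: "(t, z) \<in> S" "\<And>z'. (t, z') \<in> S \<Longrightarrow> z \<bullet> i \<le> z' \<bullet> i"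
      by blast
    have "g t = z \<bullet> i" unfolding g_def using t z by (auto intro!: cInf_eq_minimum)
    then have "(t, z) \<in> S'" using z t by (auto simp: S'_def space_pair_measure)
    then show "t \<in> fst ` S'" by force
  qed (auto simp: S'_def)
  moreover have "compact {z. (t, z) \<in> S'}" if t: "t \<in> space M" for t
  proof -
    have "{z. (t, z) \<in> S'} = {z. (t, z) \<in> S} \<inter> {z. z \<bullet> i = g t}"
      using t by (auto simp: S'_def space_pair_measure)
    moreover have "closed {z. z \<bullet> i = g t}" by (intro closed_Collect_eq continuous_intros)
    ultimately show ?thesis using cpt[OF t] by (simp add: compact_Int_closed)
  qed
  moreover have "S' \<subseteq> S" "\<forall>(t, z)\<in>S'. z \<bullet> i = g t" by (auto simp: S'_def)
  ultimately show ?thesis using g_meas by blast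
qed

text \<open>
  After all basis coordinates have been minimized in turn, each section consists of a single point
  whose coordinates are measurable functions.
\<close>

theorem measurable_selection_compact:
  fixes S :: "('t \<times> 'b::euclidean_space) set"
  assumes M: "finite_measure M" "complete_measure M"
    and S: "S \<in> sets (M \<Otimes>\<^sub>M borel)"
    and cpt: "\<And>t. t \<in> space M \<Longrightarrow> compact {z. (t, z) \<in> S}"
  shows "\<exists>s\<in>borel_measurable M. \<forall>t\<in>fst ` S. (t, s t) \<in> S"
proof -
  have "\<exists>S' g. S' \<in> sets (M \<Otimes>\<^sub>M borel) \<and> S' \<subseteq> S \<and> fst ` S' = fst ` S \<and>
     (\<forall>t\<in>space M. compact {z. (t, z) \<in> S'}) \<and>
     (\<forall>i\<in>F. g i \<in> borel_measurable M) \<and> (\<forall>i\<in>F. \<forall>(t, z)\<in>S'. z \<bullet> i = (g i t :: real))"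
    if "finite F" for F :: "'b set"
    using that
  proof induction
    case empty
    then show ?case using S cpt by (intro exI[of _ S]) auto
  next
    case (insert i F)
    then obtain S1 g1 where 1: "S1 \<in> sets (M \<Otimes>\<^sub>M borel)" "S1 \<subseteq> S" "fst ` S1 = fst ` S"
      "\<forall>t\<in>space M. compact {z. (t, z) \<in> S1}" "\<forall>i\<in>F. g1 i \<in> borel_measurable M"
      "\<forall>i\<in>F. \<forall>(t, z)\<in>S1. z \<bullet> i = (g1 i t :: real)" by auto
    obtain S2 g2 where 2: "S2 \<in> sets (M \<Otimes>\<^sub>M borel)" "S2 \<subseteq> S1" "fst ` S2 = fst ` S1"
     "\<forall>t\<in>space M. compact {z. (t, z) \<in> S2}" "g2 \<in> borel_measurable M" "\<forall>(t, z)\<in>S2. z \<bullet> i = (g2 t :: real)"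
      using coordinate_refinement[OF M 1(1), of i] 1(4) by auto
    have a: "(g1(i := g2)) k \<in> borel_measurable M" if "k \<in> insert i F" for k
      using that 1(5) 2(5) by (cases "k = i") auto
    have b: "\<forall>(t, z)\<in>S2. z \<bullet> k = (g1(i := g2)) k t" if "k \<in> insert i F" for k
    proof (cases "k = i")
      case False
      then have "k \<in> F" using that by simp
      then have "\<forall>(t, z)\<in>S1. z \<bullet> k = g1 k t" using 1(6) by blast
      then show ?thesis using 2(2) False by auto
    qed (use 2(6) in simp)
    have c: "S2 \<subseteq> S" "fst ` S2 = fst ` S" using 1(2,3) 2(2,3) by auto
    show ?case by (intro exI[of _ S2] exI[of _ "g1(i := g2)"] conjI ballI[OF a] ballI[OF b] c 2(1,4))
  qed
  from this[OF finite_Basis] obtain S' and g :: "'b \<Rightarrow> 't \<Rightarrow> real" where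
    S': "S' \<subseteq> S" "fst ` S' = fst ` S" and g: "\<forall>i\<in>Basis. g i \<in> borel_measurable M"
    and gS_ball: "\<forall>i\<in>Basis. \<forall>(t, z)\<in>S'. z \<bullet> i = g i t"
    by (elim exE conjE) (rule that; assumption)
  have gS: "z \<bullet> i = g i t" if "i \<in> Basis" "(t, z) \<in> S'" for i t z
    using bspec[OF bspec[OF gS_ball that(1)] that(2)] by simp
  define s where "s t = (\<Sum>i\<in>Basis. g i t *\<^sub>R i)" for t
  have "s \<in> borel_measurable M" unfolding s_def using g by (intro borel_measurable_sum) auto
  moreover have "(t, s t) \<in> S" if "t \<in> fst ` S" for t
  proof -
    obtain z where z: "(t, z) \<in> S'" using \<open>t \<in> fst ` S\<close> S'(2) by force
    have "s t = (\<Sum>i\<in>Basis. (z \<bullet> i) *\<^sub>R i)" unfolding s_def using gS[OF _ z] by (intro sum.cong) auto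
    then have "s t = z" by (simp add: euclidean_representation)
    then show ?thesis using z S'(1) by auto
  qed
  ultimately show ?thesis by blast
qed

section \<open>Measurable minimizers of lower semicontinuous integrands\<close>

definition seq_lsc :: "('a::topological_space \<Rightarrow> ennreal) \<Rightarrow> bool" where
  "seq_lsc f \<longleftrightarrow> (\<forall>u l. u \<longlonglongrightarrow> l \<longrightarrow> f l \<le> liminf (\<lambda>j. f (u j)))"

lemma seq_lscD: "seq_lsc f \<Longrightarrow> u \<longlonglongrightarrow> l \<Longrightarrow> f l \<le> liminf (\<lambda>j. f (u j))"
  by (simp only: seq_lsc_def)

definition lsc_integrand :: "'t measure \<Rightarrow> ('t \<Rightarrow> 'a::euclidean_space \<Rightarrow> ennreal) \<Rightarrow> bool" where
  "lsc_integrand M G \<longleftrightarrow>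
     (\<lambda>x. G (fst x) (snd x)) \<in> borel_measurable (M \<Otimes>\<^sub>M borel) \<and> (\<forall>t\<in>space M. seq_lsc (G t))"

text \<open>
  The direct method of the calculus of variations with penalties that vary along the sequence. The
  penalties make the sequence bounded, and lower semicontinuity passes to the limit of a subsequence.
\<close>

lemma seq_lsc_penalized_limit:
  fixes z :: "nat \<Rightarrow> 'a::euclidean_space"
  assumes f: "seq_lsc f"
    and le: "\<And>j. f (z j) + ennreal (\<rho> j) \<le> c j"
    and c: "c \<longlonglongrightarrow> c0" "c0 < \<infinity>"
    and coercive: "\<And>C. \<exists>K. \<forall>j. \<rho> j \<le> C \<longrightarrow> norm (z j) \<le> K"
    and cont: "\<And>\<sigma> l. strict_mono \<sigma> \<Longrightarrow> (\<lambda>j. z (\<sigma> j)) \<longlonglongrightarrow> l \<Longrightarrow> (\<lambda>j. \<rho> (\<sigma> j)) \<longlonglongrightarrow> P l"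
  shows "\<exists>\<sigma> l. strict_mono \<sigma> \<and> (\<lambda>j. z (\<sigma> j)) \<longlonglongrightarrow> l \<and> f l + ennreal (P l) \<le> c0"
proof -
  have "c0 < c0 + 1" using c(2) by (metis add_0_right ennreal_add_left_cancel_less infinity_ennreal_def zero_less_one)
  then have "eventually (\<lambda>j. c j < c0 + 1) sequentially" using c(1) by (simp add: order_tendsto_iff)
  then obtain J where J: "\<And>j. J \<le> j \<Longrightarrow> c j < c0 + 1" by (auto simp: eventually_sequentially)
  obtain K where K: "\<And>j. \<rho> j \<le> enn2real (c0 + 1) \<Longrightarrow> norm (z j) \<le> K"
    using coercive by blast
  have "norm (z (j + J)) \<le> K" for j
  proof (rule K)
    have "ennreal (\<rho> (j + J)) \<le> f (z (j + J)) + ennreal (\<rho> (j + J))" by simp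
    also have "\<dots> \<le> c (j + J)" by (rule le)
    also have "\<dots> \<le> c0 + 1" using J[of "j + J"] by simp
    also have "\<dots> = ennreal (enn2real (c0 + 1))" using c(2) by (simp add: less_top)
    finally show "\<rho> (j + J) \<le> enn2real (c0 + 1)" by (simp add: ennreal_le_iff)
  qed
  then have "bounded (range (\<lambda>j. z (j + J)))" by (auto simp: bounded_iff)
  then obtain l r where r: "strict_mono (r :: nat \<Rightarrow> nat)" "((\<lambda>j. z (j + J)) \<circ> r) \<longlonglongrightarrow> l"
    using bounded_imp_convergent_subsequence by blast
  define \<sigma> where "\<sigma> j = r j + J" for j
  have \<sigma>: "strict_mono \<sigma>" "(\<lambda>j. z (\<sigma> j)) \<longlonglongrightarrow> l"
    using r by (auto simp: \<sigma>_def strict_mono_def o_def)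
  have \<rho>: "(\<lambda>j. ennreal (\<rho> (\<sigma> j))) \<longlonglongrightarrow> ennreal (P l)"
    by (intro tendsto_ennrealI cont \<sigma>)
  have c\<sigma>: "(\<lambda>j. c (\<sigma> j)) \<longlonglongrightarrow> c0" using LIMSEQ_subseq_LIMSEQ[OF c(1) \<sigma>(1)] by (simp add: o_def)
  have liminf: "f l \<le> liminf (\<lambda>j. f (z (\<sigma> j)))" using f \<sigma>(2) by (simp add: seq_lsc_def)
  have *: "d + ennreal (P l) \<le> c0" if "d < f l" for d
  proof (rule LIMSEQ_le)
    show "(\<lambda>j. d + ennreal (\<rho> (\<sigma> j))) \<longlonglongrightarrow> d + ennreal (P l)"
      by (intro tendsto_add tendsto_const \<rho>)
    show "(\<lambda>j. c (\<sigma> j)) \<longlonglongrightarrow> c0" by fact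
    have "eventually (\<lambda>j. d < f (z (\<sigma> j))) sequentially"
      using less_le_trans[OF that liminf] by (simp add: less_LiminfD)
    then have "eventually (\<lambda>j. d + ennreal (\<rho> (\<sigma> j)) \<le> c (\<sigma> j)) sequentially"
    proof eventually_elim
      case (elim j)
      then have "d + ennreal (\<rho> (\<sigma> j)) \<le> f (z (\<sigma> j)) + ennreal (\<rho> (\<sigma> j))" by (intro add_right_mono) simp
      then show ?case using le order_trans by blast
    qed
    then show "\<exists>N. \<forall>j\<ge>N. d + ennreal (\<rho> (\<sigma> j)) \<le> c (\<sigma> j)" by (simp add: eventually_sequentially)
  qed
  have "f l + ennreal (P l) \<le> c0"
  proof (cases "f l = 0")
    case True
    have "ennreal (P l) \<le> c0"
    proof (rule LIMSEQ_le[OF \<rho> c\<sigma>])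
      have "ennreal (\<rho> j) \<le> c j" for j by (rule order_trans[OF _ le]) simp
      then show "\<exists>N. \<forall>n\<ge>N. ennreal (\<rho> (\<sigma> n)) \<le> c (\<sigma> n)" by blast
    qed
    then show ?thesis using True by simp
  next
    case False
    have "f l \<le> c0 - ennreal (P l)"
    proof (rule dense_le)
      fix d assume "d < f l"
      from *[OF this] show "d \<le> c0 - ennreal (P l)"
        by (metis add.commute ennreal_le_minus_iff ennreal_minus_if ennreal_neq_top le_add_same_cancel1 order_trans top_neq_ennreal zero_le ennreal_add_diff_cancel_right ennreal_minus_mono order_refl)
    qed
    moreover have "ennreal (P l) \<le> c0"
      using *[of 0] False by (simp add: zero_less_iff_neq_zero)
    ultimately show ?thesis
      by (metis add.commute add_left_mono ennreal_add_diff_cancel_right diff_add_cancel_ennreal)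
  qed
  then show ?thesis using \<sigma> by blast
qed

lemma attained_limit_of_values:
  fixes f :: "'a::euclidean_space \<Rightarrow> ennreal"
  assumes f: "seq_lsc f" and P: "continuous_on UNIV P" and coercive: "\<And>C. bounded {z. P z \<le> C}"
    and le: "\<And>j. f (z j) + ennreal (P (z j)) \<le> c j" and c: "c \<longlonglongrightarrow> c0" "c0 < \<infinity>"
  shows "\<exists>\<sigma> l. strict_mono \<sigma> \<and> (\<lambda>j. z (\<sigma> j)) \<longlonglongrightarrow> l \<and> f l + ennreal (P l) \<le> c0"
proof (rule seq_lsc_penalized_limit[OF f le c])
  fix C show "\<exists>K. \<forall>j. P (z j) \<le> C \<longrightarrow> norm (z j) \<le> K"
    using coercive[of C] by (auto simp: bounded_iff)
next
  fix \<sigma> l assume "(\<lambda>j. z (\<sigma> j)) \<longlonglongrightarrow> l"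
  then show "(\<lambda>j. P (z (\<sigma> j))) \<longlonglongrightarrow> P l"
    using P continuous_on_tendsto_compose[of UNIV P] by auto
qed

text \<open>
  Minimizers exist by the direct method and form compact sections wherever the minimum is finite; where
  it is infinite every point is a minimizer. The minimum is measurable by the projection theorem, hence
  so is the set of minimizers, and a selection from it exists.
\<close>

theorem measurable_argmin:
  fixes G :: "'t \<Rightarrow> 'b::euclidean_space \<Rightarrow> ennreal"
  assumes M: "finite_measure M" "complete_measure M" and G: "lsc_integrand M G"
    and P_meas: "(\<lambda>x. P (fst x) (snd x)) \<in> borel_measurable (M \<Otimes>\<^sub>M borel)"
    and P: "\<And>t. t \<in> space M \<Longrightarrow> continuous_on UNIV (P t)"
    and coercive: "\<And>t C. t \<in> space M \<Longrightarrow> bounded {z. P t z \<le> C}"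
  shows "\<exists>s\<in>borel_measurable M. \<forall>t\<in>space M. \<forall>z.
     G t (s t) + ennreal (P t (s t)) \<le> G t z + ennreal (P t z)"
proof -
  define H where "H t z = G t z + ennreal (P t z)" for t z
  define m where "m t = (INF z. H t z)" for t
  have H_meas: "(\<lambda>x. H (fst x) (snd x)) \<in> borel_measurable (M \<Otimes>\<^sub>M borel)"
    using G P_meas unfolding lsc_integrand_def H_def by (intro borel_measurable_add) auto
  have lsc: "seq_lsc (G t)" if "t \<in> space M" for t using G that by (simp add: lsc_integrand_def)
  have m_meas: "m \<in> borel_measurable M"
  proof (rule borel_measurableI_less)
    fix c
    have "{x \<in> space (M \<Otimes>\<^sub>M borel). H (fst x) (snd x) < c} \<in> sets (M \<Otimes>\<^sub>M borel)"
      using H_meas by measurable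
    then have "fst ` {x \<in> space (M \<Otimes>\<^sub>M borel). H (fst x) (snd x) < c} \<in> sets M"
      by (rule measurable_projection[OF M])
    moreover have "{t \<in> space M. m t < c} = fst ` {x \<in> space (M \<Otimes>\<^sub>M borel). H (fst x) (snd x) < c}"
    proof (intro equalityI subsetI)
      fix t assume "t \<in> {t \<in> space M. m t < c}"
      then obtain z where "t \<in> space M" "H t z < c" by (auto simp: m_def INF_less_iff)
      then have "(t, z) \<in> {x \<in> space (M \<Otimes>\<^sub>M borel). H (fst x) (snd x) < c}" by (simp add: space_pair_measure)
      then show "t \<in> fst ` {x \<in> space (M \<Otimes>\<^sub>M borel). H (fst x) (snd x) < c}" by (rule image_eqI[rotated]) simp
    qed (auto simp: m_def INF_less_iff space_pair_measure)
    ultimately show "{t \<in> space M. m t < c} \<in> sets M" by simp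
  qed
  define S where "S = {x \<in> space (M \<Otimes>\<^sub>M borel). m (fst x) < \<infinity> \<and> H (fst x) (snd x) \<le> m (fst x)}"
  have S_meas: "S \<in> sets (M \<Otimes>\<^sub>M borel)" unfolding S_def using H_meas m_meas by measurable
  have S_iff: "(t, z) \<in> S \<longleftrightarrow> t \<in> space M \<and> m t < \<infinity> \<and> H t z \<le> m t" for t z
    by (auto simp: S_def space_pair_measure)
  have "compact {z. (t, z) \<in> S}" if t: "t \<in> space M" for t
  proof (cases "m t < \<infinity>")
    case fin: True
    have "{z. (t, z) \<in> S} \<subseteq> {z. P t z \<le> enn2real (m t)}"
    proof clarify
      fix z assume "(t, z) \<in> S"
      then have "H t z \<le> m t" by (simp add: S_iff)
      then have "ennreal (P t z) \<le> m t"
        unfolding H_def by (rule order_trans[rotated]) simp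
      also have "\<dots> = ennreal (enn2real (m t))" using fin by (simp add: less_top)
      finally show "P t z \<le> enn2real (m t)" by (simp add: ennreal_le_iff)
    qed
    then have "bounded {z. (t, z) \<in> S}" using coercive[OF t] bounded_subset by blast
    moreover have "closed {z. (t, z) \<in> S}"
      unfolding closed_sequential_limits
    proof (intro allI impI, elim conjE)
      fix z l assume z: "\<forall>n. z n \<in> {z. (t, z) \<in> S}" and lim: "z \<longlonglongrightarrow> l"
      have "\<exists>\<sigma> l. strict_mono \<sigma> \<and> (\<lambda>j. z (\<sigma> j)) \<longlonglongrightarrow> l \<and> G t l + ennreal (P t l) \<le> m t"
        by (rule attained_limit_of_values[OF lsc[OF t] P[OF t] coercive[OF t] _ tendsto_const fin])
          (use z in \<open>auto simp: S_iff H_def\<close>)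
      then obtain \<sigma> l' where *: "strict_mono \<sigma>" "(\<lambda>j. z (\<sigma> j)) \<longlonglongrightarrow> l'" "G t l' + ennreal (P t l') \<le> m t"
        by blast
      have "l' = l" using LIMSEQ_subseq_LIMSEQ[OF lim *(1)] *(2) LIMSEQ_unique by (auto simp: o_def)
      then show "l \<in> {z. (t, z) \<in> S}" using * t fin by (simp add: S_iff H_def)
    qed
    ultimately show ?thesis by (simp add: compact_eq_bounded_closed)
  qed (simp add: S_iff)
  from measurable_selection_compact[OF M S_meas this] obtain s where
    s: "s \<in> borel_measurable M" "\<And>t. t \<in> fst ` S \<Longrightarrow> (t, s t) \<in> S" by blast
  have "H t (s t) \<le> H t y" if t: "t \<in> space M" for t y
  proof (cases "m t < \<infinity>")
    case fin: True
    obtain u where u: "\<And>n. u n \<in> range (H t)" "u \<longlonglongrightarrow> m t"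
      using Inf_as_limit[of "range (H t)"] by (auto simp: m_def)
    then have "\<exists>z. u n = H t z" for n by blast
    then obtain z where z: "\<And>n::nat. u n = H t (z n)" by metis
    have "\<exists>\<sigma> l. strict_mono \<sigma> \<and> (\<lambda>j. z (\<sigma> j)) \<longlonglongrightarrow> l \<and> G t l + ennreal (P t l) \<le> m t"
      by (rule attained_limit_of_values[OF lsc[OF t] P[OF t] coercive[OF t] _ u(2) fin])
        (use z in \<open>auto simp: H_def\<close>)
    then obtain l where "(t, l) \<in> S" using t fin by (auto simp: S_iff H_def)
    then have "(t, s t) \<in> S" using s(2)[of t] by force
    then have "H t (s t) \<le> m t" by (simp add: S_iff)
    also have "\<dots> \<le> H t y" unfolding m_def by (rule INF_lower) simp
    finally show ?thesis .
  next
    case False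
    moreover have "m t \<le> H t y" unfolding m_def by (rule INF_lower) simp
    ultimately have "H t y = \<infinity>" by (simp add: less_top[symmetric] top_unique)
    then show ?thesis by simp
  qed
  then have "\<forall>t\<in>space M. \<forall>z. G t (s t) + ennreal (P t (s t)) \<le> G t z + ennreal (P t z)"
    unfolding H_def by blast
  then show ?thesis using s(1) by (rule bexI)
qed

section \<open>Smooth approximations of the norm\<close>

text \<open>
  For \<open>s > 0\<close> this is smooth with gradient of norm at most one, and it differs from the norm by at most
  \<open>s\<close>. The value \<open>s = 0\<close> gives the norm itself.
\<close>

definition smooth_norm :: "real \<Rightarrow> 'a::euclidean_space \<Rightarrow> real" where
  "smooth_norm s u = sqrt ((norm u)\<^sup>2 + s\<^sup>2) - s"

lemma smooth_norm_zero [simp]: "0 \<le> s \<Longrightarrow> smooth_norm s 0 = 0" "smooth_norm 0 u = norm u"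
  by (auto simp: smooth_norm_def)

lemma smooth_norm_bounds:
  assumes "0 \<le> s"
  shows "0 \<le> smooth_norm s u" "smooth_norm s u \<le> norm u" "norm u - s \<le> smooth_norm s u"
proof -
  have "sqrt (s\<^sup>2) \<le> sqrt ((norm u)\<^sup>2 + s\<^sup>2)" by (intro real_sqrt_le_mono) simp
  then show "0 \<le> smooth_norm s u" using assms by (simp add: smooth_norm_def)
  have "sqrt ((norm u)\<^sup>2 + s\<^sup>2) \<le> norm u + s"
    using sqrt_add_le_add_sqrt[of "(norm u)\<^sup>2" "s\<^sup>2"] assms by simp
  then show "smooth_norm s u \<le> norm u" by (simp add: smooth_norm_def)
  have "sqrt ((norm u)\<^sup>2) \<le> sqrt ((norm u)\<^sup>2 + s\<^sup>2)" by (intro real_sqrt_le_mono) simp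
  then show "norm u - s \<le> smooth_norm s u" by (simp add: smooth_norm_def)
qed

lemma tendsto_smooth_norm [tendsto_intros]:
  "(s \<longlongrightarrow> s0) F \<Longrightarrow> (u \<longlongrightarrow> u0) F \<Longrightarrow> ((\<lambda>j. smooth_norm (s j) (u j)) \<longlongrightarrow> smooth_norm s0 u0) F"
  unfolding smooth_norm_def by (intro tendsto_intros)

lemma measurable_smooth_norm [measurable]: "smooth_norm s \<in> borel_measurable borel"
  unfolding smooth_norm_def by measurable

definition smooth_norm_grad :: "real \<Rightarrow> 'a::euclidean_space \<Rightarrow> 'a" where
  "smooth_norm_grad s u = (1 / sqrt ((norm u)\<^sup>2 + s\<^sup>2)) *\<^sub>R u"

lemma measurable_smooth_norm_grad [measurable]: "smooth_norm_grad s \<in> borel_measurable borel"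
  unfolding smooth_norm_grad_def by measurable

lemma norm_smooth_norm_grad: "norm (smooth_norm_grad s u) \<le> 1"
proof (cases "(norm u)\<^sup>2 + s\<^sup>2 = 0")
  case False
  then have "0 < sqrt ((norm u)\<^sup>2 + s\<^sup>2)"
    by (metis add_nonneg_nonneg less_eq_real_def real_sqrt_gt_zero zero_le_power2)
  moreover have "sqrt ((norm u)\<^sup>2) \<le> sqrt ((norm u)\<^sup>2 + s\<^sup>2)" by (intro real_sqrt_le_mono) simp
  ultimately show ?thesis by (simp add: smooth_norm_grad_def)
qed (simp add: smooth_norm_grad_def)

lemma has_derivative_smooth_norm:
  assumes "0 < s"
  shows "(smooth_norm s has_derivative (\<lambda>h. smooth_norm_grad s u \<bullet> h)) (at u)"
proof -
  have pos: "0 < (norm u)\<^sup>2 + s\<^sup>2" using assms by (simp add: add_nonneg_pos)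
  have "((\<lambda>u. sqrt (u \<bullet> u + s\<^sup>2) - s) has_derivative
     (\<lambda>h. (1 / sqrt (u \<bullet> u + s\<^sup>2)) * (u \<bullet> h))) (at u)"
    using pos by (auto intro!: derivative_eq_intros simp: power2_norm_eq_inner field_simps inner_commute)
  then show ?thesis
    by (simp add: smooth_norm_def[abs_def] smooth_norm_grad_def power2_norm_eq_inner)
qed

section \<open>From local minimality in the mean to pointwise growth\<close>

lemma measurable_integrand_comp:
  fixes G :: "'t \<Rightarrow> 'a::euclidean_space \<times> 'b::euclidean_space \<Rightarrow> ennreal"
  assumes G: "lsc_integrand M G" and [measurable]: "X \<in> borel_measurable M" "Y \<in> borel_measurable M"
  shows "(\<lambda>t. G t (X t, Y t)) \<in> borel_measurable M"
proof -
  have "(\<lambda>t. (t, (X t, Y t))) \<in> measurable M (M \<Otimes>\<^sub>M borel)" by measurable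
  from measurable_compose[OF this G[unfolded lsc_integrand_def, THEN conjunct1]] show ?thesis by simp
qed

lemma ennreal_le_plusI: "a \<le> b + c \<Longrightarrow> 0 \<le> b \<Longrightarrow> 0 \<le> c \<Longrightarrow> ennreal a \<le> ennreal b + ennreal c"
  by (simp flip: ennreal_plus add: ennreal_leI)

text \<open>
  The condition \<open>local_min\<close> is the subgradient inequality at accuracy \<open>\<epsilon>\<close> for the functional
  \<open>(x, y) \<mapsto> \<integral> G\<^sub>t(x, y(t))\<close>, the candidate subgradient being \<open>(xs, 0)\<close>. It compares finite values
  only; where the functional is infinite the inequality holds trivially.
\<close>

locale locally_minimal_integrand = finite_measure M + complete_measure M for M :: "'t measure" +
  fixes G :: "'t \<Rightarrow> 'a::euclidean_space \<times> 'b::euclidean_space \<Rightarrow> ennreal"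
    and xb :: 'a and yb :: "'t \<Rightarrow> 'b" and xs :: 'a and \<epsilon> \<delta>0 :: real
  assumes lsc: "lsc_integrand M G"
    and yb: "integrable M yb"
    and finite_value: "(\<integral>\<^sup>+t. G t (xb, yb t) \<partial>M) < \<infinity>"
    and \<epsilon>: "0 < \<epsilon>" and \<delta>0: "0 < \<delta>0"
    and local_min: "\<And>x y. integrable M y \<Longrightarrow>
      0 < norm (x - xb) + (\<integral>t. norm (y t - yb t) \<partial>M) \<Longrightarrow>
      norm (x - xb) + (\<integral>t. norm (y t - yb t) \<partial>M) < \<delta>0 \<Longrightarrow>
      (\<integral>\<^sup>+t. G t (x, y t) \<partial>M) < \<infinity> \<Longrightarrow>
      enn2real (\<integral>\<^sup>+t. G t (xb, yb t) \<partial>M) + xs \<bullet> (x - xb)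
        \<le> enn2real (\<integral>\<^sup>+t. G t (x, y t) \<partial>M) + \<epsilon> * (norm (x - xb) + (\<integral>t. norm (y t - yb t) \<partial>M))"
begin

lemmas finM = finite_measure_axioms and completeM = complete_measure_axioms

lemma yb_meas [measurable]: "yb \<in> borel_measurable M"
  using yb by (rule borel_measurable_integrable)

lemma G_meas [measurable (raw)]:
  "X \<in> borel_measurable M \<Longrightarrow> Y \<in> borel_measurable M \<Longrightarrow> (\<lambda>t. G t (X t, Y t)) \<in> borel_measurable M"
  by (rule measurable_integrand_comp[OF lsc])

lemma G_seq_lsc: "t \<in> space M \<Longrightarrow> seq_lsc (G t)"
  using lsc by (simp add: lsc_integrand_def)

lemma local_min_xb:
  assumes y: "integrable M y" and d: "(\<integral>t. norm (y t - yb t) \<partial>M) < \<delta>0"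
  shows "(\<integral>\<^sup>+t. G t (xb, yb t) \<partial>M) \<le> (\<integral>\<^sup>+t. G t (xb, y t) + ennreal (\<epsilon> * norm (y t - yb t)) \<partial>M)"
proof -
  note [measurable] = borel_measurable_integrable[OF y]
  have int: "integrable M (\<lambda>t. \<epsilon> * norm (y t - yb t))"
    using y yb by (intro integrable_mult_right integrable_norm Bochner_Integration.integrable_diff)
  have split: "(\<integral>\<^sup>+t. G t (xb, y t) + ennreal (\<epsilon> * norm (y t - yb t)) \<partial>M)
      = (\<integral>\<^sup>+t. G t (xb, y t) \<partial>M) + ennreal (\<epsilon> * (\<integral>t. norm (y t - yb t) \<partial>M))"
    using nn_integral_eq_integral[OF int] \<epsilon> by (subst nn_integral_add) auto
  show ?thesis
  proof (cases "(\<integral>\<^sup>+t. G t (xb, y t) \<partial>M) < \<infinity>")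
    case fin: True
    have nn: "0 \<le> (\<integral>t. norm (y t - yb t) \<partial>M)" by simp
    show ?thesis
    proof (cases "(\<integral>t. norm (y t - yb t) \<partial>M) = 0")
      case True
      then have "AE t in M. norm (y t - yb t) = 0"
        using y yb by (subst (asm) integral_nonneg_eq_0_iff_AE) auto
      then have "(\<integral>\<^sup>+t. G t (xb, yb t) \<partial>M) = (\<integral>\<^sup>+t. G t (xb, y t) \<partial>M)"
        by (intro nn_integral_cong_AE) auto
      then show ?thesis unfolding split by simp
    next
      case False
      then have "enn2real (\<integral>\<^sup>+t. G t (xb, yb t) \<partial>M)
          \<le> enn2real (\<integral>\<^sup>+t. G t (xb, y t) \<partial>M) + \<epsilon> * (\<integral>t. norm (y t - yb t) \<partial>M)"
        using local_min[OF y, of xb] d nn fin by simp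
      from ennreal_le_plusI[OF this enn2real_nonneg mult_nonneg_nonneg[OF less_imp_le[OF \<epsilon>] nn]]
      show ?thesis unfolding split using fin finite_value by (simp add: less_top)
    qed
  next
    case False
    then show ?thesis unfolding split by (simp add: less_top[symmetric])
  qed
qed

text \<open>
  Replacing \<open>yb\<close> by \<open>y\<close> on \<open>D\<close> alone gives an admissible competitor close to \<open>yb\<close> in \<open>L\<^sup>1\<close>. If \<open>D\<close> had
  positive measure, it would have a strictly smaller value than \<open>yb\<close>.
\<close>

lemma null_set_of_improvement:
  assumes [measurable]: "y \<in> borel_measurable M" "D \<in> sets M"
    and better: "\<And>t. t \<in> D \<Longrightarrow> G t (xb, y t) + ennreal (\<epsilon> * norm (y t - yb t)) < G t (xb, yb t)"
    and small: "(\<integral>\<^sup>+t. ennreal (norm (y t - yb t)) * indicator D t \<partial>M) < ennreal \<delta>0"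
  shows "emeasure M D = 0"
proof -
  define y' where "y' t = (if t \<in> D then y t else yb t)" for t
  have [measurable]: "y' \<in> borel_measurable M" unfolding y'_def by measurable
  have eq: "(\<integral>\<^sup>+t. ennreal (norm (y' t - yb t)) \<partial>M) = (\<integral>\<^sup>+t. ennreal (norm (y t - yb t)) * indicator D t \<partial>M)"
    by (intro nn_integral_cong) (auto simp: y'_def indicator_def)
  have int: "integrable M (\<lambda>t. y' t - yb t)"
    using small eq by (intro integrableI_bounded) (auto simp: less_top[symmetric] top_unique)
  then have y': "integrable M y'"
    using Bochner_Integration.integrable_add[OF int yb] by simp
  have "ennreal (\<integral>t. norm (y' t - yb t) \<partial>M) < ennreal \<delta>0"
    using small eq nn_integral_eq_integral[OF integrable_norm[OF int]] by simp
  then have d: "(\<integral>t. norm (y' t - yb t) \<partial>M) < \<delta>0" by (simp add: ennreal_less_iff)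
  define a where "a t = G t (xb, y' t) + ennreal (\<epsilon> * norm (y' t - yb t))" for t
  have [measurable]: "a \<in> borel_measurable M" unfolding a_def by measurable
  have a_le: "a t \<le> G t (xb, yb t)" for t
    using better[of t] by (auto simp: a_def y'_def)
  have "(\<integral>\<^sup>+t. a t \<partial>M) \<le> (\<integral>\<^sup>+t. G t (xb, yb t) \<partial>M)" by (intro nn_integral_mono a_le)
  then have a_fin: "(\<integral>\<^sup>+t. a t \<partial>M) \<noteq> \<infinity>" using finite_value by (auto simp: top_unique)
  have "(\<integral>\<^sup>+t. G t (xb, yb t) - a t \<partial>M) = (\<integral>\<^sup>+t. G t (xb, yb t) \<partial>M) - (\<integral>\<^sup>+t. a t \<partial>M)"
    using a_fin a_le by (intro nn_integral_diff) auto
  also have "\<dots> = 0"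
    using local_min_xb[OF y' d] finite_value by (simp add: a_def diff_eq_0_iff_ennreal less_top)
  finally have "AE t in M. G t (xb, yb t) - a t = 0" by (simp add: nn_integral_0_iff_AE)
  then have "AE t in M. t \<notin> D"
  proof eventually_elim
    case (elim t)
    show ?case
    proof
      assume t: "t \<in> D"
      then have "a t < G t (xb, yb t)" using better[OF t] by (simp add: a_def y'_def)
      with elim show False by (auto simp: diff_eq_0_iff_ennreal)
    qed
  qed
  then show ?thesis by (subst (asm) AE_iff_measurable[OF \<open>D \<in> sets M\<close>]) (use sets.sets_into_space[OF \<open>D \<in> sets M\<close>] in auto)
qed

lemma section_lsc: "t \<in> space M \<Longrightarrow> seq_lsc (\<lambda>w. G t (x, w))"
  unfolding seq_lsc_def
proof (intro allI impI)
  fix u :: "nat \<Rightarrow> 'b" and l assume "t \<in> space M" and u: "u \<longlonglongrightarrow> l"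
  have "(\<lambda>j. (x, u j)) \<longlonglongrightarrow> (x, l)" by (intro tendsto_Pair tendsto_const u)
  then show "G t (x, l) \<le> liminf (\<lambda>j. G t (x, u j))"
    using G_seq_lsc[OF \<open>t \<in> space M\<close>] unfolding seq_lsc_def by blast
qed

lemma section_integrand: "lsc_integrand M (\<lambda>t w. G t (x, w))"
proof -
  have "(\<lambda>z. (fst z, (x, snd z))) \<in> measurable (M \<Otimes>\<^sub>M (borel :: 'b measure)) (M \<Otimes>\<^sub>M borel)"
    by measurable
  from measurable_compose[OF this lsc[unfolded lsc_integrand_def, THEN conjunct1]] show ?thesis
    by (simp add: lsc_integrand_def section_lsc)
qed

lemma bounded_penalty_ball: "0 < c \<Longrightarrow> bounded {w::'b. c * norm (w - z) \<le> C}"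
proof -
  assume c: "0 < c"
  have "{w. c * norm (w - z) \<le> C} \<subseteq> cball z (C / c)"
    using c by (auto simp: dist_norm norm_minus_commute field_simps)
  then show ?thesis using bounded_subset[OF bounded_cball] by blast
qed

lemma section_argmin:
  assumes c: "0 < c"
  shows "\<exists>s\<in>borel_measurable M. \<forall>t\<in>space M. \<forall>w.
    G t (x, s t) + ennreal (c * norm (s t - yb t)) \<le> G t (x, w) + ennreal (c * norm (w - yb t))"
proof (rule measurable_argmin[OF finM completeM section_integrand])
  show "(\<lambda>z. c * norm (snd z - yb (fst z))) \<in> borel_measurable (M \<Otimes>\<^sub>M borel)" by measurable
  show "continuous_on UNIV (\<lambda>w. c * norm (w - yb t))" for t by (intro continuous_intros)
  show "bounded {w. c * norm (w - yb t) \<le> C}" for t C by (rule bounded_penalty_ball[OF c])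
qed

end

text \<open>
  With \<open>growth\<close> the comparison of \<open>yb t\<close> with other points is pointwise and no longer restricted to
  points near \<open>yb t\<close>.
\<close>

locale growing_integrand = locally_minimal_integrand M G xb yb xs \<epsilon> \<delta>0
  for M :: "'t measure" and G :: "'t \<Rightarrow> 'a::euclidean_space \<times> 'b::euclidean_space \<Rightarrow> ennreal"
    and xb :: 'a and yb :: "'t \<Rightarrow> 'b" and xs :: 'a and \<epsilon> \<delta>0 :: real +
  assumes growth: "AE t in M. \<forall>w. G t (xb, yb t) \<le> G t (xb, w) + ennreal (\<epsilon> * norm (w - yb t))"

definition constrain ::
    "('t \<Rightarrow> 'a::euclidean_space \<times> 'b::euclidean_space \<Rightarrow> ennreal) \<Rightarrow> 't set \<Rightarrow> real \<Rightarrow> ('t \<Rightarrow> 'b)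
      \<Rightarrow> 't \<Rightarrow> 'a \<times> 'b \<Rightarrow> ennreal" where
  "constrain G B r yb t z = (if t \<in> B \<and> r < norm (snd z - yb t) then \<infinity> else G t z)"

lemma constrain_integrand:
  fixes G :: "'t \<Rightarrow> 'a::euclidean_space \<times> 'b::euclidean_space \<Rightarrow> ennreal"
  assumes G: "lsc_integrand M G" and B [measurable]: "B \<in> sets M" and yb [measurable]: "yb \<in> borel_measurable M"
  shows "lsc_integrand M (constrain G B r yb)"
  unfolding lsc_integrand_def
proof (intro conjI ballI)
  show "(\<lambda>x. constrain G B r yb (fst x) (snd x)) \<in> borel_measurable (M \<Otimes>\<^sub>M (borel :: ('a \<times> 'b) measure))"
    unfolding constrain_def
  proof (rule measurable_If)
    show "(\<lambda>x. G (fst x) (snd x)) \<in> borel_measurable (M \<Otimes>\<^sub>M borel)"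
      using G by (simp add: lsc_integrand_def)
    have "snd \<in> borel_measurable (borel :: ('a \<times> 'b) measure)"
      by (intro borel_measurable_continuous_onI continuous_intros)
    from measurable_compose[OF measurable_snd this]
    have [measurable]: "(\<lambda>x. norm (snd (snd x) - yb (fst x))) \<in> borel_measurable (M \<Otimes>\<^sub>M (borel :: ('a \<times> 'b) measure))"
      by (intro measurable_compose[OF _ borel_measurable_norm] borel_measurable_diff measurable_compose[OF measurable_fst yb])
    show "{x \<in> space (M \<Otimes>\<^sub>M (borel :: ('a \<times> 'b) measure)).
        fst x \<in> B \<and> r < norm (snd (snd x) - yb (fst x))} \<in> sets (M \<Otimes>\<^sub>M borel)"
      by measurable
  qed simp
  fix t assume t: "t \<in> space M"
  have lsc: "seq_lsc (G t)" using G t by (simp add: lsc_integrand_def)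
  show "seq_lsc (constrain G B r yb t)"
    unfolding seq_lsc_def
  proof (intro allI impI)
    fix u :: "nat \<Rightarrow> 'a \<times> 'b" and l assume u: "u \<longlonglongrightarrow> l"
    show "constrain G B r yb t l \<le> liminf (\<lambda>j. constrain G B r yb t (u j))"
    proof (cases "t \<in> B \<and> r < norm (snd l - yb t)")
      case True
      have "(\<lambda>j. norm (snd (u j) - yb t)) \<longlonglongrightarrow> norm (snd l - yb t)" by (intro tendsto_intros u)
      then have "eventually (\<lambda>j. r < norm (snd (u j) - yb t)) sequentially"
        using True by (intro order_tendstoD) auto
      then have "eventually (\<lambda>j. \<infinity> \<le> constrain G B r yb t (u j)) sequentially"
        by eventually_elim (use True in \<open>simp add: constrain_def\<close>)
      then have "\<infinity> \<le> liminf (\<lambda>j. constrain G B r yb t (u j))" by (rule Liminf_bounded)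
      then show ?thesis by (simp add: top_unique)
    next
      case False
      then have "constrain G B r yb t l = G t l" by (auto simp: constrain_def)
      also have "\<dots> \<le> liminf (\<lambda>j. G t (u j))" by (rule seq_lscD[OF lsc u])
      also have "\<dots> \<le> liminf (\<lambda>j. constrain G B r yb t (u j))"
        by (intro Liminf_mono always_eventually) (auto simp: constrain_def)
      finally show ?thesis .
    qed
  qed
qed

context locally_minimal_integrand
begin

text \<open>
  Let \<open>s\<close> minimize the right-hand side of \<open>growth\<close>, and let \<open>B\<close> be the set on which \<open>s\<close> violates that
  inequality. On \<open>B\<close> the value of \<open>G\<close> at \<open>yb\<close> dominates \<open>\<epsilon>\<parallel>s - yb\<parallel>\<close>, so this difference is integrable,
  and a subset of \<open>B\<close> over which its integral is small is null by \<open>null_set_of_improvement\<close>. After the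
  second variable has been confined on \<open>B\<close> to a ball so small that all functions with values in it
  stay within \<open>L\<^sup>1\<close> distance \<open>\<delta>0\<close>, the same lemma shows that violations of \<open>growth\<close> have become null.
\<close>

lemma localization:
  "\<exists>B s r. B \<in> sets M \<and> s \<in> borel_measurable M \<and> 0 < r \<and>
     (\<integral>\<^sup>+t. ennreal (norm (s t - yb t)) * indicator B t \<partial>M) < \<infinity> \<and>
     (\<forall>D\<in>sets M. D \<subseteq> B \<longrightarrow> (\<integral>\<^sup>+t. ennreal (norm (s t - yb t)) * indicator D t \<partial>M) < ennreal \<delta>0 \<longrightarrow> emeasure M D = 0) \<and>
     growing_integrand M (constrain G B r yb) xb yb xs \<epsilon> \<delta>0"
proof -
  obtain s where [measurable]: "s \<in> borel_measurable M"
    and s: "\<And>t w. t \<in> space M \<Longrightarrow>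
      G t (xb, s t) + ennreal (\<epsilon> * norm (s t - yb t)) \<le> G t (xb, w) + ennreal (\<epsilon> * norm (w - yb t))"
    using section_argmin[OF \<epsilon>, of xb] by blast
  define B where "B = {t \<in> space M. G t (xb, s t) + ennreal (\<epsilon> * norm (s t - yb t)) < G t (xb, yb t)}"
  have B [measurable]: "B \<in> sets M" unfolding B_def by measurable
  have fin: "(\<integral>\<^sup>+t. ennreal (norm (s t - yb t)) * indicator B t \<partial>M) < \<infinity>"
  proof -
    have "ennreal \<epsilon> * (\<integral>\<^sup>+t. ennreal (norm (s t - yb t)) * indicator B t \<partial>M)
        = (\<integral>\<^sup>+t. ennreal \<epsilon> * (ennreal (norm (s t - yb t)) * indicator B t) \<partial>M)"
      by (rule nn_integral_cmult[symmetric]) measurable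
    also have "\<dots> \<le> (\<integral>\<^sup>+t. G t (xb, yb t) \<partial>M)"
    proof (intro nn_integral_mono)
      fix t
      show "ennreal \<epsilon> * (ennreal (norm (s t - yb t)) * indicator B t) \<le> G t (xb, yb t)"
      proof (cases "t \<in> B")
        case True
        have "ennreal (\<epsilon> * norm (s t - yb t)) \<le> G t (xb, s t) + ennreal (\<epsilon> * norm (s t - yb t))" by simp
        also have "\<dots> \<le> G t (xb, yb t)" using True by (simp add: B_def less_imp_le)
        finally show ?thesis using True \<epsilon> by (simp add: ennreal_mult')
      qed simp
    qed
    finally have "ennreal \<epsilon> * (\<integral>\<^sup>+t. ennreal (norm (s t - yb t)) * indicator B t \<partial>M) < \<infinity>"
      using finite_value by (rule le_less_trans)
    then show ?thesis using \<epsilon> by (auto simp: ennreal_mult_less_top)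
  qed
  have null: "emeasure M D = 0"
    if D: "D \<in> sets M" "D \<subseteq> B" "(\<integral>\<^sup>+t. ennreal (norm (s t - yb t)) * indicator D t \<partial>M) < ennreal \<delta>0" for D
    using D by (intro null_set_of_improvement[of s D]) (auto simp: B_def)
  (* small enough for functions with values in balls of radius r to stay within L1 distance \<delta>0 *)
  define r where "r = \<delta>0 / (2 * (measure M (space M) + 1))"
  have m: "0 < measure M (space M) + 1" by (simp add: add_nonneg_pos)
  have r: "0 < r" using \<delta>0 m by (simp add: r_def)
  have r_small: "r * measure M (space M) < \<delta>0"
  proof -
    have "r * measure M (space M) < r * (2 * (measure M (space M) + 1))"
      using r m by (intro mult_strict_left_mono) auto
    also have "\<dots> = \<delta>0" using m by (simp add: r_def)
    finally show ?thesis .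
  qed
  define G' where "G' = constrain G B r yb"
  have G'_yb: "G' t (v, yb t) = G t (v, yb t)" for t v using r by (simp add: G'_def constrain_def)
  have G'_ge: "G t z \<le> G' t z" for t z by (simp add: G'_def constrain_def)
  interpret L: locally_minimal_integrand M G' xb yb xs \<epsilon> \<delta>0
  proof unfold_locales
    show "lsc_integrand M G'" unfolding G'_def by (rule constrain_integrand[OF lsc]) auto
    show "integrable M yb" "0 < \<epsilon>" "0 < \<delta>0" by (fact yb \<epsilon> \<delta>0)+
    show "(\<integral>\<^sup>+ t. G' t (xb, yb t) \<partial>M) < \<infinity>" using finite_value by (simp add: G'_yb)
    fix x y assume y: "integrable M y"
      and 1: "0 < norm (x - xb) + (\<integral>t. norm (y t - yb t) \<partial>M)" "norm (x - xb) + (\<integral>t. norm (y t - yb t) \<partial>M) < \<delta>0"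
      and 2: "(\<integral>\<^sup>+ t. G' t (x, y t) \<partial>M) < \<infinity>"
    have le: "(\<integral>\<^sup>+ t. G t (x, y t) \<partial>M) \<le> (\<integral>\<^sup>+ t. G' t (x, y t) \<partial>M)"
      by (intro nn_integral_mono G'_ge)
    then have "enn2real (\<integral>\<^sup>+ t. G t (x, y t) \<partial>M) \<le> enn2real (\<integral>\<^sup>+ t. G' t (x, y t) \<partial>M)"
      using 2 by (intro enn2real_mono) auto
    with local_min[OF y 1 le_less_trans[OF le 2]]
    show "enn2real (\<integral>\<^sup>+ t. G' t (xb, yb t) \<partial>M) + xs \<bullet> (x - xb)
        \<le> enn2real (\<integral>\<^sup>+ t. G' t (x, y t) \<partial>M) + \<epsilon> * (norm (x - xb) + (\<integral>t. norm (y t - yb t) \<partial>M))"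
      by (simp add: G'_yb)
  qed
  obtain s2 where [measurable]: "s2 \<in> borel_measurable M"
    and s2: "\<And>t w. t \<in> space M \<Longrightarrow>
      G' t (xb, s2 t) + ennreal (\<epsilon> * norm (s2 t - yb t)) \<le> G' t (xb, w) + ennreal (\<epsilon> * norm (w - yb t))"
    using L.section_argmin[OF \<epsilon>, of xb] by blast
  define D where "D = {t \<in> space M. G' t (xb, s2 t) + ennreal (\<epsilon> * norm (s2 t - yb t)) < G' t (xb, yb t)}"
  have D [measurable]: "D \<in> sets M"
    unfolding D_def using L.G_meas[of "\<lambda>_. xb" s2] L.G_meas[of "\<lambda>_. xb" yb] by measurable
  have D_r: "norm (s2 t - yb t) \<le> r" if t: "t \<in> D" for t
  proof (rule ccontr)
    assume far: "\<not> norm (s2 t - yb t) \<le> r"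
    have "t \<in> space M" using t by (simp add: D_def)
    show False
    proof (cases "t \<in> B")
      case True
      then have "G' t (xb, s2 t) = \<infinity>" using far by (simp add: G'_def constrain_def)
      then show False using t by (simp add: D_def)
    next
      case False
      then have "G t (xb, yb t) \<le> G t (xb, s t) + ennreal (\<epsilon> * norm (s t - yb t))"
        using \<open>t \<in> space M\<close> by (simp add: B_def not_less)
      also have "\<dots> \<le> G t (xb, s2 t) + ennreal (\<epsilon> * norm (s2 t - yb t))" using s[OF \<open>t \<in> space M\<close>] .
      also have "\<dots> \<le> G' t (xb, s2 t) + ennreal (\<epsilon> * norm (s2 t - yb t))" by (intro add_right_mono G'_ge)
      also have "\<dots> < G t (xb, yb t)" using t by (simp add: D_def G'_yb)
      finally show False by simp
    qed
  qed
  have "emeasure M D = 0"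
  proof (rule L.null_set_of_improvement[of s2])
    have "(\<integral>\<^sup>+ t. ennreal (norm (s2 t - yb t)) * indicator D t \<partial>M) \<le> (\<integral>\<^sup>+ t. ennreal r \<partial>M)"
      using D_r by (intro nn_integral_mono) (auto simp: indicator_def intro: ennreal_leI)
    also have "\<dots> = ennreal (r * measure M (space M))"
      using r by (simp add: emeasure_eq_measure ennreal_mult')
    also have "\<dots> < ennreal \<delta>0" using r_small \<delta>0 by (intro ennreal_lessI) auto
    finally show "(\<integral>\<^sup>+ t. ennreal (norm (s2 t - yb t)) * indicator D t \<partial>M) < ennreal \<delta>0" .
  qed (auto simp: D_def)
  then have "AE t in M. t \<notin> D" by (intro AE_not_in) (simp add: null_sets_def)
  then have "AE t in M. \<forall>w. G' t (xb, yb t) \<le> G' t (xb, w) + ennreal (\<epsilon> * norm (w - yb t))"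
    using AE_space
  proof eventually_elim
    case (elim t)
    then have "G' t (xb, yb t) \<le> G' t (xb, s2 t) + ennreal (\<epsilon> * norm (s2 t - yb t))"
      by (simp add: D_def not_less)
    then show ?case using s2[OF elim(2)] order_trans by blast
  qed
  then have "growing_integrand M G' xb yb xs \<epsilon> \<delta>0" by unfold_locales
  then show ?thesis
    using B \<open>s \<in> borel_measurable M\<close> r fin null unfolding G'_def
    by (intro exI[of _ B] exI[of _ s] exI[of _ r]) blast
qed

end

section \<open>Convergence of almost minimizing sequences\<close>

context growing_integrand
begin

text \<open>
  The case of \<open>seq_lsc_penalized_limit\<close> in which the first components converge by assumption and only
  the second ones are controlled by a penalty.
\<close>

lemma pointwise_limit:
  assumes t: "t \<in> space M"
    and s: "\<And>j. 0 \<le> s j" "s \<longlonglongrightarrow> 0" and v: "v \<longlonglongrightarrow> x"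
    and le: "\<And>j. G t (v j, w j) + ennreal (2 * \<epsilon> * smooth_norm (s j) (w j - yb t)) \<le> c j"
    and c: "c \<longlonglongrightarrow> c0" "c0 < \<infinity>"
  shows "\<exists>\<sigma> l. strict_mono \<sigma> \<and> (\<lambda>j. w (\<sigma> j)) \<longlonglongrightarrow> l \<and>
    G t (x, l) + ennreal (2 * \<epsilon> * norm (l - yb t)) \<le> c0"
proof -
  have "\<exists>\<sigma> l. strict_mono \<sigma> \<and> (\<lambda>j. (v (\<sigma> j), w (\<sigma> j))) \<longlonglongrightarrow> l \<and>
    G t l + ennreal (2 * \<epsilon> * norm (snd l - yb t)) \<le> c0"
  proof (rule seq_lsc_penalized_limit[OF G_seq_lsc[OF t] le c])
    fix C
    obtain K1 where K1: "\<And>j. norm (v j) \<le> K1"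
      using convergent_imp_bounded[OF v] by (auto simp: bounded_iff)
    obtain K2 where K2: "\<And>j. norm (s j) \<le> K2"
      using convergent_imp_bounded[OF s(2)] by (auto simp: bounded_iff)
    have "norm (v j, w j) \<le> K1 + (C / (2 * \<epsilon>) + K2 + norm (yb t))"
      if "2 * \<epsilon> * smooth_norm (s j) (w j - yb t) \<le> C" for j
    proof -
      have "norm (w j - yb t) - s j \<le> smooth_norm (s j) (w j - yb t)"
        by (rule smooth_norm_bounds(3)[OF s(1)])
      also have "\<dots> \<le> C / (2 * \<epsilon>)" using that \<epsilon> by (simp add: field_simps)
      finally have "norm (w j) \<le> C / (2 * \<epsilon>) + K2 + norm (yb t)"
        using K2[of j] s(1)[of j] norm_triangle_ineq2[of "w j" "yb t"] by simp
      then show ?thesis using norm_Pair_le[of "v j" "w j"] K1[of j] by linarith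
    qed
    then show "\<exists>K. \<forall>j. 2 * \<epsilon> * smooth_norm (s j) (w j - yb t) \<le> C \<longrightarrow> norm (v j, w j) \<le> K" by blast
  next
    fix \<sigma> l assume \<sigma>: "strict_mono \<sigma>" and lim: "(\<lambda>j. (v (\<sigma> j), w (\<sigma> j))) \<longlonglongrightarrow> l"
    have w: "(\<lambda>j. w (\<sigma> j)) \<longlonglongrightarrow> snd l" using tendsto_snd[OF lim] by simp
    have "(\<lambda>j. s (\<sigma> j)) \<longlonglongrightarrow> 0" using LIMSEQ_subseq_LIMSEQ[OF s(2) \<sigma>] by (simp add: o_def)
    then have "(\<lambda>j. 2 * \<epsilon> * smooth_norm (s (\<sigma> j)) (w (\<sigma> j) - yb t))
        \<longlonglongrightarrow> 2 * \<epsilon> * smooth_norm 0 (snd l - yb t)"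
      by (intro tendsto_intros w)
    then show "(\<lambda>j. 2 * \<epsilon> * smooth_norm (s (\<sigma> j)) (w (\<sigma> j) - yb t)) \<longlonglongrightarrow> 2 * \<epsilon> * norm (snd l - yb t)"
      by simp
  qed
  then obtain \<sigma> l where \<sigma>: "strict_mono \<sigma>" and lim: "(\<lambda>j. (v (\<sigma> j), w (\<sigma> j))) \<longlonglongrightarrow> l"
    and l: "G t l + ennreal (2 * \<epsilon> * norm (snd l - yb t)) \<le> c0" by blast
  have "(\<lambda>j. v (\<sigma> j)) \<longlonglongrightarrow> fst l" using tendsto_fst[OF lim] by simp
  moreover have "(\<lambda>j. v (\<sigma> j)) \<longlonglongrightarrow> x" using LIMSEQ_subseq_LIMSEQ[OF v \<sigma>] by (simp add: o_def)
  ultimately have "fst l = x" by (rule LIMSEQ_unique)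
  then have "G t (x, snd l) + ennreal (2 * \<epsilon> * norm (snd l - yb t)) \<le> c0" using l by (metis prod.collapse)
  moreover have "(\<lambda>j. w (\<sigma> j)) \<longlonglongrightarrow> snd l" using tendsto_snd[OF lim] by simp
  ultimately show ?thesis using \<sigma> by blast
qed

lemma pointwise_liminf:
  assumes t: "t \<in> space M" and m: "\<And>w. m \<le> G t (x, w) + ennreal (2 * \<epsilon> * norm (w - yb t))"
    and s: "\<And>j. 0 \<le> s j" "s \<longlonglongrightarrow> 0" and v: "v \<longlonglongrightarrow> x"
  shows "m \<le> liminf (\<lambda>j. G t (v j, w j) + ennreal (2 * \<epsilon> * smooth_norm (s j) (w j - yb t)))"
    (is "_ \<le> liminf ?A")
proof (cases "liminf ?A < \<infinity>")
  case fin: True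
  obtain r where r: "strict_mono (r :: nat \<Rightarrow> nat)" "(?A \<circ> r) \<longlonglongrightarrow> liminf ?A"
    using liminf_subseq_lim by blast
  have "\<exists>\<sigma> l. strict_mono \<sigma> \<and> (\<lambda>j. w (r (\<sigma> j))) \<longlonglongrightarrow> l \<and>
    G t (x, l) + ennreal (2 * \<epsilon> * norm (l - yb t)) \<le> liminf ?A"
    by (rule pointwise_limit[OF t _ _ _ _ r(2) fin, of "\<lambda>j. s (r j)" "\<lambda>j. v (r j)"])
      (use s v r(1) LIMSEQ_subseq_LIMSEQ in \<open>auto simp: o_def\<close>)
  then obtain l where l: "G t (x, l) + ennreal (2 * \<epsilon> * norm (l - yb t)) \<le> liminf ?A" by blast
  show ?thesis using m[of l] l by (rule order_trans)
next
  case False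
  then show ?thesis by (simp add: less_top[symmetric])
qed

lemma growth_doubled:
  assumes "G t (xb, yb t) \<le> G t (xb, w) + ennreal (\<epsilon> * norm (w - yb t))"
  shows "G t (xb, yb t) \<le> G t (xb, w) + ennreal (2 * \<epsilon> * norm (w - yb t))"
  using assms
proof (rule order_trans)
  show "G t (xb, w) + ennreal (\<epsilon> * norm (w - yb t)) \<le> G t (xb, w) + ennreal (2 * \<epsilon> * norm (w - yb t))"
    using \<epsilon> by (intro add_left_mono ennreal_leI) (simp add: mult_right_mono)
qed

text \<open>
  A cluster point \<open>l\<close> of \<open>w\<close> satisfies \<open>growth\<close> with slope \<open>\<epsilon>\<close> and the opposite inequality with slope
  \<open>2\<epsilon>\<close>, which leaves only \<open>l = yb t\<close>.
\<close>

lemma pointwise_convergence: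
  assumes t: "t \<in> space M" and gr: "\<And>w. G t (xb, yb t) \<le> G t (xb, w) + ennreal (\<epsilon> * norm (w - yb t))"
    and fin: "G t (xb, yb t) < \<infinity>"
    and s: "\<And>j. 0 \<le> s j" "s \<longlonglongrightarrow> 0" and v: "v \<longlonglongrightarrow> xb"
    and A: "(\<lambda>j. G t (v j, w j) + ennreal (2 * \<epsilon> * smooth_norm (s j) (w j - yb t))) \<longlonglongrightarrow> G t (xb, yb t)"
  shows "w \<longlonglongrightarrow> yb t"
proof (rule ccontr)
  assume "\<not> w \<longlonglongrightarrow> yb t"
  then obtain \<eta> where \<eta>: "0 < \<eta>" and "\<not> eventually (\<lambda>j. dist (w j) (yb t) < \<eta>) sequentially"
    by (auto simp: tendsto_iff)
  from not_eventually_sequentiallyD[OF this(2)] obtain r :: "nat \<Rightarrow> nat" where r: "strict_mono r"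
    and far: "\<And>j. \<not> dist (w (r j)) (yb t) < \<eta>" by blast
  have "\<exists>\<sigma> l. strict_mono \<sigma> \<and> (\<lambda>j. w (r (\<sigma> j))) \<longlonglongrightarrow> l \<and>
    G t (xb, l) + ennreal (2 * \<epsilon> * norm (l - yb t)) \<le> G t (xb, yb t)"
    by (rule pointwise_limit[OF t _ _ _ _ LIMSEQ_subseq_LIMSEQ[OF A r] fin, of "\<lambda>j. s (r j)" "\<lambda>j. v (r j)"])
      (use s v r LIMSEQ_subseq_LIMSEQ in \<open>auto simp: o_def\<close>)
  then obtain \<sigma> l where l: "(\<lambda>j. w (r (\<sigma> j))) \<longlonglongrightarrow> l"
    "G t (xb, l) + ennreal (2 * \<epsilon> * norm (l - yb t)) \<le> G t (xb, yb t)" by blast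
  have le: "G t (xb, l) + ennreal (2 * \<epsilon> * norm (l - yb t)) \<le> G t (xb, l) + ennreal (\<epsilon> * norm (l - yb t))"
    using l(2) gr[of l] by (rule order_trans)
  have "G t (xb, l) \<le> G t (xb, l) + ennreal (2 * \<epsilon> * norm (l - yb t))" by simp
  then have "G t (xb, l) \<noteq> \<infinity>" using l(2) fin by (auto simp: top_unique)
  then have "2 * \<epsilon> * norm (l - yb t) \<le> \<epsilon> * norm (l - yb t)"
    using le \<epsilon> by (simp add: ennreal_add_left_cancel_le)
  then have "l = yb t" using \<epsilon> by (simp add: mult_le_cancel_right1)
  moreover have "\<eta> \<le> dist l (yb t)"
    using far by (intro LIMSEQ_le_const[OF tendsto_dist[OF l(1) tendsto_const]]) (auto simp: not_less)
  ultimately show False using \<eta> by simp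
qed

lemma psi_finite: "AE t in M. G t (xb, yb t) < \<infinity>"
  using finite_value nn_integral_PInf_AE[of "\<lambda>t. G t (xb, yb t)" M] by (auto simp: less_top[symmetric])

lemma psi_integrable: "integrable M (\<lambda>t. enn2real (G t (xb, yb t)))"
proof (rule integrableI_bounded)
  have "(\<integral>\<^sup>+t. ennreal (norm (enn2real (G t (xb, yb t)))) \<partial>M) = (\<integral>\<^sup>+t. G t (xb, yb t) \<partial>M)"
    using psi_finite by (intro nn_integral_cong_AE) (auto elim!: eventually_mono)
  then show "(\<integral>\<^sup>+t. ennreal (norm (enn2real (G t (xb, yb t)))) \<partial>M) < \<infinity>" using finite_value by simp
qed measurable

end

lemma enn2real_integral_finite:
  assumes [measurable]: "A \<in> borel_measurable M" and fin: "(\<integral>\<^sup>+t. A t \<partial>M) < \<infinity>"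
  shows "AE t in M. A t < \<infinity>" "AE t in M. ennreal (enn2real (A t)) = A t"
    "integrable M (\<lambda>t. enn2real (A t))"
    "(\<integral>t. enn2real (A t) \<partial>M) = enn2real (\<integral>\<^sup>+t. A t \<partial>M)"
proof -
  show 1: "AE t in M. A t < \<infinity>"
    using fin nn_integral_PInf_AE[of A M] by (auto simp: less_top[symmetric])
  then show 2: "AE t in M. ennreal (enn2real (A t)) = A t" by eventually_elim simp
  then have eq: "(\<integral>\<^sup>+t. ennreal (enn2real (A t)) \<partial>M) = (\<integral>\<^sup>+t. A t \<partial>M)" by (rule nn_integral_cong_AE)
  show "integrable M (\<lambda>t. enn2real (A t))"
    using eq fin by (intro integrableI_bounded) auto
  show "(\<integral>t. enn2real (A t) \<partial>M) = enn2real (\<integral>\<^sup>+t. A t \<partial>M)"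
    by (subst integral_eq_nn_integral) (auto simp: eq)
qed

text \<open>
  The argument of Scheffe's lemma with one-sided hypotheses: the part of \<open>a j\<close> below \<open>p\<close> vanishes by
  dominated convergence, and the bound on the integrals then controls the part above.
\<close>

lemma L1_convergence_of_values:
  fixes a :: "nat \<Rightarrow> 't \<Rightarrow> real"
  assumes a: "\<And>j. integrable M (a j)" and p: "integrable M p" and p0: "\<And>t. 0 \<le> p t" and a0: "\<And>j t. 0 \<le> a j t"
    and below: "\<And>\<eta>. 0 < \<eta> \<Longrightarrow> AE t in M. eventually (\<lambda>j. p t - \<eta> < a j t) sequentially"
    and le: "\<And>j. (\<integral>t. a j t \<partial>M) \<le> (\<integral>t. p t \<partial>M) + e j" and e: "e \<longlonglongrightarrow> 0"
  shows "(\<lambda>j. \<integral>t. \<bar>a j t - p t\<bar> \<partial>M) \<longlonglongrightarrow> 0"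
proof -
  have ev: "AE t in M. \<forall>n. eventually (\<lambda>j. p t - 1 / real (Suc n) < a j t) sequentially"
    by (subst AE_all_countable) (auto intro: below)
  have "(\<lambda>j. \<integral>t. max 0 (p t - a j t) \<partial>M) \<longlonglongrightarrow> (\<integral>t. 0 \<partial>M)"
  proof (rule integral_dominated_convergence[where w = p])
    show "AE t in M. (\<lambda>j. max 0 (p t - a j t)) \<longlonglongrightarrow> 0"
      using ev
    proof eventually_elim
      case (elim t)
      show ?case
      proof (rule tendsto_iff[THEN iffD2], intro allI impI)
        fix \<eta> :: real assume "0 < \<eta>"
        then obtain n where n: "1 / real (Suc n) < \<eta>" using nat_approx_posE by blast
        from elim have "eventually (\<lambda>j. p t - 1 / real (Suc n) < a j t) sequentially" by blast
        then show "eventually (\<lambda>j. dist (max 0 (p t - a j t)) 0 < \<eta>) sequentially"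
          by eventually_elim (use n \<open>0 < \<eta>\<close> in auto)
      qed
    qed
    show "AE t in M. norm (max 0 (p t - a j t)) \<le> p t" for j
      using p0 a0 by (auto intro!: AE_I2)
  qed (use a p in auto)
  then have d: "(\<lambda>j. e j + 2 * (\<integral>t. max 0 (p t - a j t) \<partial>M)) \<longlonglongrightarrow> 0 + 2 * 0"
    by (intro tendsto_add tendsto_mult tendsto_const e) simp
  have bound: "(\<integral>t. \<bar>a j t - p t\<bar> \<partial>M) \<le> e j + 2 * (\<integral>t. max 0 (p t - a j t) \<partial>M)" for j
  proof -
    have "(\<integral>t. \<bar>a j t - p t\<bar> \<partial>M) = (\<integral>t. (a j t - p t) + 2 * max 0 (p t - a j t) \<partial>M)"
      by (intro Bochner_Integration.integral_cong refl) (simp add: max_def abs_real_def)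
    also have "\<dots> = (\<integral>t. a j t \<partial>M) - (\<integral>t. p t \<partial>M) + 2 * (\<integral>t. max 0 (p t - a j t) \<partial>M)"
      using a p by (simp add: Bochner_Integration.integral_add Bochner_Integration.integral_diff)
    finally show ?thesis using le[of j] by simp
  qed
  show ?thesis
  proof (rule tendsto_sandwich[OF _ _ tendsto_const])
    show "(\<lambda>j. e j + 2 * (\<integral>t. max 0 (p t - a j t) \<partial>M)) \<longlonglongrightarrow> 0" using d by simp
  qed (auto intro: always_eventually bound)
qed

context growing_integrand
begin

text \<open>
  Along a sequence whose penalized values are asymptotically no larger than the value at \<open>(xb, yb)\<close>,
  the values converge in \<open>L\<^sup>1\<close>: they are bounded below in the limit by \<open>growth\<close>. Their pointwise limit
  along a subsequence identifies the limit of \<open>Y\<close>. Convergence of \<open>Y\<close> in \<open>L\<^sup>1\<close> follows because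
  \<open>2\<epsilon>\<parallel>Y - yb\<parallel>\<close> is dominated by a sequence that converges in \<open>L\<^sup>1\<close>.
\<close>

lemma value_convergence:
  fixes X :: "nat \<Rightarrow> 't \<Rightarrow> 'a" and Y :: "nat \<Rightarrow> 't \<Rightarrow> 'b" and s e :: "nat \<Rightarrow> real"
  defines "A \<equiv> \<lambda>j t. G t (X j t, Y j t) + ennreal (2 * \<epsilon> * smooth_norm (s j) (Y j t - yb t))"
    and "p \<equiv> \<lambda>t. enn2real (G t (xb, yb t))"
  assumes [measurable]: "\<And>j. X j \<in> borel_measurable M" "\<And>j. Y j \<in> borel_measurable M"
    and s: "\<And>j. 0 \<le> s j" "s \<longlonglongrightarrow> 0"
    and X: "AE t in M. (\<lambda>j. X j t) \<longlonglongrightarrow> xb"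
    and A_fin: "\<And>j. (\<integral>\<^sup>+t. A j t \<partial>M) < \<infinity>"
    and le: "\<And>j. enn2real (\<integral>\<^sup>+t. A j t \<partial>M) \<le> enn2real (\<integral>\<^sup>+t. G t (xb, yb t) \<partial>M) + e j"
    and e: "e \<longlonglongrightarrow> 0"
  shows "\<And>j. integrable M (Y j)"
    and "(\<lambda>j. \<integral>t. \<bar>enn2real (A j t) - p t\<bar> \<partial>M) \<longlonglongrightarrow> 0"
    and "\<exists>\<sigma>. strict_mono \<sigma> \<and> (AE t in M. (\<lambda>j. Y (\<sigma> j) t) \<longlonglongrightarrow> yb t) \<and>
      (\<lambda>j. \<integral>t. norm (Y (\<sigma> j) t - yb t) \<partial>M) \<longlonglongrightarrow> 0 \<and>
      (\<lambda>j. \<integral>t. \<bar>enn2real (G t (X (\<sigma> j) t, Y (\<sigma> j) t)) - p t\<bar> \<partial>M) \<longlonglongrightarrow> 0"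
proof -
  have A_meas [measurable]: "A j \<in> borel_measurable M" for j unfolding A_def by measurable
  have [measurable]: "p \<in> borel_measurable M" unfolding p_def by measurable
  note A_real = enn2real_integral_finite[OF A_meas A_fin]
  define a where "a j t = enn2real (A j t)" for j t
  have a_int: "integrable M (a j)" for j unfolding a_def by (rule A_real)
  have p_int: "integrable M p" unfolding p_def by (rule psi_integrable)
  have p_val: "(\<integral>t. p t \<partial>M) = enn2real (\<integral>\<^sup>+t. G t (xb, yb t) \<partial>M)"
    unfolding p_def by (rule enn2real_integral_finite(4)[OF _ finite_value]) measurable
  have A_fin_all: "AE t in M. \<forall>j. A j t < \<infinity>" using A_real(1) by (simp add: AE_all_countable)
  have liminf: "AE t in M. G t (xb, yb t) \<le> liminf (\<lambda>j. A j t)"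
    using growth X AE_space
  proof eventually_elim
    case (elim t)
    show ?case unfolding A_def
      by (rule pointwise_liminf[OF elim(3) growth_doubled s elim(2)]) (use elim(1) in blast)
  qed
  have below: "AE t in M. eventually (\<lambda>j. p t - \<eta> < a j t) sequentially" if \<eta>: "0 < \<eta>" for \<eta>
    using liminf psi_finite A_fin_all
  proof eventually_elim
    case (elim t)
    show ?case
    proof (cases "p t - \<eta> < 0")
      case True
      then show ?thesis
        using less_le_trans[OF True enn2real_nonneg] by (intro always_eventually allI) (simp add: a_def)
    next
      case False
      have "ennreal (p t - \<eta>) < ennreal (p t)" using \<eta> False by (intro ennreal_lessI) auto
      also have "\<dots> = G t (xb, yb t)" using elim(2) by (simp add: p_def)
      also have "\<dots> \<le> liminf (\<lambda>j. A j t)" by (rule elim(1))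
      finally have "eventually (\<lambda>j. ennreal (p t - \<eta>) < A j t) sequentially" by (rule less_LiminfD)
      then show ?thesis
      proof eventually_elim
        case (elim j)
        then have "ennreal (p t - \<eta>) < ennreal (a j t)" using \<open>\<forall>j. A j t < \<infinity>\<close> by (simp add: a_def)
        then show ?case using False by (simp add: ennreal_less_iff)
      qed
    qed
  qed
  have L1: "(\<lambda>j. \<integral>t. \<bar>a j t - p t\<bar> \<partial>M) \<longlonglongrightarrow> 0"
  proof (rule L1_convergence_of_values[OF a_int p_int _ _ below _ e])
    show "0 \<le> p t" "0 \<le> a j t" for j t by (simp_all add: p_def a_def)
    show "(\<integral>t. a j t \<partial>M) \<le> (\<integral>t. p t \<partial>M) + e j" for j
      using le[of j] unfolding p_val a_def A_real(4) .
  qed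
  then show "(\<lambda>j. \<integral>t. \<bar>enn2real (A j t) - p t\<bar> \<partial>M) \<longlonglongrightarrow> 0" by (simp add: a_def)
  have dom: "AE t in M. 2 * \<epsilon> * norm (Y j t - yb t) \<le> a j t + 2 * \<epsilon> * s j
      \<and> \<bar>enn2real (G t (X j t, Y j t)) - a j t\<bar> \<le> 2 * \<epsilon> * norm (Y j t - yb t)" for j
    using A_real(1)[of j]
  proof eventually_elim
    case (elim t)
    have sn: "0 \<le> smooth_norm (s j) (Y j t - yb t)" "smooth_norm (s j) (Y j t - yb t) \<le> norm (Y j t - yb t)"
      "norm (Y j t - yb t) - s j \<le> smooth_norm (s j) (Y j t - yb t)"
      using smooth_norm_bounds[OF s(1)] by blast+
    have "G t (X j t, Y j t) < \<infinity>" using elim by (simp add: A_def)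
    then have a: "a j t = enn2real (G t (X j t, Y j t)) + 2 * \<epsilon> * smooth_norm (s j) (Y j t - yb t)"
      using sn(1) \<epsilon> by (simp add: a_def A_def enn2real_plus)
    have "2 * \<epsilon> * (norm (Y j t - yb t) - s j) \<le> 2 * \<epsilon> * smooth_norm (s j) (Y j t - yb t)"
      using sn(3) \<epsilon> by (intro mult_left_mono) auto
    moreover have "2 * \<epsilon> * smooth_norm (s j) (Y j t - yb t) \<le> 2 * \<epsilon> * norm (Y j t - yb t)"
      using sn(2) \<epsilon> by (intro mult_left_mono) auto
    moreover have "0 \<le> 2 * \<epsilon> * smooth_norm (s j) (Y j t - yb t)" using sn(1) \<epsilon> by simp
    moreover have "0 \<le> enn2real (G t (X j t, Y j t))" by simp
    ultimately show ?case unfolding a right_diff_distrib abs_le_iff by (intro conjI; linarith)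
  qed
  have diff_int: "integrable M (\<lambda>t. Y j t - yb t)" for j
  proof (rule Bochner_Integration.integrable_bound)
    show "integrable M (\<lambda>t. (a j t + 2 * \<epsilon> * s j) / (2 * \<epsilon>))" using a_int by auto
    show "AE t in M. norm (Y j t - yb t) \<le> norm ((a j t + 2 * \<epsilon> * s j) / (2 * \<epsilon>))"
      using dom[of j]
    proof eventually_elim
      case (elim t)
      then have "norm (Y j t - yb t) \<le> (a j t + 2 * \<epsilon> * s j) / (2 * \<epsilon>)"
        using \<epsilon> by (simp add: field_simps)
      then show ?case unfolding real_norm_def by (rule order_trans[OF _ abs_ge_self])
    qed
  qed measurable
  show Y_int: "integrable M (Y j)" for j
    using Bochner_Integration.integrable_add[OF diff_int yb] by simp
  have "\<exists>\<sigma>. strict_mono \<sigma> \<and> (AE t in M. (\<lambda>j. a (\<sigma> j) t - p t) \<longlonglongrightarrow> 0)"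
    by (rule tendsto_L1_AE_subseq) (use a_int p_int L1 in simp_all)
  then obtain \<sigma> where \<sigma>: "strict_mono \<sigma>" and conv: "AE t in M. (\<lambda>j. a (\<sigma> j) t - p t) \<longlonglongrightarrow> 0" by blast
  have s\<sigma>: "(\<lambda>j. s (\<sigma> j)) \<longlonglongrightarrow> 0" using LIMSEQ_subseq_LIMSEQ[OF s(2) \<sigma>] by (simp add: o_def)
  have L1\<sigma>: "(\<lambda>j. \<integral>t. \<bar>a (\<sigma> j) t - p t\<bar> \<partial>M) \<longlonglongrightarrow> 0"
    using LIMSEQ_subseq_LIMSEQ[OF L1 \<sigma>] by (simp add: o_def)
  have Y_conv: "AE t in M. (\<lambda>j. Y (\<sigma> j) t) \<longlonglongrightarrow> yb t"
    using conv growth X psi_finite A_fin_all AE_space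
  proof eventually_elim
    case (elim t)
    have "(\<lambda>j. a (\<sigma> j) t) \<longlonglongrightarrow> p t" using elim(1) by (simp add: LIM_zero_iff)
    then have "(\<lambda>j. ennreal (a (\<sigma> j) t)) \<longlonglongrightarrow> ennreal (p t)" by (rule tendsto_ennrealI)
    moreover have "ennreal (a (\<sigma> j) t) = A (\<sigma> j) t" for j using elim(5) by (simp add: a_def)
    moreover have "ennreal (p t) = G t (xb, yb t)" using elim(4) by (simp add: p_def)
    ultimately have A_lim: "(\<lambda>j. A (\<sigma> j) t) \<longlonglongrightarrow> G t (xb, yb t)" by (simp only:)
    have X_lim: "(\<lambda>j. X (\<sigma> j) t) \<longlonglongrightarrow> xb"
      using LIMSEQ_subseq_LIMSEQ[OF elim(3) \<sigma>] by (simp add: o_def)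
    show ?case
      by (rule pointwise_convergence[OF elim(6) _ elim(4) s(1) s\<sigma> X_lim A_lim[unfolded A_def]])
        (use elim(2) in blast)
  qed
  (* b j is at most |a (\<sigma> j) - p| + 2 \<epsilon> s (\<sigma> j) + min p (b j); only the last term is not known to vanish in L1,
     and it is dominated by p *)
  define b where "b j t = 2 * \<epsilon> * norm (Y (\<sigma> j) t - yb t)" for j t
  have b_int: "integrable M (b j)" for j unfolding b_def by (intro integrable_mult_right integrable_norm diff_int)
  have "(\<lambda>j. \<integral>t. min (p t) (b j t) \<partial>M) \<longlonglongrightarrow> (\<integral>t. 0 \<partial>M)"
  proof (rule integral_dominated_convergence[where w = p])
    show "AE t in M. (\<lambda>j. min (p t) (b j t)) \<longlonglongrightarrow> 0"
      using Y_conv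
    proof eventually_elim
      case (elim t)
      have "(\<lambda>j. min (p t) (b j t)) \<longlonglongrightarrow> min (p t) (2 * \<epsilon> * norm (yb t - yb t))"
        unfolding b_def by (intro tendsto_intros elim)
      then show ?case by (simp add: p_def min_absorb2)
    qed
    show "AE t in M. norm (min (p t) (b j t)) \<le> p t" for j
      using \<epsilon> by (intro AE_I2) (auto simp: p_def b_def)
  qed (use p_int b_int in auto)
  then have lim: "(\<lambda>j. (\<integral>t. \<bar>a (\<sigma> j) t - p t\<bar> \<partial>M) + 2 * \<epsilon> * s (\<sigma> j) * measure M (space M) + (\<integral>t. min (p t) (b j t) \<partial>M))
      \<longlonglongrightarrow> 0 + 2 * \<epsilon> * 0 * measure M (space M) + 0"
    by (intro tendsto_intros L1\<sigma> s\<sigma>) simp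
  have b_bound: "(\<integral>t. b j t \<partial>M)
      \<le> (\<integral>t. \<bar>a (\<sigma> j) t - p t\<bar> \<partial>M) + 2 * \<epsilon> * s (\<sigma> j) * measure M (space M) + (\<integral>t. min (p t) (b j t) \<partial>M)" for j
  proof -
    have int: "integrable M (\<lambda>t. \<bar>a (\<sigma> j) t - p t\<bar>)" "integrable M (\<lambda>t. min (p t) (b j t))"
      using a_int p_int b_int by auto
    have "(\<integral>t. b j t \<partial>M) \<le> (\<integral>t. \<bar>a (\<sigma> j) t - p t\<bar> + 2 * \<epsilon> * s (\<sigma> j) + min (p t) (b j t) \<partial>M)"
    proof (rule integral_mono_AE)
      show "AE t in M. b j t \<le> \<bar>a (\<sigma> j) t - p t\<bar> + 2 * \<epsilon> * s (\<sigma> j) + min (p t) (b j t)"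
        using dom[of "\<sigma> j"]
      proof eventually_elim
        case (elim t)
        have "0 \<le> \<epsilon> * s (\<sigma> j)" using \<epsilon> s(1) by simp
        then show ?case using elim[THEN conjunct1] unfolding b_def by linarith
      qed
    qed (use int b_int in auto)
    also have "\<dots> = (\<integral>t. \<bar>a (\<sigma> j) t - p t\<bar> \<partial>M) + 2 * \<epsilon> * s (\<sigma> j) * measure M (space M) + (\<integral>t. min (p t) (b j t) \<partial>M)"
      using int by (simp add: Bochner_Integration.integral_add)
    finally show ?thesis .
  qed
  have b_lim: "(\<lambda>j. \<integral>t. b j t \<partial>M) \<longlonglongrightarrow> 0"
  proof (rule tendsto_sandwich[OF _ _ tendsto_const])
    show "eventually (\<lambda>j. 0 \<le> (\<integral>t. b j t \<partial>M)) sequentially"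
      using \<epsilon> by (intro always_eventually allI integral_nonneg_AE AE_I2) (simp add: b_def)
    show "eventually (\<lambda>j. (\<integral>t. b j t \<partial>M) \<le> (\<integral>t. \<bar>a (\<sigma> j) t - p t\<bar> \<partial>M) + 2 * \<epsilon> * s (\<sigma> j) * measure M (space M) + (\<integral>t. min (p t) (b j t) \<partial>M)) sequentially"
      using b_bound by (intro always_eventually) blast
  qed (use lim in simp)
  have Y_L1: "(\<lambda>j. \<integral>t. norm (Y (\<sigma> j) t - yb t) \<partial>M) \<longlonglongrightarrow> 0"
  proof -
    have "(\<lambda>j. (1 / (2 * \<epsilon>)) * (\<integral>t. b j t \<partial>M)) \<longlonglongrightarrow> (1 / (2 * \<epsilon>)) * 0"
      by (intro tendsto_mult tendsto_const b_lim)
    then show ?thesis using \<epsilon> by (simp add: b_def)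
  qed
  have G_L1: "(\<lambda>j. \<integral>t. \<bar>enn2real (G t (X (\<sigma> j) t, Y (\<sigma> j) t)) - p t\<bar> \<partial>M) \<longlonglongrightarrow> 0"
  proof (rule tendsto_sandwich[OF _ _ tendsto_const])
    show "(\<lambda>j. (\<integral>t. \<bar>a (\<sigma> j) t - p t\<bar> \<partial>M) + (\<integral>t. b j t \<partial>M)) \<longlonglongrightarrow> 0"
      using tendsto_add[OF L1\<sigma> b_lim] by simp
    show "eventually (\<lambda>j. (\<integral>t. \<bar>enn2real (G t (X (\<sigma> j) t, Y (\<sigma> j) t)) - p t\<bar> \<partial>M)
        \<le> (\<integral>t. \<bar>a (\<sigma> j) t - p t\<bar> \<partial>M) + (\<integral>t. b j t \<partial>M)) sequentially"
    proof (intro always_eventually allI)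
      fix j
      have int: "integrable M (\<lambda>t. \<bar>a (\<sigma> j) t - p t\<bar>)" using a_int p_int by auto
      have bd: "AE t in M. \<bar>enn2real (G t (X (\<sigma> j) t, Y (\<sigma> j) t)) - p t\<bar> \<le> \<bar>a (\<sigma> j) t - p t\<bar> + b j t"
        using dom[of "\<sigma> j"]
      proof eventually_elim
        case (elim t)
        then show ?case using elim[THEN conjunct2] unfolding b_def by linarith
      qed
      have "(\<integral>t. \<bar>enn2real (G t (X (\<sigma> j) t, Y (\<sigma> j) t)) - p t\<bar> \<partial>M) \<le> (\<integral>t. \<bar>a (\<sigma> j) t - p t\<bar> + b j t \<partial>M)"
      proof (rule integral_mono_AE[OF _ _ bd])
        show "integrable M (\<lambda>t. \<bar>enn2real (G t (X (\<sigma> j) t, Y (\<sigma> j) t)) - p t\<bar>)"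
        proof (rule Bochner_Integration.integrable_bound)
          show "integrable M (\<lambda>t. \<bar>a (\<sigma> j) t - p t\<bar> + b j t)" using int b_int by auto
          show "AE t in M. norm \<bar>enn2real (G t (X (\<sigma> j) t, Y (\<sigma> j) t)) - p t\<bar> \<le> norm (\<bar>a (\<sigma> j) t - p t\<bar> + b j t)"
            using bd unfolding real_norm_def by eventually_elim linarith
        qed measurable
      qed (use int b_int in auto)
      then show "(\<integral>t. \<bar>enn2real (G t (X (\<sigma> j) t, Y (\<sigma> j) t)) - p t\<bar> \<partial>M)
        \<le> (\<integral>t. \<bar>a (\<sigma> j) t - p t\<bar> \<partial>M) + (\<integral>t. b j t \<partial>M)"
        using int b_int by (simp add: Bochner_Integration.integral_add)
    qed
  qed (auto intro: always_eventually)
  show "\<exists>\<sigma>. strict_mono \<sigma> \<and> (AE t in M. (\<lambda>j. Y (\<sigma> j) t) \<longlonglongrightarrow> yb t) \<and>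
      (\<lambda>j. \<integral>t. norm (Y (\<sigma> j) t - yb t) \<partial>M) \<longlonglongrightarrow> 0 \<and>
      (\<lambda>j. \<integral>t. \<bar>enn2real (G t (X (\<sigma> j) t, Y (\<sigma> j) t)) - p t\<bar> \<partial>M) \<longlonglongrightarrow> 0"
    using \<sigma> Y_conv Y_L1 G_L1 by blast
qed

text \<open>
  If there were competitors with first component arbitrarily near, but different from, \<open>xb\<close>, then by
  \<open>value_convergence\<close> their second components would come close to \<open>yb\<close> in \<open>L\<^sup>1\<close>. There the local
  inequality applies, and its error \<open>\<epsilon>\<close> per unit distance is smaller than the slope \<open>2\<epsilon>\<close> of the
  added terms.
\<close>

lemma isolated_minimizer:
  "\<exists>\<delta>>0. \<forall>x y. y \<in> borel_measurable M \<longrightarrow> norm (x - xb) \<le> \<delta> \<longrightarrow>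
     (\<integral>\<^sup>+t. G t (x, y t) + ennreal (2 * \<epsilon> * norm (y t - yb t)) \<partial>M) < \<infinity> \<longrightarrow>
     enn2real (\<integral>\<^sup>+t. G t (x, y t) + ennreal (2 * \<epsilon> * norm (y t - yb t)) \<partial>M) - xs \<bullet> (x - xb) + 2 * \<epsilon> * norm (x - xb)
       \<le> enn2real (\<integral>\<^sup>+t. G t (xb, yb t) \<partial>M) \<longrightarrow> x = xb"
proof (rule ccontr)
  define V where "V x y = (\<integral>\<^sup>+t. G t (x, y t) + ennreal (2 * \<epsilon> * norm (y t - yb t)) \<partial>M)" for x y
  define E0 where "E0 = enn2real (\<integral>\<^sup>+t. G t (xb, yb t) \<partial>M)"
  define bad where "bad \<delta> z \<longleftrightarrow> snd z \<in> borel_measurable M \<and> norm (fst z - xb) \<le> \<delta> \<and> V (fst z) (snd z) < \<infinity> \<and>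
     enn2real (V (fst z) (snd z)) - xs \<bullet> (fst z - xb) + 2 * \<epsilon> * norm (fst z - xb) \<le> E0 \<and> fst z \<noteq> xb"
    for \<delta> and z :: "'a \<times> ('t \<Rightarrow> 'b)"
  assume "\<not> ?thesis"
  then have no: "\<exists>x y. bad \<delta> (x, y)" if "0 < \<delta>" for \<delta>
    using that unfolding bad_def V_def E0_def fst_conv snd_conv by blast
  have "\<exists>z. bad (1 / real (Suc j)) z" for j using no[of "1 / real (Suc j)"] by auto
  then obtain z where z: "\<And>j. bad (1 / real (Suc j)) (z j)" by metis
  define x where "x j = fst (z j)" for j
  define y where "y j = snd (z j)" for j
  have y_meas: "y j \<in> borel_measurable M" and x_le: "norm (x j - xb) \<le> 1 / real (Suc j)"
    and V_fin: "V (x j) (y j) < \<infinity>" and x_ne: "x j \<noteq> xb"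
    and V_le: "enn2real (V (x j) (y j)) - xs \<bullet> (x j - xb) + 2 * \<epsilon> * norm (x j - xb) \<le> E0" for j
    using z[of j] unfolding bad_def x_def y_def by blast+
  note [measurable] = y_meas
  have x_norm: "(\<lambda>j. norm (x j - xb)) \<longlonglongrightarrow> 0"
  proof (rule tendsto_sandwich[where f = "\<lambda>_. 0" and h = "\<lambda>j. 1 / real (Suc j)"])
    show "(\<lambda>j. 1 / real (Suc j)) \<longlonglongrightarrow> 0" using LIMSEQ_inverse_real_of_nat by (simp add: inverse_eq_divide)
    show "eventually (\<lambda>j. norm (x j - xb) \<le> 1 / real (Suc j)) sequentially"
      by (intro always_eventually allI x_le)
    show "eventually (\<lambda>j. 0 \<le> norm (x j - xb)) sequentially" by simp
  qed simp
  then have x_lim: "x \<longlonglongrightarrow> xb" by (rule LIM_zero_cancel[OF tendsto_norm_zero_cancel])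
  have e_lim: "(\<lambda>j. norm xs * norm (x j - xb)) \<longlonglongrightarrow> 0" by (rule tendsto_mult_right_zero[OF x_norm])
  have le: "enn2real (V (x j) (y j)) \<le> E0 + norm xs * norm (x j - xb)" for j
  proof -
    have "xs \<bullet> (x j - xb) \<le> norm xs * norm (x j - xb)" by (rule norm_cauchy_schwarz)
    moreover have "0 \<le> 2 * \<epsilon> * norm (x j - xb)" using \<epsilon> by simp
    ultimately show ?thesis using V_le[of j] by linarith
  qed
  have X': "AE t in M. (\<lambda>j. x j) \<longlonglongrightarrow> xb" using x_lim by simp
  have A_fin': "(\<integral>\<^sup>+t. G t (x j, y j t) + ennreal (2 * \<epsilon> * smooth_norm 0 (y j t - yb t)) \<partial>M) < \<infinity>" for j
    using V_fin[of j] by (simp add: V_def)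
  have le': "enn2real (\<integral>\<^sup>+t. G t (x j, y j t) + ennreal (2 * \<epsilon> * smooth_norm 0 (y j t - yb t)) \<partial>M)
      \<le> enn2real (\<integral>\<^sup>+t. G t (xb, yb t) \<partial>M) + norm xs * norm (x j - xb)" for j
    using le[of j] by (simp add: V_def E0_def)
  note vc = value_convergence[where X = "\<lambda>j _. x j" and s = "\<lambda>_. 0",
      OF borel_measurable_const y_meas order_refl tendsto_const X' A_fin' le' e_lim]
  obtain \<sigma> where \<sigma>: "strict_mono \<sigma>" and y_lim: "(\<lambda>j. \<integral>t. norm (y (\<sigma> j) t - yb t) \<partial>M) \<longlonglongrightarrow> 0"
    using vc(3) by blast
  have "(\<lambda>j. norm (x (\<sigma> j) - xb) + (\<integral>t. norm (y (\<sigma> j) t - yb t) \<partial>M)) \<longlonglongrightarrow> 0 + 0"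
    using LIMSEQ_subseq_LIMSEQ[OF x_norm \<sigma>] by (intro tendsto_add y_lim) (simp add: o_def)
  then have "eventually (\<lambda>j. norm (x (\<sigma> j) - xb) + (\<integral>t. norm (y (\<sigma> j) t - yb t) \<partial>M) < \<delta>0) sequentially"
    using \<delta>0 by (intro order_tendstoD) auto
  then obtain j where small: "norm (x (\<sigma> j) - xb) + (\<integral>t. norm (y (\<sigma> j) t - yb t) \<partial>M) < \<delta>0"
    by (auto simp: eventually_sequentially)
  define x1 where "x1 = x (\<sigma> j)"
  define y1 where "y1 = y (\<sigma> j)"
  define d where "d = (\<integral>t. norm (y1 t - yb t) \<partial>M)"
  have y1: "integrable M y1" unfolding y1_def by (rule vc(1))
  then have [measurable]: "y1 \<in> borel_measurable M" by simp
  have d0: "0 \<le> d" unfolding d_def by simp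
  have int: "integrable M (\<lambda>t. 2 * \<epsilon> * norm (y1 t - yb t))"
    using y1 yb by (intro integrable_mult_right integrable_norm Bochner_Integration.integrable_diff)
  have V_eq: "V x1 y1 = (\<integral>\<^sup>+t. G t (x1, y1 t) \<partial>M) + ennreal (2 * \<epsilon> * d)"
    unfolding V_def d_def using nn_integral_eq_integral[OF int] \<epsilon> by (subst nn_integral_add) auto
  have V1: "V x1 y1 < \<infinity>" unfolding x1_def y1_def by (rule V_fin)
  then have G1: "(\<integral>\<^sup>+t. G t (x1, y1 t) \<partial>M) < \<infinity>" unfolding V_eq by simp
  have V_real: "enn2real (V x1 y1) = enn2real (\<integral>\<^sup>+t. G t (x1, y1 t) \<partial>M) + 2 * \<epsilon> * d"
    unfolding V_eq using G1 d0 \<epsilon> by (simp add: enn2real_plus)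
  have pos: "0 < norm (x1 - xb)" using x_ne by (simp add: x1_def)
  have "E0 + xs \<bullet> (x1 - xb) \<le> enn2real (\<integral>\<^sup>+t. G t (x1, y1 t) \<partial>M) + \<epsilon> * (norm (x1 - xb) + d)"
  proof (rule local_min[OF y1 _ _ G1, folded d_def E0_def])
    show "0 < norm (x1 - xb) + d" using pos d0 by linarith
    show "norm (x1 - xb) + d < \<delta>0" unfolding x1_def y1_def d_def by (rule small)
  qed
  moreover have "enn2real (V x1 y1) - xs \<bullet> (x1 - xb) + 2 * \<epsilon> * norm (x1 - xb) \<le> E0"
    unfolding x1_def y1_def by (rule V_le)
  ultimately have "2 * \<epsilon> * d + 2 * \<epsilon> * norm (x1 - xb) \<le> \<epsilon> * (norm (x1 - xb) + d)" unfolding V_real by linarith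
  then have "\<epsilon> * (norm (x1 - xb) + d) \<le> 0" by (simp add: algebra_simps)
  moreover have "0 < \<epsilon> * (norm (x1 - xb) + d)" using pos d0 by (intro mult_pos_pos[OF \<epsilon>] add_pos_nonneg)
  ultimately show False by simp
qed

end

section \<open>Powers of the norm\<close>

text \<open>
  The gradient of the \<open>p\<close>-th power of the norm. At the origin the factor \<open>0 powr (p - 2)\<close> is \<open>0\<close>, which
  gives the correct value for \<open>p > 1\<close>.
\<close>

definition power_grad :: "real \<Rightarrow> 'a::euclidean_space \<Rightarrow> 'a" where
  "power_grad p u = (p * norm u powr (p - 2)) *\<^sub>R u"

lemma measurable_power_grad [measurable]: "power_grad p \<in> borel_measurable borel"
  unfolding power_grad_def by measurable

lemma norm_power_grad: "1 < p \<Longrightarrow> norm (power_grad p u) = p * norm u powr (p - 1)"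
proof (cases "u = 0")
  case False
  assume "1 < p"
  have "norm u powr (p - 2) * norm u powr 1 = norm u powr (p - 1)"
    by (subst powr_add[symmetric]) simp
  then show ?thesis using False \<open>1 < p\<close> by (simp add: power_grad_def)
qed (simp add: power_grad_def)

lemma power_grad_minus: "power_grad p (- u) = - power_grad p u"
  by (simp add: power_grad_def)

lemma has_derivative_norm_powr:
  fixes u :: "'a::euclidean_space"
  assumes p: "1 < p"
  shows "((\<lambda>u. norm u powr p) has_derivative (\<lambda>h. power_grad p u \<bullet> h)) (at u)"
proof (cases "u = 0")
  case False
  have eq: "norm u powr (p - 1) = norm u * norm u powr (p - 2)"
    using powr_mult_base[of "norm u" "p - 2"] by simp
  have "((\<lambda>u. norm u powr p) has_derivative (\<lambda>h. (h \<bullet> sgn u) * (p * norm u powr (p - 1)))) (at u)"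
    by (rule DERIV_compose_FDERIV[OF has_real_derivative_powr has_derivative_norm]) (use False in auto)
  moreover have "(h \<bullet> sgn u) * (p * norm u powr (p - 1)) = power_grad p u \<bullet> h" for h
    unfolding eq using False by (simp add: power_grad_def sgn_div_norm inner_commute)
  ultimately show ?thesis by simp
next
  case True
  have "((\<lambda>y. norm y powr (p - 1)) \<longlongrightarrow> 0) (at (0::'a))"
    using p by (intro tendsto_zero_powrI[where b = "p - 1"]) (auto intro!: tendsto_eq_intros)
  then have "((\<lambda>y. norm (norm y powr p) / norm y) \<longlongrightarrow> 0) (at (0::'a))"
  proof (rule Lim_transform_eventually)
    show "eventually (\<lambda>y. norm y powr (p - 1) = norm (norm y powr p) / norm y) (at (0::'a))"
      unfolding eventually_at_filter by (rule always_eventually) (simp add: powr_diff)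
  qed
  then show ?thesis using True by (simp add: has_derivative_iff_norm power_grad_def)
qed

lemma powr_lipschitz:
  fixes \<alpha> \<beta> :: real
  assumes p: "1 < p" and "0 \<le> \<alpha>" "0 \<le> \<beta>" "\<alpha> \<le> K" "\<beta> \<le> K"
  shows "\<bar>\<beta> powr p - \<alpha> powr p\<bar> \<le> p * K powr (p - 1) * \<bar>\<beta> - \<alpha>\<bar>"
proof -
  have *: "y powr p - x powr p \<le> p * K powr (p - 1) * (y - x)" if xy: "0 \<le> x" "x < y" "y \<le> K" for x y
  proof -
    have "\<exists>z. x < z \<and> z < y \<and> y powr p - x powr p = (y - x) * (p * z powr (p - 1))"
    proof -
      have "continuous_on {x..y} (\<lambda>z. z powr p)"
        using p xy by (intro continuous_on_powr' continuous_intros) auto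
      moreover have "((\<lambda>z. z powr p) has_derivative (\<lambda>h. h * (p * z powr (p - 1)))) (at z)" if "x < z" "z < y" for z
        using has_real_derivative_powr[of z p] that xy
        by (simp add: has_field_derivative_def mult.commute[of _ "p * z powr (p - 1)"])
      ultimately obtain z where "x < z" "z < y" "y powr p - x powr p = (y - x) * (p * z powr (p - 1))"
        using mvt[of x y "\<lambda>z. z powr p" "\<lambda>z h. h * (p * z powr (p - 1))"] xy by auto
      then show ?thesis by blast
    qed
    then obtain z where z: "x < z" "z < y" "y powr p - x powr p = (y - x) * (p * z powr (p - 1))" by blast
    have "z powr (p - 1) \<le> K powr (p - 1)" using p z xy by (intro powr_mono2) auto
    then have "(y - x) * (p * z powr (p - 1)) \<le> (y - x) * (p * K powr (p - 1))"
      using p xy by (intro mult_left_mono) auto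
    then show ?thesis using z(3) by (simp add: mult_ac)
  qed
  have mono: "x powr p \<le> y powr p" if "0 \<le> x" "x \<le> y" for x y :: real using p that by (intro powr_mono2) auto
  show ?thesis
  proof (cases rule: linorder_cases[of \<alpha> \<beta>])
    case less
    then show ?thesis using *[of \<alpha> \<beta>] mono[of \<alpha> \<beta>] assms by simp
  next
    case greater
    then show ?thesis using *[of \<beta> \<alpha>] mono[of \<beta> \<alpha>] assms by simp
  qed simp
qed

lemma base_le_powr: "0 \<le> u \<Longrightarrow> 1 \<le> p \<Longrightarrow> u \<le> 1 + u powr p" for u p :: real
proof (cases "u \<le> 1")
  case False
  assume "1 \<le> p"
  then have "u powr 1 \<le> u powr p" using False by (intro powr_mono) auto
  then show ?thesis using False by simp
qed (simp add: add_increasing2)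

lemma sum_powr_le: "0 \<le> x \<Longrightarrow> 0 \<le> y \<Longrightarrow> 0 \<le> p \<Longrightarrow> (x + y) powr p \<le> 2 powr p * (x powr p + y powr p)" for x y p :: real
proof -
  assume xy: "0 \<le> x" "0 \<le> y" and p: "0 \<le> p"
  have "(x + y) powr p \<le> (2 * max x y) powr p" using xy p by (intro powr_mono2) auto
  also have "\<dots> = 2 powr p * (max x y) powr p" using xy by (simp add: powr_mult)
  also have "(max x y) powr p \<le> x powr p + y powr p" by (simp add: max_def)
  finally show ?thesis by simp
qed

lemma integrable_shifted_power:
  fixes X :: "'t \<Rightarrow> 'a::euclidean_space"
  assumes M: "finite_measure M" and [measurable]: "X \<in> borel_measurable M" and p: "1 < p"
    and int: "integrable M (\<lambda>t. norm (X t - x) powr p)"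
  shows "integrable M (\<lambda>t. (norm (X t - x) + norm d) powr p)" "integrable M (\<lambda>t. norm (X t - y) powr p)"
proof -
  interpret finite_measure M by fact
  have *: "integrable M (\<lambda>t. (norm (X t - x) + c) powr p)" if c: "0 \<le> c" for c
  proof (rule Bochner_Integration.integrable_bound)
    show "integrable M (\<lambda>t. 2 powr p * (norm (X t - x) powr p + c powr p))" using int by auto
    show "AE t in M. norm ((norm (X t - x) + c) powr p) \<le> norm (2 powr p * (norm (X t - x) powr p + c powr p))"
      using sum_powr_le[of "norm (X _ - x)" c p] c p by (intro AE_I2) simp
  qed measurable
  show "integrable M (\<lambda>t. (norm (X t - x) + norm d) powr p)" by (rule *) simp
  show "integrable M (\<lambda>t. norm (X t - y) powr p)"
  proof (rule Bochner_Integration.integrable_bound)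
    show "integrable M (\<lambda>t. (norm (X t - x) + norm (x - y)) powr p)" by (rule *) simp
    show "AE t in M. norm (norm (X t - y) powr p) \<le> norm ((norm (X t - x) + norm (x - y)) powr p)"
    proof (intro AE_I2)
      fix t
      have "norm (X t - y) \<le> norm (X t - x) + norm (x - y)" using norm_triangle_ineq[of "X t - x" "x - y"] by simp
      then show "norm (norm (X t - y) powr p) \<le> norm ((norm (X t - x) + norm (x - y)) powr p)"
        using p by (simp add: powr_mono2)
    qed
  qed measurable
qed

text \<open>
  Differentiation under the integral sign. The difference quotients are bounded by an integrable
  function because powers are locally Lipschitz with a constant that is itself controlled by the
  \<open>p\<close>-th power.
\<close>

lemma power_integral_directional_derivative:
  fixes X :: "'t \<Rightarrow> 'a::euclidean_space" and x d :: 'a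
  assumes M: "finite_measure M" and [measurable]: "X \<in> borel_measurable M" and p: "1 < p"
    and int: "integrable M (\<lambda>t. norm (X t - x) powr p)"
    and \<tau>: "\<And>n. 0 < \<tau> n" "\<And>n. \<tau> n \<le> 1" "\<tau> \<longlonglongrightarrow> 0"
  shows "integrable M (\<lambda>t. power_grad p (x - X t))"
    and "(\<lambda>n. ((\<integral>t. norm (X t - (x + \<tau> n *\<^sub>R d)) powr p \<partial>M) - (\<integral>t. norm (X t - x) powr p \<partial>M)) / \<tau> n)
      \<longlonglongrightarrow> (\<integral>t. power_grad p (x - X t) \<partial>M) \<bullet> d"
proof -
  interpret finite_measure M by fact
  note shifted = integrable_shifted_power[OF M \<open>X \<in> borel_measurable M\<close> p int]
  have pow_le: "u powr (p - 1) \<le> 1 + u powr p" if "0 \<le> u" for u :: real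
  proof (cases "u \<le> 1")
    case True
    then have "u powr (p - 1) \<le> 1 powr (p - 1)" using that p by (intro powr_mono2) auto
    then show ?thesis by (simp add: add_increasing2)
  next
    case False
    then have "u powr (p - 1) \<le> u powr p" by (intro powr_mono) auto
    then show ?thesis by simp
  qed
  show grad_int: "integrable M (\<lambda>t. power_grad p (x - X t))"
  proof (rule Bochner_Integration.integrable_bound)
    show "integrable M (\<lambda>t. p * (1 + norm (X t - x) powr p))" using int by auto
    show "AE t in M. norm (power_grad p (x - X t)) \<le> norm (p * (1 + norm (X t - x) powr p))"
      using pow_le[of "norm (X _ - x)"] p
      by (intro AE_I2) (simp add: norm_power_grad norm_minus_commute mult_left_mono)
  qed measurable
  define Q where "Q n t = (norm (X t - (x + \<tau> n *\<^sub>R d)) powr p - norm (X t - x) powr p) / \<tau> n" for n t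
  have "(\<lambda>n. \<integral>t. Q n t \<partial>M) \<longlonglongrightarrow> (\<integral>t. power_grad p (x - X t) \<bullet> d \<partial>M)"
  proof (rule integral_dominated_convergence[where w = "\<lambda>t. p * (1 + (norm (X t - x) + norm d) powr p) * norm d"])
    show "(\<lambda>t. power_grad p (x - X t) \<bullet> d) \<in> borel_measurable M" by measurable
    show "Q n \<in> borel_measurable M" for n unfolding Q_def by measurable
    show "integrable M (\<lambda>t. p * (1 + (norm (X t - x) + norm d) powr p) * norm d)"
      by (intro integrable_mult_left integrable_mult_right Bochner_Integration.integrable_add shifted(1)) auto
    show "AE t in M. (\<lambda>n. Q n t) \<longlonglongrightarrow> power_grad p (x - X t) \<bullet> d"
    proof (intro AE_I2)
      fix t
      have line: "((\<lambda>\<tau>. x - X t + \<tau> *\<^sub>R d) has_derivative (\<lambda>h. h *\<^sub>R d)) (at 0)"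
        by (auto intro!: derivative_eq_intros)
      have "((\<lambda>u. norm u powr p) has_derivative (\<lambda>h. power_grad p (x - X t) \<bullet> h)) (at (x - X t + 0 *\<^sub>R d))"
        using has_derivative_norm_powr[OF p, of "x - X t"] by simp
      from has_derivative_compose[OF line this]
      have "((\<lambda>\<tau>. norm (x - X t + \<tau> *\<^sub>R d) powr p) has_real_derivative power_grad p (x - X t) \<bullet> d) (at 0)"
        by (rule has_derivative_imp_has_field_derivative) simp
      then have "((\<lambda>h. (norm (x - X t + h *\<^sub>R d) powr p - norm (x - X t) powr p) / h) \<longlongrightarrow> power_grad p (x - X t) \<bullet> d) (at 0)"
        by (simp add: DERIV_def)
      moreover have "filterlim \<tau> (at 0) sequentially"
        using \<tau>(1,3) by (intro filterlim_atI) (auto simp: less_imp_neq[symmetric])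
      ultimately have "(\<lambda>n. (norm (x - X t + \<tau> n *\<^sub>R d) powr p - norm (x - X t) powr p) / \<tau> n) \<longlonglongrightarrow> power_grad p (x - X t) \<bullet> d"
        by (rule filterlim_compose)
      moreover have "norm (x - X t + \<tau> n *\<^sub>R d) = norm (X t - (x + \<tau> n *\<^sub>R d))" for n
        by (metis add_diff_eq diff_add_eq norm_minus_commute)
      ultimately show "(\<lambda>n. Q n t) \<longlonglongrightarrow> power_grad p (x - X t) \<bullet> d"
        by (simp add: Q_def norm_minus_commute[of x])
    qed
    show "AE t in M. norm (Q n t) \<le> p * (1 + (norm (X t - x) + norm d) powr p) * norm d" for n
    proof (intro AE_I2)
      fix t
      let ?K = "norm (X t - x) + norm d"
      have td: "norm (\<tau> n *\<^sub>R d) \<le> norm d" "norm (\<tau> n *\<^sub>R d) = \<tau> n * norm d"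
        using \<tau>(1,2)[of n] by (auto simp: mult_left_le_one_le)
      have eq: "X t - (x + \<tau> n *\<^sub>R d) = (X t - x) - \<tau> n *\<^sub>R d" by simp
      have diff: "\<bar>norm (X t - (x + \<tau> n *\<^sub>R d)) - norm (X t - x)\<bar> \<le> \<tau> n * norm d"
        unfolding eq td(2)[symmetric] using norm_triangle_ineq3[of "X t - x - \<tau> n *\<^sub>R d" "X t - x"] by simp
      have "norm (X t - (x + \<tau> n *\<^sub>R d)) \<le> ?K"
        unfolding eq using norm_triangle_ineq4[of "X t - x" "\<tau> n *\<^sub>R d"] td(1) by simp
      then have "\<bar>norm (X t - (x + \<tau> n *\<^sub>R d)) powr p - norm (X t - x) powr p\<bar>
          \<le> p * ?K powr (p - 1) * \<bar>norm (X t - (x + \<tau> n *\<^sub>R d)) - norm (X t - x)\<bar>"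
        by (intro powr_lipschitz[OF p]) auto
      also have "\<dots> \<le> p * ?K powr (p - 1) * (\<tau> n * norm d)"
        using p diff by (intro mult_left_mono) auto
      also have "\<dots> \<le> p * (1 + ?K powr p) * (\<tau> n * norm d)"
        using p \<tau>(1)[of n] by (intro mult_right_mono mult_left_mono pow_le) auto
      finally show "norm (Q n t) \<le> p * (1 + ?K powr p) * norm d"
        using \<tau>(1)[of n] by (simp add: Q_def abs_divide divide_le_eq mult_ac)
    qed
  qed
  also have "(\<integral>t. power_grad p (x - X t) \<bullet> d \<partial>M) = (\<integral>t. power_grad p (x - X t) \<partial>M) \<bullet> d"
    using grad_int by simp
  also have "(\<lambda>n. \<integral>t. Q n t \<partial>M) = (\<lambda>n. ((\<integral>t. norm (X t - (x + \<tau> n *\<^sub>R d)) powr p \<partial>M) - (\<integral>t. norm (X t - x) powr p \<partial>M)) / \<tau> n)"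
    unfolding Q_def using int shifted(2) by (simp add: Bochner_Integration.integral_diff)
  finally show "(\<lambda>n. ((\<integral>t. norm (X t - (x + \<tau> n *\<^sub>R d)) powr p \<partial>M) - (\<integral>t. norm (X t - x) powr p \<partial>M)) / \<tau> n)
      \<longlonglongrightarrow> (\<integral>t. power_grad p (x - X t) \<partial>M) \<bullet> d" .
qed

section \<open>The decoupled penalized problem\<close>

lemma nonneg_inner_imp_zero:
  fixes v :: "'a::euclidean_space"
  assumes "\<And>d. 0 \<le> v \<bullet> d"
  shows "v = 0"
  using assms[of "- v"] by (simp add: inner_minus_right) (metis inner_ge_zero inner_eq_zero_iff order_antisym)

text \<open>
  The Borel \<open>\<sigma>\<close>-algebra of a product type is not syntactically a product \<open>\<sigma>\<close>-algebra, so the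
  measurability of the projections is obtained from their continuity.
\<close>

lemma measurable_fst_snd_borel:
  "(\<lambda>z. fst (snd z)) \<in> borel_measurable (M \<Otimes>\<^sub>M (borel :: ('a::euclidean_space \<times> 'b::euclidean_space) measure))"
  "(\<lambda>z. snd (snd z)) \<in> borel_measurable (M \<Otimes>\<^sub>M (borel :: ('a::euclidean_space \<times> 'b::euclidean_space) measure))"
proof -
  have "fst \<in> borel_measurable (borel :: ('a \<times> 'b) measure)" "snd \<in> borel_measurable (borel :: ('a \<times> 'b) measure)"
    by (intro borel_measurable_continuous_onI continuous_intros)+
  from this[THEN measurable_compose[OF measurable_snd]]
  show "(\<lambda>z. fst (snd z)) \<in> borel_measurable (M \<Otimes>\<^sub>M (borel :: ('a \<times> 'b) measure))"
    "(\<lambda>z. snd (snd z)) \<in> borel_measurable (M \<Otimes>\<^sub>M (borel :: ('a \<times> 'b) measure))" by auto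
qed

context growing_integrand
begin

definition penalty :: "real \<Rightarrow> real \<Rightarrow> real \<Rightarrow> 'a \<Rightarrow> 't \<Rightarrow> 'a \<times> 'b \<Rightarrow> real" where
  "penalty p r s x t z = 2 * \<epsilon> * smooth_norm s (snd z - yb t) + r * norm (fst z - x) powr p"

text \<open>
  The part of the penalized objective that depends on \<open>x\<close> alone.
\<close>

definition cost :: "real \<Rightarrow> 'a \<Rightarrow> real" where
  "cost s x = 2 * \<epsilon> * smooth_norm s (x - xb) - xs \<bullet> (x - xb)"

lemma scaled_smooth_norm_nonneg: "0 \<le> s \<Longrightarrow> 0 \<le> 2 * \<epsilon> * smooth_norm s u"
  using \<epsilon> by (intro mult_nonneg_nonneg smooth_norm_bounds(1)) auto

lemma cost_xb [simp]: "0 \<le> s \<Longrightarrow> cost s xb = 0"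
  by (simp add: cost_def)

lemma cost_lower: "0 \<le> s \<Longrightarrow> norm (x - xb) \<le> \<delta> \<Longrightarrow> 0 \<le> cost s x + norm xs * \<delta>"
proof -
  assume s: "0 \<le> s" and x: "norm (x - xb) \<le> \<delta>"
  have "xs \<bullet> (x - xb) \<le> norm xs * norm (x - xb)" by (rule norm_cauchy_schwarz)
  also have "\<dots> \<le> norm xs * \<delta>" using x by (intro mult_left_mono) auto
  moreover note scaled_smooth_norm_nonneg[OF s, of "x - xb"]
  ultimately show ?thesis unfolding cost_def by linarith
qed

lemma penalty_nonneg: "0 \<le> r \<Longrightarrow> 0 \<le> s \<Longrightarrow> 0 \<le> penalty p r s x t z"
  unfolding penalty_def by (intro add_nonneg_nonneg scaled_smooth_norm_nonneg) auto

lemma penalty_split: "0 \<le> r \<Longrightarrow> 0 \<le> s \<Longrightarrow>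
  ennreal (penalty p r s x t z) = ennreal (2 * \<epsilon> * smooth_norm s (snd z - yb t)) + ennreal (r * norm (fst z - x) powr p)"
  unfolding penalty_def by (intro ennreal_plus scaled_smooth_norm_nonneg) auto

lemma penalty_measurable: "(\<lambda>z. penalty p r s x (fst z) (snd z)) \<in> borel_measurable (M \<Otimes>\<^sub>M borel)"
proof -
  have "(\<lambda>z. snd (snd z) - yb (fst z)) \<in> borel_measurable (M \<Otimes>\<^sub>M (borel :: ('a \<times> 'b) measure))"
    by (intro borel_measurable_diff measurable_fst_snd_borel measurable_compose[OF measurable_fst yb_meas])
  from measurable_compose[OF this measurable_smooth_norm[of s]]
  have "(\<lambda>z. 2 * \<epsilon> * smooth_norm s (snd (snd z) - yb (fst z)))
      \<in> borel_measurable (M \<Otimes>\<^sub>M (borel :: ('a \<times> 'b) measure))"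
    by (rule borel_measurable_times[OF borel_measurable_const])
  moreover have "(\<lambda>z. fst (snd z) - x) \<in> borel_measurable (M \<Otimes>\<^sub>M (borel :: ('a \<times> 'b) measure))"
    by (intro borel_measurable_diff measurable_fst_snd_borel measurable_const) auto
  from measurable_compose[OF measurable_compose[OF this borel_measurable_norm], of "\<lambda>u. r * u powr p"]
  have "(\<lambda>z. r * norm (fst (snd z) - x) powr p)
      \<in> borel_measurable (M \<Otimes>\<^sub>M (borel :: ('a \<times> 'b) measure))"
    by simp
  ultimately show ?thesis unfolding penalty_def by (rule borel_measurable_add)
qed

lemma penalty_tendsto:
  assumes p: "1 < p" and x: "u \<longlonglongrightarrow> x" and z: "z \<longlonglongrightarrow> l"
  shows "(\<lambda>j. penalty p r s (u j) t (z j)) \<longlonglongrightarrow> penalty p r s x t l"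
  unfolding penalty_def
proof (intro tendsto_add tendsto_mult tendsto_const tendsto_smooth_norm tendsto_diff tendsto_snd z)
  show "(\<lambda>j. norm (fst (z j) - u j) powr p) \<longlonglongrightarrow> norm (fst l - x) powr p"
    using p by (intro tendsto_powr' tendsto_intros x z) auto
qed

lemma penalty_continuous: "1 < p \<Longrightarrow> continuous_on UNIV (penalty p r s x t)"
  by (intro continuous_at_imp_continuous_on ballI continuous_at_sequentiallyI penalty_tendsto tendsto_const) auto

lemma penalty_coercive:
  assumes r: "0 < r" and s: "0 \<le> s" and p: "1 < p" and le: "penalty p r s x t z \<le> C"
  shows "norm z \<le> norm x + 1 + C / r + (C / (2 * \<epsilon>) + s + norm (yb t))"
proof -
  note 0 = scaled_smooth_norm_nonneg[OF s, of "snd z - yb t"]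
  have 1: "0 \<le> r * norm (fst z - x) powr p" using r by simp
  have "2 * \<epsilon> * smooth_norm s (snd z - yb t) \<le> C" using le 1 unfolding penalty_def by linarith
  then have "smooth_norm s (snd z - yb t) \<le> C / (2 * \<epsilon>)" using \<epsilon> by (simp add: field_simps)
  then have A: "norm (snd z) \<le> C / (2 * \<epsilon>) + s + norm (yb t)"
    using smooth_norm_bounds(3)[OF s, of "snd z - yb t"] norm_triangle_ineq2[of "snd z" "yb t"] by linarith
  have "r * norm (fst z - x) powr p \<le> C" using le 0 unfolding penalty_def by linarith
  then have "norm (fst z - x) powr p \<le> C / r" using r by (simp add: field_simps)
  then have "norm (fst z - x) \<le> 1 + C / r" using base_le_powr[of "norm (fst z - x)" p] p by simp
  then have B: "norm (fst z) \<le> norm x + 1 + C / r" using norm_triangle_ineq2[of "fst z" x] by linarith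
  have "norm z \<le> norm (fst z) + norm (snd z)" using norm_Pair_le[of "fst z" "snd z"] by simp
  then show ?thesis using A B by linarith
qed

lemma joint_argmin:
  assumes p: "1 < p" and r: "0 < r" and s: "0 \<le> s"
  shows "\<exists>Z\<in>borel_measurable M. \<forall>t\<in>space M. \<forall>z.
    G t (Z t) + ennreal (penalty p r s x t (Z t)) \<le> G t z + ennreal (penalty p r s x t z)"
proof (rule measurable_argmin[where P = "penalty p r s x", OF finM completeM lsc penalty_measurable])
  show "continuous_on UNIV (penalty p r s x t)" for t by (rule penalty_continuous[OF p])
  show "bounded {z. penalty p r s x t z \<le> C}" for t C
    unfolding bounded_iff using penalty_coercive[OF r s p] by blast
qed

definition penalized_value :: "real \<Rightarrow> real \<Rightarrow> real \<Rightarrow> 'a \<Rightarrow> ('t \<Rightarrow> 'a \<times> 'b) \<Rightarrow> ennreal" where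
  "penalized_value p r s x Z = (\<integral>\<^sup>+t. G t (Z t) + ennreal (penalty p r s x t (Z t)) \<partial>M)"

text \<open>
  The third condition is minimality at each point, the fourth minimality of the whole objective over
  the ball. The constant \<open>norm xs * \<delta>\<close> makes the terms outside the integral nonnegative on the ball,
  so that everything can be compared in \<^typ>\<open>ennreal\<close>.
\<close>

definition optimal :: "real \<Rightarrow> real \<Rightarrow> real \<Rightarrow> real \<Rightarrow> 'a \<Rightarrow> ('t \<Rightarrow> 'a \<times> 'b) \<Rightarrow> bool" where
  "optimal p r s \<delta> x Z \<longleftrightarrow> Z \<in> borel_measurable M \<and> norm (x - xb) \<le> \<delta> \<and>
     (\<forall>t\<in>space M. \<forall>z. G t (Z t) + ennreal (penalty p r s x t (Z t)) \<le> G t z + ennreal (penalty p r s x t z)) \<and>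
     (\<forall>x' Z'. Z' \<in> borel_measurable M \<longrightarrow> norm (x' - xb) \<le> \<delta> \<longrightarrow>
       penalized_value p r s x Z + ennreal (cost s x + norm xs * \<delta>) \<le> penalized_value p r s x' Z' + ennreal (cost s x' + norm xs * \<delta>))"

lemma G_comp_meas: "Z \<in> borel_measurable M \<Longrightarrow> (\<lambda>t. G t (Z t)) \<in> borel_measurable M"
proof -
  assume Z: "Z \<in> borel_measurable M"
  have "(\<lambda>t. (t, Z t)) \<in> measurable M (M \<Otimes>\<^sub>M borel)" using Z by (intro measurable_Pair) auto
  from measurable_compose[OF this lsc[unfolded lsc_integrand_def, THEN conjunct1]] show ?thesis by simp
qed

lemma penalty_comp_meas: "Z \<in> borel_measurable M \<Longrightarrow> (\<lambda>t. penalty p r s x t (Z t)) \<in> borel_measurable M"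
proof -
  assume Z: "Z \<in> borel_measurable M"
  have "(\<lambda>t. (t, Z t)) \<in> measurable M (M \<Otimes>\<^sub>M borel)" using Z by (intro measurable_Pair) auto
  from measurable_compose[OF this penalty_measurable[of p r s x]] show ?thesis by simp
qed

text \<open>
  Fatou's lemma, with the integrands compared pointwise by the direct method.
\<close>

lemma penalized_value_lsc:
  assumes p: "1 < p" and r: "0 < r" and s: "0 \<le> s" and x: "u \<longlonglongrightarrow> x"
    and Z: "\<And>j. Z j \<in> borel_measurable M" "Zx \<in> borel_measurable M"
    and min: "\<And>t z. t \<in> space M \<Longrightarrow>
      G t (Zx t) + ennreal (penalty p r s x t (Zx t)) \<le> G t z + ennreal (penalty p r s x t z)"
  shows "penalized_value p r s x Zx \<le> liminf (\<lambda>j. penalized_value p r s (u j) (Z j))"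
proof -
  let ?H = "\<lambda>j t. G t (Z j t) + ennreal (penalty p r s (u j) t (Z j t))"
  have H: "?H j \<in> borel_measurable M" for j
    by (intro borel_measurable_add G_comp_meas measurable_compose[OF _ measurable_ennreal] penalty_comp_meas Z)
  have pt: "G t (Zx t) + ennreal (penalty p r s x t (Zx t)) \<le> liminf (\<lambda>j. ?H j t)" if t: "t \<in> space M" for t
  proof (cases "liminf (\<lambda>j. ?H j t) < \<infinity>")
    case fin: True
    obtain \<tau> where \<tau>: "strict_mono (\<tau> :: nat \<Rightarrow> nat)" "((\<lambda>j. ?H j t) \<circ> \<tau>) \<longlonglongrightarrow> liminf (\<lambda>j. ?H j t)"
      using liminf_subseq_lim by blast
    obtain K where K: "\<And>j. norm (u j) \<le> K" using convergent_imp_bounded[OF x] by (auto simp: bounded_iff)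
    have "\<exists>\<sigma> l. strict_mono \<sigma> \<and> (\<lambda>j. Z (\<tau> (\<sigma> j)) t) \<longlonglongrightarrow> l \<and>
      G t l + ennreal (penalty p r s x t l) \<le> liminf (\<lambda>j. ?H j t)"
    proof (rule seq_lsc_penalized_limit[where z = "\<lambda>j. Z (\<tau> j) t" and P = "penalty p r s x t" and
          \<rho> = "\<lambda>j. penalty p r s (u (\<tau> j)) t (Z (\<tau> j) t)", OF G_seq_lsc[OF t] _ \<tau>(2) fin])
      show "G t (Z (\<tau> j) t) + ennreal (penalty p r s (u (\<tau> j)) t (Z (\<tau> j) t)) \<le> ((\<lambda>j. ?H j t) \<circ> \<tau>) j" for j
        by simp
      fix C
      have "norm (Z (\<tau> j) t) \<le> K + 1 + C / r + (C / (2 * \<epsilon>) + s + norm (yb t))"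
        if "penalty p r s (u (\<tau> j)) t (Z (\<tau> j) t) \<le> C" for j
        using penalty_coercive[OF r s p that] K[of "\<tau> j"] by linarith
      then show "\<exists>K. \<forall>j. penalty p r s (u (\<tau> j)) t (Z (\<tau> j) t) \<le> C \<longrightarrow> norm (Z (\<tau> j) t) \<le> K" by blast
    next
      fix \<sigma> :: "nat \<Rightarrow> nat" and l assume \<sigma>: "strict_mono \<sigma>" and l: "(\<lambda>j. Z (\<tau> (\<sigma> j)) t) \<longlonglongrightarrow> l"
      have "(\<lambda>j. u (\<tau> (\<sigma> j))) \<longlonglongrightarrow> x"
        using LIMSEQ_subseq_LIMSEQ[OF LIMSEQ_subseq_LIMSEQ[OF x \<tau>(1)] \<sigma>] by (simp add: o_def)
      then show "(\<lambda>j. penalty p r s (u (\<tau> (\<sigma> j))) t (Z (\<tau> (\<sigma> j)) t)) \<longlonglongrightarrow> penalty p r s x t l"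
        by (intro penalty_tendsto p l)
    qed
    then obtain l where l: "G t l + ennreal (penalty p r s x t l) \<le> liminf (\<lambda>j. ?H j t)" by blast
    show ?thesis using min[OF t, of l] l by (rule order_trans)
  next
    case False then show ?thesis by (simp add: less_top[symmetric])
  qed
  have "penalized_value p r s x Zx \<le> (\<integral>\<^sup>+t. liminf (\<lambda>j. ?H j t) \<partial>M)"
    unfolding penalized_value_def by (intro nn_integral_mono pt)
  also have "\<dots> \<le> liminf (\<lambda>j. \<integral>\<^sup>+t. ?H j t \<partial>M)" by (rule nn_integral_liminf[OF H])
  finally show ?thesis unfolding penalized_value_def .
qed

text \<open>
  For each \<open>x\<close> the minimization over \<open>Z\<close> is solved pointwise by \<open>measurable_argmin\<close>. The resulting
  function of \<open>x\<close> is lower semicontinuous, so it attains its infimum on the compact ball.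
\<close>

lemma optimal_exists:
  assumes p: "1 < p" and r: "0 < r" and s: "0 \<le> s" and \<delta>: "0 < \<delta>"
  shows "\<exists>x Z. optimal p r s \<delta> x Z"
proof -
  have "\<exists>Z. Z \<in> borel_measurable M \<and> (\<forall>t\<in>space M. \<forall>z.
    G t (Z t) + ennreal (penalty p r s x t (Z t)) \<le> G t z + ennreal (penalty p r s x t z))" for x
    using joint_argmin[OF p r s, of x] by blast
  then obtain Z where Z: "\<And>x. Z x \<in> borel_measurable M"
    and Z_min: "\<And>x t z. t \<in> space M \<Longrightarrow>
      G t (Z x t) + ennreal (penalty p r s x t (Z x t)) \<le> G t z + ennreal (penalty p r s x t z)"
    by metis
  define k where "k x = ennreal (cost s x + norm xs * \<delta>)" for x
  define \<Phi> where "\<Phi> x = penalized_value p r s x (Z x) + k x" for x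
  define m where "m = Inf (\<Phi> ` cball xb \<delta>)"
  have "\<Phi> ` cball xb \<delta> \<noteq> {}" using \<delta> by auto
  from Inf_as_limit[OF this] obtain c where c: "\<And>n. c n \<in> \<Phi> ` cball xb \<delta>" "c \<longlonglongrightarrow> m"
    unfolding m_def by blast
  from c(1) have "\<exists>u. u \<in> cball xb \<delta> \<and> \<Phi> u = c n" for n by (metis imageE)
  then obtain u where u: "\<And>n. u n \<in> cball xb \<delta>" "\<And>n. \<Phi> (u n) = c n" by metis
  have "\<exists>l\<in>cball xb \<delta>. \<exists>\<tau>. strict_mono (\<tau>::nat \<Rightarrow> nat) \<and> (u \<circ> \<tau>) \<longlonglongrightarrow> l"
    by (rule compact_cball[unfolded compact_eq_seq_compact_metric seq_compact_def, rule_format]) (rule u)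
  then obtain x \<tau> where x: "x \<in> cball xb \<delta>" and \<tau>: "strict_mono (\<tau>::nat \<Rightarrow> nat)" and lim: "(u \<circ> \<tau>) \<longlonglongrightarrow> x"
    by blast
  have \<Phi>_le: "\<Phi> x \<le> m"
  proof (cases "m = \<infinity>")
    case False
    have \<Phi>_lim: "(\<lambda>j. \<Phi> (u (\<tau> j))) \<longlonglongrightarrow> m"
      using LIMSEQ_subseq_LIMSEQ[OF c(2) \<tau>] by (simp add: o_def u(2))
    have k_lim: "(\<lambda>j. k (u (\<tau> j))) \<longlonglongrightarrow> k x"
      unfolding k_def cost_def using lim by (intro tendsto_ennrealI tendsto_intros) (simp_all add: o_def)
    have "(\<lambda>j. \<Phi> (u (\<tau> j)) - k (u (\<tau> j))) \<longlonglongrightarrow> m - k x"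
      using False by (intro tendsto_diff_ennreal \<Phi>_lim k_lim) (auto simp: k_def)
    moreover have "\<Phi> (u (\<tau> j)) - k (u (\<tau> j)) = penalized_value p r s (u (\<tau> j)) (Z (u (\<tau> j)))" for j
      by (simp add: \<Phi>_def k_def)
    ultimately have V_lim: "(\<lambda>j. penalized_value p r s (u (\<tau> j)) (Z (u (\<tau> j)))) \<longlonglongrightarrow> m - k x" by simp
    have "penalized_value p r s x (Z x) \<le> liminf (\<lambda>j. penalized_value p r s (u (\<tau> j)) (Z (u (\<tau> j))))"
      using lim by (intro penalized_value_lsc[OF p r s _ Z Z Z_min]) (simp_all add: o_def)
    also have "\<dots> = m - k x" using V_lim by (intro lim_imp_Liminf) auto
    finally have 1: "penalized_value p r s x (Z x) \<le> m - k x" .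
    have "k x \<le> m"
      by (rule LIMSEQ_le[OF k_lim \<Phi>_lim]) (auto simp: \<Phi>_def)
    then have "m - k x + k x = m" by (rule diff_add_cancel_ennreal)
    then show ?thesis using add_right_mono[OF 1, of "k x"] by (simp add: \<Phi>_def)
  qed simp
  have "optimal p r s \<delta> x (Z x)"
    unfolding optimal_def
  proof (intro conjI ballI allI impI Z Z_min)
    show "norm (x - xb) \<le> \<delta>" using x by (simp add: dist_norm norm_minus_commute)
    fix x' and Z' :: "'t \<Rightarrow> 'a \<times> 'b" assume Z': "Z' \<in> borel_measurable M" and x': "norm (x' - xb) \<le> \<delta>"
    have "x' \<in> cball xb \<delta>" using x' by (simp add: dist_norm norm_minus_commute)
    then have "m \<le> \<Phi> x'" unfolding m_def by (intro Inf_lower imageI)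
    moreover have "penalized_value p r s x' (Z x') \<le> penalized_value p r s x' Z'"
      unfolding penalized_value_def by (intro nn_integral_mono Z_min)
    ultimately show "penalized_value p r s x (Z x) + ennreal (cost s x + norm xs * \<delta>)
        \<le> penalized_value p r s x' Z' + ennreal (cost s x' + norm xs * \<delta>)"
      using \<Phi>_le unfolding \<Phi>_def k_def by (meson add_right_mono order_trans)
  qed
  then show ?thesis by blast
qed

text \<open>
  Fermat's rule in the variable \<open>x\<close> with \<open>X\<close> kept fixed: all one-sided directional derivatives at an
  interior minimizer are nonnegative and, being linear in the direction, zero.
\<close>

lemma stationary_point:
  fixes X :: "'t \<Rightarrow> 'a" and p r s \<delta> :: real and x :: 'a
  defines "N \<equiv> \<lambda>x. \<integral>t. norm (X t - x) powr p \<partial>M"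
  assumes p: "1 < p" and s: "0 < s" and X: "X \<in> borel_measurable M"
    and int: "integrable M (\<lambda>t. norm (X t - x) powr p)"
    and opt: "\<And>x'. norm (x' - xb) \<le> \<delta> \<Longrightarrow> r * N x + cost s x \<le> r * N x' + cost s x'"
    and interior: "norm (x - xb) < \<delta>"
  shows "r *\<^sub>R (\<integral>t. power_grad p (x - X t) \<partial>M) = xs - (2 * \<epsilon>) *\<^sub>R smooth_norm_grad s (x - xb)"
proof -
  define g where "g = (\<integral>t. power_grad p (x - X t) \<partial>M)"
  define v where "v = r *\<^sub>R g + ((2 * \<epsilon>) *\<^sub>R smooth_norm_grad s (x - xb) - xs)"
  have "0 \<le> v \<bullet> d" for d
  proof -
    (* the segment from x in direction d of length \<tau>0 stays in the ball *)
    define \<tau>0 where "\<tau>0 = min 1 ((\<delta> - norm (x - xb)) / (norm d + 1))"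
    have den: "0 < norm d + 1" by (simp add: add_nonneg_pos)
    have \<tau>0: "0 < \<tau>0" "\<tau>0 \<le> 1" using interior den by (auto simp: \<tau>0_def)
    have "\<tau>0 * norm d \<le> (\<delta> - norm (x - xb)) / (norm d + 1) * (norm d + 1)"
      using interior by (intro mult_mono) (auto simp: \<tau>0_def)
    then have \<tau>0_d: "\<tau>0 * norm d \<le> \<delta> - norm (x - xb)" using den by simp
    define \<tau> where "\<tau> n = \<tau>0 / real (Suc n)" for n
    have \<tau>_pos: "0 < \<tau> n" for n using \<tau>0 by (simp add: \<tau>_def)
    have \<tau>_le: "\<tau> n \<le> \<tau>0" for n using \<tau>0 by (simp add: \<tau>_def divide_le_eq)
    have \<tau>_lim: "\<tau> \<longlonglongrightarrow> 0"
      unfolding \<tau>_def by (rule LIMSEQ_Suc[OF lim_const_over_n])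
    have \<tau>_at: "filterlim \<tau> (at 0) sequentially"
      using \<tau>_pos \<tau>_lim by (intro filterlim_atI) (auto simp: less_imp_neq[symmetric])
    have 1: "(\<lambda>n. (N (x + \<tau> n *\<^sub>R d) - N x) / \<tau> n) \<longlonglongrightarrow> g \<bullet> d"
      unfolding N_def g_def
      by (rule power_integral_directional_derivative(2)[OF finM X p int \<tau>_pos order_trans[OF \<tau>_le \<tau>0(2)] \<tau>_lim])
    have "((\<lambda>h. x - xb + h *\<^sub>R d) has_derivative (\<lambda>h. h *\<^sub>R d)) (at 0)"
      by (auto intro!: derivative_eq_intros)
    moreover have "(smooth_norm s has_derivative (\<lambda>h. smooth_norm_grad s (x - xb) \<bullet> h)) (at (x - xb + 0 *\<^sub>R d))"
      using has_derivative_smooth_norm[OF s, of "x - xb"] by simp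
    ultimately have "((\<lambda>h. smooth_norm s (x - xb + h *\<^sub>R d)) has_derivative (\<lambda>h. smooth_norm_grad s (x - xb) \<bullet> (h *\<^sub>R d))) (at 0)"
      by (rule has_derivative_compose)
    then have "((\<lambda>h. smooth_norm s (x - xb + h *\<^sub>R d)) has_real_derivative smooth_norm_grad s (x - xb) \<bullet> d) (at 0)"
      by (rule has_derivative_imp_has_field_derivative) simp
    then have "((\<lambda>h. (smooth_norm s (x - xb + h *\<^sub>R d) - smooth_norm s (x - xb)) / h) \<longlongrightarrow> smooth_norm_grad s (x - xb) \<bullet> d) (at 0)"
      by (simp add: DERIV_def)
    from filterlim_compose[OF this \<tau>_at]
    have 2: "(\<lambda>n. (smooth_norm s (x - xb + \<tau> n *\<^sub>R d) - smooth_norm s (x - xb)) / \<tau> n) \<longlonglongrightarrow> smooth_norm_grad s (x - xb) \<bullet> d" .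
    have "(\<lambda>n. r * ((N (x + \<tau> n *\<^sub>R d) - N x) / \<tau> n) +
        (2 * \<epsilon> * ((smooth_norm s (x - xb + \<tau> n *\<^sub>R d) - smooth_norm s (x - xb)) / \<tau> n) - xs \<bullet> d))
      \<longlonglongrightarrow> r * (g \<bullet> d) + (2 * \<epsilon> * (smooth_norm_grad s (x - xb) \<bullet> d) - xs \<bullet> d)"
      by (intro tendsto_intros 1 2)
    moreover have "0 \<le> r * ((N (x + \<tau> n *\<^sub>R d) - N x) / \<tau> n) +
        (2 * \<epsilon> * ((smooth_norm s (x - xb + \<tau> n *\<^sub>R d) - smooth_norm s (x - xb)) / \<tau> n) - xs \<bullet> d)" for n
    proof -
      have "norm (x + \<tau> n *\<^sub>R d - xb) \<le> norm (x - xb) + \<tau> n * norm d"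
        using norm_triangle_ineq[of "x - xb" "\<tau> n *\<^sub>R d"] \<tau>_pos[of n] by (simp add: algebra_simps)
      also have "\<tau> n * norm d \<le> \<tau>0 * norm d" using \<tau>_le by (intro mult_right_mono) auto
      finally have "norm (x + \<tau> n *\<^sub>R d - xb) \<le> \<delta>" using \<tau>0_d by simp
      from opt[OF this] have "0 \<le> r * (N (x + \<tau> n *\<^sub>R d) - N x) + (cost s (x + \<tau> n *\<^sub>R d) - cost s x)"
        by (simp add: algebra_simps)
      also have "cost s (x + \<tau> n *\<^sub>R d) - cost s x =
          2 * \<epsilon> * (smooth_norm s (x - xb + \<tau> n *\<^sub>R d) - smooth_norm s (x - xb)) - \<tau> n * (xs \<bullet> d)"
        by (simp add: cost_def algebra_simps)
      finally have "0 \<le> (r * (N (x + \<tau> n *\<^sub>R d) - N x) +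
          (2 * \<epsilon> * (smooth_norm s (x - xb + \<tau> n *\<^sub>R d) - smooth_norm s (x - xb)) - \<tau> n * (xs \<bullet> d))) / \<tau> n"
        using \<tau>_pos[of n] by (intro divide_nonneg_pos)
      moreover have "(r * a + (2 * \<epsilon> * b - w * c)) / w = r * (a / w) + (2 * \<epsilon> * (b / w) - c)"
        if "0 < w" for a b c w :: real
        using that by (simp add: field_simps)
      ultimately show ?thesis using \<tau>_pos[of n] by metis
    qed
    ultimately have "0 \<le> r * (g \<bullet> d) + (2 * \<epsilon> * (smooth_norm_grad s (x - xb) \<bullet> d) - xs \<bullet> d)"
      by (intro LIMSEQ_le_const) auto
    then show ?thesis by (simp add: v_def inner_add_left inner_diff_left)
  qed
  then have "v = 0" by (rule nonneg_inner_imp_zero)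
  then show ?thesis by (simp add: v_def g_def algebra_simps)
qed

end

section \<open>Vanishing penalties\<close>

lemma borel_measurable_fst_snd:
  assumes "Z \<in> borel_measurable M"
  shows "(\<lambda>t. fst (Z t) :: 'a::euclidean_space) \<in> borel_measurable M"
    and "(\<lambda>t. snd (Z t) :: 'b::euclidean_space) \<in> borel_measurable M"
proof -
  have "fst \<in> borel_measurable (borel :: ('a \<times> 'b) measure)" "snd \<in> borel_measurable (borel :: ('a \<times> 'b) measure)"
    by (intro borel_measurable_continuous_onI continuous_intros)+
  from this[THEN measurable_compose[OF assms]]
  show "(\<lambda>t. fst (Z t) :: 'a) \<in> borel_measurable M" "(\<lambda>t. snd (Z t) :: 'b) \<in> borel_measurable M" by auto
qed

context growing_integrand
begin

text \<open>
  The integrand without the power term; writing \<open>Z t\<close> as a pair matches \<open>value_convergence\<close>.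
\<close>

definition value_part :: "real \<Rightarrow> ('t \<Rightarrow> 'a \<times> 'b) \<Rightarrow> 't \<Rightarrow> ennreal" where
  "value_part s Z t = G t (fst (Z t), snd (Z t)) + ennreal (2 * \<epsilon> * smooth_norm s (snd (Z t) - yb t))"

definition power_part :: "real \<Rightarrow> 'a \<Rightarrow> ('t \<Rightarrow> 'a \<times> 'b) \<Rightarrow> real" where
  "power_part p x Z = (\<integral>t. norm (fst (Z t) - x) powr p \<partial>M)"

definition base_value :: real where
  "base_value = enn2real (\<integral>\<^sup>+t. G t (xb, yb t) \<partial>M)"

lemma value_part_meas: "Z \<in> borel_measurable M \<Longrightarrow> value_part s Z \<in> borel_measurable M"
proof -
  assume Z: "Z \<in> borel_measurable M"
  note [measurable] = borel_measurable_fst_snd[OF Z]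
  show ?thesis unfolding value_part_def by measurable
qed

lemma penalized_value_split:
  assumes Z: "Z \<in> borel_measurable M" and r: "0 \<le> r" and s: "0 \<le> s"
  shows "penalized_value p r s x Z = (\<integral>\<^sup>+t. value_part s Z t \<partial>M) + (\<integral>\<^sup>+t. ennreal (r * norm (fst (Z t) - x) powr p) \<partial>M)"
proof -
  note [measurable] = borel_measurable_fst_snd[OF Z]
  have "penalized_value p r s x Z = (\<integral>\<^sup>+t. value_part s Z t + ennreal (r * norm (fst (Z t) - x) powr p) \<partial>M)"
    unfolding penalized_value_def value_part_def by (simp add: penalty_split[OF r s] add.assoc)
  also have "\<dots> = (\<integral>\<^sup>+t. value_part s Z t \<partial>M) + (\<integral>\<^sup>+t. ennreal (r * norm (fst (Z t) - x) powr p) \<partial>M)"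
    using value_part_meas[OF Z] by (intro nn_integral_add) auto
  finally show ?thesis .
qed

text \<open>
  The first three items come from the competitor \<open>(xb, yb)\<close>, for which all penalties vanish. The last
  one keeps \<open>Z\<close> and varies \<open>x\<close>.
\<close>

lemma optimal_consequences:
  assumes p: "1 < p" and r: "0 < r" and s: "0 < s" and \<delta>: "0 < \<delta>" and opt: "optimal p r s \<delta> x Z"
  shows "(\<integral>\<^sup>+t. value_part s Z t \<partial>M) < \<infinity>"
    and "integrable M (\<lambda>t. norm (fst (Z t) - x) powr p)"
    and "enn2real (\<integral>\<^sup>+t. value_part s Z t \<partial>M) + r * power_part p x Z + cost s x \<le> base_value"
    and "norm (x - xb) < \<delta> \<Longrightarrow>
      r *\<^sub>R (\<integral>t. power_grad p (x - fst (Z t)) \<partial>M) = xs - (2 * \<epsilon>) *\<^sub>R smooth_norm_grad s (x - xb)"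
proof -
  have Z: "Z \<in> borel_measurable M" and x: "norm (x - xb) \<le> \<delta>"
    and min: "\<And>x' Z'. Z' \<in> borel_measurable M \<Longrightarrow> norm (x' - xb) \<le> \<delta> \<Longrightarrow>
       penalized_value p r s x Z + ennreal (cost s x + norm xs * \<delta>) \<le> penalized_value p r s x' Z' + ennreal (cost s x' + norm xs * \<delta>)"
    using opt unfolding optimal_def by blast+
  note [measurable] = borel_measurable_fst_snd[OF Z] value_part_meas[OF Z]
  have r0: "0 \<le> r" and s0: "0 \<le> s" using r s by auto
  have k: "0 \<le> norm xs * \<delta>" using \<delta> by simp
  note cx = cost_lower[OF s0 x]
  have "(\<lambda>t. (xb, yb t)) \<in> borel_measurable M" by measurable
  from min[OF this, of xb] have "penalized_value p r s x Z + ennreal (cost s x + norm xs * \<delta>)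
      \<le> (\<integral>\<^sup>+t. G t (xb, yb t) \<partial>M) + ennreal (norm xs * \<delta>)"
    using \<delta> s0 by (simp add: penalized_value_def penalty_def)
  then have le: "penalized_value p r s x Z + ennreal (cost s x + norm xs * \<delta>) \<le> ennreal (base_value + norm xs * \<delta>)"
    using finite_value k by (simp add: base_value_def)
  have "penalized_value p r s x Z \<le> penalized_value p r s x Z + ennreal (cost s x + norm xs * \<delta>)" by simp
  then have total_fin: "penalized_value p r s x Z < \<infinity>" using le le_less_trans ennreal_less_top by (metis infinity_ennreal_def)
  then show V: "(\<integral>\<^sup>+t. value_part s Z t \<partial>M) < \<infinity>" unfolding penalized_value_split[OF Z r0 s0] by simp
  have N: "(\<integral>\<^sup>+t. ennreal (r * norm (fst (Z t) - x) powr p) \<partial>M) < \<infinity>"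
    using total_fin unfolding penalized_value_split[OF Z r0 s0] by simp
  have "integrable M (\<lambda>t. r * norm (fst (Z t) - x) powr p)"
    using N r0 by (intro integrableI_bounded) auto
  then show int: "integrable M (\<lambda>t. norm (fst (Z t) - x) powr p)" using r by simp
  define v where "v = enn2real (\<integral>\<^sup>+t. value_part s Z t \<partial>M)"
  have v0: "0 \<le> v" by (simp add: v_def)
  have total_eq: "penalized_value p r s x' Z = ennreal (v + r * power_part p x' Z)" for x'
  proof -
    have "integrable M (\<lambda>t. norm (fst (Z t) - x') powr p)"
      by (rule integrable_shifted_power(2)[OF finM _ p int]) measurable
    then have "(\<integral>\<^sup>+t. ennreal (r * norm (fst (Z t) - x') powr p) \<partial>M) = ennreal (r * power_part p x' Z)"
      using r0 by (subst nn_integral_eq_integral) (auto simp: power_part_def)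
    moreover have "(\<integral>\<^sup>+t. value_part s Z t \<partial>M) = ennreal v" using V by (simp add: v_def)
    moreover have "0 \<le> power_part p x' Z" unfolding power_part_def by simp
    ultimately show ?thesis using v0 r0 unfolding penalized_value_split[OF Z r0 s0] by simp
  qed
  have pp: "0 \<le> power_part p x' Z" for x' unfolding power_part_def by simp
  have "ennreal (v + r * power_part p x Z + (cost s x + norm xs * \<delta>)) \<le> ennreal (base_value + norm xs * \<delta>)"
    using le cx v0 r0 pp unfolding total_eq by (simp add: ennreal_plus)
  then have "v + r * power_part p x Z + (cost s x + norm xs * \<delta>) \<le> base_value + norm xs * \<delta>"
    using k by (subst (asm) ennreal_le_iff) (auto simp: base_value_def)
  then show "enn2real (\<integral>\<^sup>+t. value_part s Z t \<partial>M) + r * power_part p x Z + cost s x \<le> base_value"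
    by (simp add: v_def)
  assume interior: "norm (x - xb) < \<delta>"
  show "r *\<^sub>R (\<integral>t. power_grad p (x - fst (Z t)) \<partial>M) = xs - (2 * \<epsilon>) *\<^sub>R smooth_norm_grad s (x - xb)"
  proof (rule stationary_point[OF p s _ int _ interior])
    show "(\<lambda>t. fst (Z t)) \<in> borel_measurable M" by measurable
    fix x' assume x': "norm (x' - xb) \<le> \<delta>"
    note cx' = cost_lower[OF s0 x']
    have "ennreal (v + r * power_part p x Z + (cost s x + norm xs * \<delta>))
        \<le> ennreal (v + r * power_part p x' Z + (cost s x' + norm xs * \<delta>))"
      using min[OF Z x'] cx cx' v0 r0 pp unfolding total_eq by (simp add: ennreal_plus)
    moreover have "0 \<le> v + r * power_part p x' Z + (cost s x' + norm xs * \<delta>)"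
      by (rule add_nonneg_nonneg[OF add_nonneg_nonneg[OF v0 mult_nonneg_nonneg[OF r0 pp]] cx'])
    ultimately have "v + r * power_part p x Z + (cost s x + norm xs * \<delta>)
        \<le> v + r * power_part p x' Z + (cost s x' + norm xs * \<delta>)"
      by (simp only: ennreal_le_iff)
    then show "r * (\<integral>t. norm (fst (Z t) - x) powr p \<partial>M) + cost s x
        \<le> r * (\<integral>t. norm (fst (Z t) - x') powr p \<partial>M) + cost s x'"
      by (simp add: power_part_def)
  qed
qed

text \<open>
  Solve the penalized problem with \<open>r = j + 1\<close> and \<open>s = 1 / (j + 1)\<close>. The power terms tend to zero, so
  along a subsequence \<open>x j\<close> and the first component of \<open>Z j\<close> have a common limit \<open>x0\<close>. By Fatou's lemma
  the limit problem has at \<open>x0\<close> a value no larger than at \<open>xb\<close>, and \<open>isolated_minimizer\<close> gives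
  \<open>x0 = xb\<close>. Then \<open>value_convergence\<close> applies, and comparing integrals once more shows that even
  \<open>r\<close> times the power term tends to zero.
\<close>

lemma approximate_solutions:
  assumes p: "1 < p"
  shows "\<exists>\<delta> x Z r s. 0 < \<delta> \<and> (\<forall>j. 0 < r j \<and> 0 < s j \<and> optimal p (r j) (s j) \<delta> (x j) (Z j)) \<and>
    x \<longlonglongrightarrow> xb \<and>
    (\<forall>j. integrable M (\<lambda>t. snd (Z j t))) \<and>
    (AE t in M. (\<lambda>j. snd (Z j t)) \<longlonglongrightarrow> yb t) \<and>
    (\<lambda>j. \<integral>t. norm (snd (Z j t) - yb t) \<partial>M) \<longlonglongrightarrow> 0 \<and>
    (\<lambda>j. r j * power_part p (x j) (Z j)) \<longlonglongrightarrow> 0 \<and>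
    (\<lambda>j. power_part p (x j) (Z j)) \<longlonglongrightarrow> 0 \<and>
    (\<lambda>j. \<integral>t. \<bar>enn2real (G t (fst (Z j t), snd (Z j t))) - enn2real (G t (xb, yb t))\<bar> \<partial>M) \<longlonglongrightarrow> 0"
proof -
  obtain \<delta> where \<delta>: "0 < \<delta>" and isolated: "\<And>x y. y \<in> borel_measurable M \<Longrightarrow> norm (x - xb) \<le> \<delta> \<Longrightarrow>
     (\<integral>\<^sup>+t. G t (x, y t) + ennreal (2 * \<epsilon> * norm (y t - yb t)) \<partial>M) < \<infinity> \<Longrightarrow>
     enn2real (\<integral>\<^sup>+t. G t (x, y t) + ennreal (2 * \<epsilon> * norm (y t - yb t)) \<partial>M) - xs \<bullet> (x - xb) + 2 * \<epsilon> * norm (x - xb)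
       \<le> enn2real (\<integral>\<^sup>+t. G t (xb, yb t) \<partial>M) \<Longrightarrow> x = xb"
    using isolated_minimizer by blast
  define r where "r j = real (Suc j)" for j
  define s where "s j = 1 / real (Suc j)" for j
  have r: "0 < r j" and s: "0 < s j" for j by (simp_all add: r_def s_def)
  have s_lim: "s \<longlonglongrightarrow> 0" unfolding s_def using LIMSEQ_inverse_real_of_nat by (simp add: inverse_eq_divide)
  have "\<exists>x Z. optimal p (r j) (s j) \<delta> x Z" for j
    by (rule optimal_exists[OF p r less_imp_le[OF s] \<delta>])
  then obtain x Z where opt: "\<And>j. optimal p (r j) (s j) \<delta> (x j) (Z j)" by metis
  note cons = optimal_consequences[OF p r s \<delta> opt]
  have Z: "Z j \<in> borel_measurable M" and x_le: "norm (x j - xb) \<le> \<delta>" for j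
    using opt[of j] unfolding optimal_def by blast+
  note fs = borel_measurable_fst_snd[OF Z]
  define V where "V j = enn2real (\<integral>\<^sup>+t. value_part (s j) (Z j) t \<partial>M)" for j
  define N where "N j = power_part p (x j) (Z j)" for j
  have V0: "0 \<le> V j" and N0: "0 \<le> N j" for j by (simp_all add: V_def N_def power_part_def)
  have VN: "V j + r j * N j + cost (s j) (x j) \<le> base_value" for j
    unfolding V_def N_def by (rule cons(3))
  have base0: "0 \<le> base_value" by (simp add: base_value_def)
  have rN_le: "r j * N j \<le> base_value + norm xs * \<delta>" for j
    using VN[of j] V0[of j] cost_lower[OF less_imp_le[OF s] x_le, of j j] by linarith
  have N_lim: "N \<longlonglongrightarrow> 0"
  proof (rule tendsto_sandwich[where f = "\<lambda>_. 0" and h = "\<lambda>j. (base_value + norm xs * \<delta>) * s j"])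
    show "eventually (\<lambda>j. N j \<le> (base_value + norm xs * \<delta>) * s j) sequentially"
      using rN_le by (intro always_eventually allI) (simp add: r_def s_def field_simps)
    show "(\<lambda>j. (base_value + norm xs * \<delta>) * s j) \<longlonglongrightarrow> 0" by (rule tendsto_mult_right_zero[OF s_lim])
  qed (use N0 in auto)
  have "\<exists>l\<in>cball xb \<delta>. \<exists>\<tau>. strict_mono (\<tau>::nat \<Rightarrow> nat) \<and> (x \<circ> \<tau>) \<longlonglongrightarrow> l"
    by (rule compact_cball[unfolded compact_eq_seq_compact_metric seq_compact_def, rule_format])
      (use x_le in \<open>simp add: dist_norm norm_minus_commute\<close>)
  then obtain x0 \<tau>1 where x0: "norm (x0 - xb) \<le> \<delta>" and \<tau>1: "strict_mono (\<tau>1::nat \<Rightarrow> nat)" and x_lim1: "(x \<circ> \<tau>1) \<longlonglongrightarrow> x0"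
    by (auto simp: dist_norm norm_minus_commute)
  have "\<exists>\<tau>. strict_mono (\<tau>::nat \<Rightarrow> nat) \<and>
      (AE t in M. (\<lambda>j. norm (fst (Z (\<tau>1 (\<tau> j)) t) - x (\<tau>1 (\<tau> j))) powr p) \<longlonglongrightarrow> 0)"
  proof (rule tendsto_L1_AE_subseq)
    show "integrable M (\<lambda>t. norm (fst (Z (\<tau>1 j) t) - x (\<tau>1 j)) powr p)" for j by (rule cons(2))
    show "(\<lambda>j. \<integral>t. norm (norm (fst (Z (\<tau>1 j) t) - x (\<tau>1 j)) powr p) \<partial>M) \<longlonglongrightarrow> 0"
      using LIMSEQ_subseq_LIMSEQ[OF N_lim \<tau>1] by (simp add: N_def power_part_def o_def)
  qed
  then obtain \<tau>2 where \<tau>2: "strict_mono (\<tau>2::nat \<Rightarrow> nat)"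
    and pw: "AE t in M. (\<lambda>j. norm (fst (Z (\<tau>1 (\<tau>2 j)) t) - x (\<tau>1 (\<tau>2 j))) powr p) \<longlonglongrightarrow> 0" by blast
  define \<tau> where "\<tau> j = \<tau>1 (\<tau>2 j)" for j
  have \<tau>: "strict_mono \<tau>" using \<tau>1 \<tau>2 by (auto simp: strict_mono_def \<tau>_def)
  have x_lim: "(\<lambda>j. x (\<tau> j)) \<longlonglongrightarrow> x0"
    using LIMSEQ_subseq_LIMSEQ[OF x_lim1 \<tau>2] by (simp add: o_def \<tau>_def)
  have s\<tau>: "(\<lambda>j. s (\<tau> j)) \<longlonglongrightarrow> 0" using LIMSEQ_subseq_LIMSEQ[OF s_lim \<tau>] by (simp add: o_def)
  have X_lim: "AE t in M. (\<lambda>j. fst (Z (\<tau> j) t)) \<longlonglongrightarrow> x0"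
    using pw
  proof eventually_elim
    case (elim t)
    have "(\<lambda>j. (norm (fst (Z (\<tau> j) t) - x (\<tau> j)) powr p) powr (1 / p)) \<longlonglongrightarrow> 0"
      by (rule tendsto_zero_powrI[OF elim[folded \<tau>_def] tendsto_const]) (use p in auto)
    then have "(\<lambda>j. norm (fst (Z (\<tau> j) t) - x (\<tau> j))) \<longlonglongrightarrow> 0" using p by (simp add: powr_powr)
    from tendsto_add[OF tendsto_norm_zero_cancel[OF this] x_lim] show ?case by simp
  qed
  have cost_lim: "(\<lambda>j. cost (s (\<tau> j)) (x (\<tau> j))) \<longlonglongrightarrow> 2 * \<epsilon> * norm (x0 - xb) - xs \<bullet> (x0 - xb)"
  proof -
    have "(\<lambda>j. cost (s (\<tau> j)) (x (\<tau> j))) \<longlonglongrightarrow> 2 * \<epsilon> * smooth_norm 0 (x0 - xb) - xs \<bullet> (x0 - xb)"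
      unfolding cost_def by (intro tendsto_intros s\<tau> x_lim)
    then show ?thesis by simp
  qed
  have V_le: "V j \<le> base_value - cost (s j) (x j)" for j
    using VN[of j] mult_nonneg_nonneg[OF less_imp_le[OF r] N0, of j j] by linarith
  obtain y0 where y0 [measurable]: "y0 \<in> borel_measurable M"
    and y0_min: "\<And>t w. t \<in> space M \<Longrightarrow>
      G t (x0, y0 t) + ennreal (2 * \<epsilon> * norm (y0 t - yb t)) \<le> G t (x0, w) + ennreal (2 * \<epsilon> * norm (w - yb t))"
    using section_argmin[of "2 * \<epsilon>" x0] \<epsilon> by auto
  (* the value of the limit problem at x0, compared below with the bound k that survives the limit *)
  define W where "W = (\<integral>\<^sup>+t. G t (x0, y0 t) + ennreal (2 * \<epsilon> * norm (y0 t - yb t)) \<partial>M)"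
  define k where "k = base_value - (2 * \<epsilon> * norm (x0 - xb) - xs \<bullet> (x0 - xb))"
  have k_lim: "(\<lambda>j. base_value - cost (s (\<tau> j)) (x (\<tau> j))) \<longlonglongrightarrow> k"
    unfolding k_def by (intro tendsto_intros cost_lim)
  have k0: "0 \<le> k"
    using V_le V0 by (intro LIMSEQ_le_const[OF k_lim]) (meson order_trans)
  have "W \<le> (\<integral>\<^sup>+t. liminf (\<lambda>j. value_part (s (\<tau> j)) (Z (\<tau> j)) t) \<partial>M)"
    unfolding W_def
  proof (rule nn_integral_mono_AE)
    show "AE t in M. G t (x0, y0 t) + ennreal (2 * \<epsilon> * norm (y0 t - yb t))
        \<le> liminf (\<lambda>j. value_part (s (\<tau> j)) (Z (\<tau> j)) t)"
      using X_lim AE_space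
    proof eventually_elim
      case (elim t)
      show ?case unfolding value_part_def
        by (rule pointwise_liminf[OF elim(2) y0_min[OF elim(2)] less_imp_le[OF s] s\<tau> elim(1)])
    qed
  qed
  also have "\<dots> \<le> liminf (\<lambda>j. \<integral>\<^sup>+t. value_part (s (\<tau> j)) (Z (\<tau> j)) t \<partial>M)"
    by (rule nn_integral_liminf) (rule value_part_meas[OF Z])
  also have "\<dots> \<le> liminf (\<lambda>j. ennreal (base_value - cost (s (\<tau> j)) (x (\<tau> j))))"
  proof (intro Liminf_mono always_eventually allI)
    fix j
    have "(\<integral>\<^sup>+t. value_part (s (\<tau> j)) (Z (\<tau> j)) t \<partial>M) = ennreal (V (\<tau> j))"
      unfolding V_def using cons(1)[of "\<tau> j"] by simp
    also have "\<dots> \<le> ennreal (base_value - cost (s (\<tau> j)) (x (\<tau> j)))" by (rule ennreal_leI[OF V_le])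
    finally show "(\<integral>\<^sup>+t. value_part (s (\<tau> j)) (Z (\<tau> j)) t \<partial>M) \<le> ennreal (base_value - cost (s (\<tau> j)) (x (\<tau> j)))" .
  qed
  also have "\<dots> = ennreal k"
    by (rule lim_imp_Liminf[OF _ tendsto_ennrealI[OF k_lim]]) simp
  finally have W_le: "W \<le> ennreal k" .
  then have W_fin: "W < \<infinity>" using le_less_trans ennreal_less_top by (metis infinity_ennreal_def)
  have "enn2real W \<le> k" using W_le k0 by (simp add: enn2real_leI)
  then have x0_eq: "x0 = xb"
    using isolated[OF y0 x0] W_fin unfolding W_def k_def base_value_def by simp
  have e_lim: "(\<lambda>j. - cost (s (\<tau> j)) (x (\<tau> j))) \<longlonglongrightarrow> 0"
    using tendsto_minus[OF cost_lim] by (simp add: x0_eq)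
  have A_fin: "(\<integral>\<^sup>+t. G t (fst (Z (\<tau> j) t), snd (Z (\<tau> j) t)) + ennreal (2 * \<epsilon> * smooth_norm (s (\<tau> j)) (snd (Z (\<tau> j) t) - yb t)) \<partial>M) < \<infinity>" for j
    using cons(1)[of "\<tau> j"] unfolding value_part_def .
  have A_le: "enn2real (\<integral>\<^sup>+t. G t (fst (Z (\<tau> j) t), snd (Z (\<tau> j) t)) + ennreal (2 * \<epsilon> * smooth_norm (s (\<tau> j)) (snd (Z (\<tau> j) t) - yb t)) \<partial>M)
      \<le> enn2real (\<integral>\<^sup>+t. G t (xb, yb t) \<partial>M) + - cost (s (\<tau> j)) (x (\<tau> j))" for j
    using V_le[of "\<tau> j"] unfolding V_def value_part_def base_value_def by simp
  note vc = value_convergence[where X = "\<lambda>j t. fst (Z (\<tau> j) t)" and Y = "\<lambda>j t. snd (Z (\<tau> j) t)" and s = "\<lambda>j. s (\<tau> j)",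
      OF fs less_imp_le[OF s] s\<tau> X_lim[unfolded x0_eq] A_fin A_le e_lim]
  obtain \<sigma> where \<sigma>: "strict_mono \<sigma>"
    and Y_AE: "AE t in M. (\<lambda>j. snd (Z (\<tau> (\<sigma> j)) t)) \<longlonglongrightarrow> yb t"
    and Y_L1: "(\<lambda>j. \<integral>t. norm (snd (Z (\<tau> (\<sigma> j)) t) - yb t) \<partial>M) \<longlonglongrightarrow> 0"
    and G_L1: "(\<lambda>j. \<integral>t. \<bar>enn2real (G t (fst (Z (\<tau> (\<sigma> j)) t), snd (Z (\<tau> (\<sigma> j)) t))) - enn2real (G t (xb, yb t))\<bar> \<partial>M) \<longlonglongrightarrow> 0"
    using vc(3) by blast
  have rN_lim: "(\<lambda>j. r (\<tau> j) * N (\<tau> j)) \<longlonglongrightarrow> 0"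
  proof (rule tendsto_sandwich[where f = "\<lambda>_. 0"])
    let ?h = "\<lambda>j. (\<integral>t. \<bar>enn2real (value_part (s (\<tau> j)) (Z (\<tau> j)) t) - enn2real (G t (xb, yb t))\<bar> \<partial>M) + - cost (s (\<tau> j)) (x (\<tau> j))"
    show "?h \<longlonglongrightarrow> 0"
      using tendsto_add[OF vc(2) e_lim] unfolding value_part_def by simp
    show "eventually (\<lambda>j. r (\<tau> j) * N (\<tau> j) \<le> ?h j) sequentially"
    proof (intro always_eventually allI)
      fix j
      have meas: "value_part (s (\<tau> j)) (Z (\<tau> j)) \<in> borel_measurable M" by (rule value_part_meas[OF Z])
      note real = enn2real_integral_finite[OF meas cons(1)]
      have "base_value - V (\<tau> j)
          = (\<integral>t. enn2real (G t (xb, yb t)) - enn2real (value_part (s (\<tau> j)) (Z (\<tau> j)) t) \<partial>M)"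
        using real(3,4) psi_integrable enn2real_integral_finite(4)[OF _ finite_value]
        by (simp add: V_def base_value_def Bochner_Integration.integral_diff)
      also have "\<dots> \<le> (\<integral>t. \<bar>enn2real (value_part (s (\<tau> j)) (Z (\<tau> j)) t) - enn2real (G t (xb, yb t))\<bar> \<partial>M)"
        using real(3) psi_integrable by (intro integral_mono) auto
      finally show "r (\<tau> j) * N (\<tau> j) \<le> ?h j" using VN[of "\<tau> j"] by linarith
    qed
    show "eventually (\<lambda>j. 0 \<le> r (\<tau> j) * N (\<tau> j)) sequentially"
      using r N0 by (intro always_eventually allI mult_nonneg_nonneg) (auto intro: less_imp_le)
  qed simp
  have "(\<forall>j. 0 < r (\<tau> (\<sigma> j)) \<and> 0 < s (\<tau> (\<sigma> j)) \<and> optimal p (r (\<tau> (\<sigma> j))) (s (\<tau> (\<sigma> j))) \<delta> (x (\<tau> (\<sigma> j))) (Z (\<tau> (\<sigma> j))))"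
    using r s opt by blast
  moreover have "(\<lambda>j. x (\<tau> (\<sigma> j))) \<longlonglongrightarrow> xb"
    using LIMSEQ_subseq_LIMSEQ[OF x_lim \<sigma>] by (simp add: o_def x0_eq)
  moreover have "(\<lambda>j. r (\<tau> (\<sigma> j)) * power_part p (x (\<tau> (\<sigma> j))) (Z (\<tau> (\<sigma> j)))) \<longlonglongrightarrow> 0"
    using LIMSEQ_subseq_LIMSEQ[OF rN_lim \<sigma>] by (simp add: o_def N_def)
  moreover have "(\<lambda>j. power_part p (x (\<tau> (\<sigma> j))) (Z (\<tau> (\<sigma> j)))) \<longlonglongrightarrow> 0"
    using LIMSEQ_subseq_LIMSEQ[OF LIMSEQ_subseq_LIMSEQ[OF N_lim \<tau>] \<sigma>] by (simp add: o_def N_def)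
  moreover have "\<forall>j. integrable M (\<lambda>t. snd (Z (\<tau> (\<sigma> j)) t))" using vc(1) by blast
  ultimately show ?thesis
    using \<delta> Y_AE Y_L1 G_L1
    by (intro exI[of _ \<delta>] exI[of _ "\<lambda>j. x (\<tau> (\<sigma> j))"] exI[of _ "\<lambda>j. Z (\<tau> (\<sigma> j))"]
        exI[of _ "\<lambda>j. r (\<tau> (\<sigma> j))"] exI[of _ "\<lambda>j. s (\<tau> (\<sigma> j))"] conjI)
qed

end

section \<open>Regular subgradients and extended integrals\<close>

lemma lower_semicontinuous_seq:
  assumes f: "lower_semicontinuous f" and u: "u \<longlonglongrightarrow> l"
  shows "f l \<le> liminf (\<lambda>j. f (u j))"
  unfolding le_Liminf_iff
proof (intro allI impI)
  fix c assume c: "c < f l"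
  have "f l \<le> Liminf (at l) f" using f by (simp add: lower_semicontinuous_def)
  then have "eventually (\<lambda>z. c < f z) (at l)" using c by (intro less_LiminfD) (rule less_le_trans)
  then have "eventually (\<lambda>z. c < f z) (nhds l)"
    unfolding eventually_at_filter by eventually_elim (use c in auto)
  then show "eventually (\<lambda>j. c < f (u j)) sequentially"
    using u unfolding filterlim_iff by blast
qed

text \<open>
  A differentiable function that touches \<open>\<psi>\<close> from below at \<open>z0\<close> has its gradient in the regular
  subdifferential: above a point \<open>z\<close> the epigraph lies above the graph of that function, whose
  deviation from its linearization is of smaller order.
\<close>

lemma regular_subdiffI:
  fixes \<psi> :: "'a::euclidean_space \<Rightarrow> ereal" and Q :: "'a \<Rightarrow> real"
  assumes fin: "\<bar>\<psi> z0\<bar> \<noteq> \<infinity>"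
    and supp: "eventually (\<lambda>z. \<psi> z0 + ereal (Q z - Q z0) \<le> \<psi> z) (nhds z0)"
    and Q: "(Q has_derivative (\<lambda>h. z' \<bullet> h)) (at z0)"
  shows "z' \<in> regular_subdiff \<psi> z0"
proof -
  obtain c where c: "\<psi> z0 = ereal c" using fin by (cases "\<psi> z0") auto
  let ?u0 = "(z0, c)"
  have le: "Limsup (at ?u0 within epi \<psi>) (\<lambda>u. ereal ((z', - 1) \<bullet> (u - ?u0) / norm (u - ?u0))) \<le> ereal e" if e: "0 < e" for e
  proof (rule Limsup_bounded)
    obtain d1 where d1: "0 < d1" "\<And>y. norm (y - z0) < d1 \<Longrightarrow> norm (Q y - Q z0 - z' \<bullet> (y - z0)) \<le> e * norm (y - z0)"
      using Q e unfolding has_derivative_at_alt by blast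
    obtain d2 where d2: "0 < d2" "\<And>y. dist y z0 < d2 \<Longrightarrow> \<psi> z0 + ereal (Q y - Q z0) \<le> \<psi> y"
      using supp unfolding eventually_nhds_metric by blast
    show "eventually (\<lambda>u. ereal ((z', - 1) \<bullet> (u - ?u0) / norm (u - ?u0)) \<le> ereal e) (at ?u0 within epi \<psi>)"
      unfolding eventually_at
    proof (intro exI[of _ "min d1 d2"] conjI ballI impI)
      show "0 < min d1 d2" using d1 d2 by simp
      fix u assume u: "u \<in> epi \<psi>" and du: "u \<noteq> ?u0 \<and> dist u ?u0 < min d1 d2"
      obtain z \<alpha> where ua: "u = (z, \<alpha>)" by fastforce
      have \<alpha>: "\<psi> z \<le> ereal \<alpha>" using u by (simp add: ua epi_def)
      have "dist z z0 \<le> dist u ?u0" using dist_fst_le[of u ?u0] by (simp add: ua)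
      then have dz: "dist z z0 < d1" "dist z z0 < d2" using du by auto
      have "ereal c + ereal (Q z - Q z0) \<le> ereal \<alpha>" using d2(2)[OF dz(2)] \<alpha> unfolding c by (rule order_trans)
      then have 1: "c + (Q z - Q z0) \<le> \<alpha>" by simp
      have 2: "norm (Q z - Q z0 - z' \<bullet> (z - z0)) \<le> e * norm (z - z0)" using d1(2) dz(1) by (simp add: dist_norm)
      have 3: "norm (z - z0) \<le> norm (u - ?u0)" using dist_fst_le[of u ?u0] by (simp add: ua dist_norm)
      have "(z', - 1) \<bullet> (u - ?u0) = z' \<bullet> (z - z0) - (\<alpha> - c)" by (simp add: ua inner_prod_def)
      also have "\<dots> \<le> e * norm (z - z0)" using 1 2 unfolding real_norm_def by linarith
      also have "\<dots> \<le> e * norm (u - ?u0)" using 3 e by (intro mult_left_mono) auto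
      finally have "(z', - 1) \<bullet> (u - ?u0) / norm (u - ?u0) \<le> e"
        using du by (simp add: divide_le_eq)
      then show "ereal ((z', - 1) \<bullet> (u - ?u0) / norm (u - ?u0)) \<le> ereal e" by simp
    qed
  qed
  have "Limsup (at ?u0 within epi \<psi>) (\<lambda>u. ereal ((z', - 1) \<bullet> (u - ?u0) / norm (u - ?u0))) \<le> 0"
  proof (rule ereal_le_epsilon2)
    fix e :: real assume "0 < e"
    then show "Limsup (at ?u0 within epi \<psi>) (\<lambda>u. ereal ((z', - 1) \<bullet> (u - ?u0) / norm (u - ?u0))) \<le> 0 + ereal e"
      using le[of e] by simp
  qed
  moreover have "?u0 \<in> epi \<psi>" by (simp add: epi_def c)
  ultimately show ?thesis by (simp add: regular_subdiff_def regular_normal_cone_def c)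
qed

lemma Lp_1_iff: "f \<in> Lp_space M 1 \<longleftrightarrow> integrable M f"
proof -
  have "(\<lambda>t. norm (f t) powr 1) = (\<lambda>t. norm (f t))" by auto
  then show ?thesis unfolding Lp_space_def using integrable_norm_iff[of f M] borel_measurable_integrable[of M f] by auto
qed

lemma Lp_norm_1: "Lp_norm M 1 f = (\<integral>t. norm (f t) \<partial>M)"
  by (simp add: Lp_norm_def)

lemma ext_integral_real:
  assumes u: "integrable M u" and eq: "AE t in M. \<alpha> t = ereal (u t)"
  shows "ext_integral M \<alpha> = ereal (\<integral>t. u t \<partial>M)"
proof -
  have 1: "(\<integral>\<^sup>+t. e2ennreal (\<alpha> t) \<partial>M) = (\<integral>\<^sup>+t. ennreal (u t) \<partial>M)"
    using eq by (intro nn_integral_cong_AE) (auto elim!: eventually_mono)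
  have 2: "(\<integral>\<^sup>+t. e2ennreal (- \<alpha> t) \<partial>M) = (\<integral>\<^sup>+t. ennreal (- u t) \<partial>M)"
    using eq by (intro nn_integral_cong_AE) (auto elim!: eventually_mono)
  have fin: "(\<integral>\<^sup>+t. ennreal (u t) \<partial>M) \<noteq> \<infinity>" "(\<integral>\<^sup>+t. ennreal (- u t) \<partial>M) \<noteq> \<infinity>"
    using u by (simp_all add: real_integrable_def)
  obtain a b where ab: "(\<integral>\<^sup>+t. ennreal (u t) \<partial>M) = ennreal a" "0 \<le> a" "(\<integral>\<^sup>+t. ennreal (- u t) \<partial>M) = ennreal b" "0 \<le> b"
    using fin by (metis ennreal_cases infinity_ennreal_def)
  show ?thesis
    unfolding ext_integral_def 1 2 real_lebesgue_integral_def[OF u] using ab by simp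
qed

lemma e2ennreal_add_le: "e2ennreal (a + ereal r) \<le> e2ennreal a + ennreal \<bar>r\<bar>"
proof (cases a)
  case (real b)
  then have "e2ennreal (a + ereal r) = ennreal (b + r)" by simp
  also have "\<dots> \<le> ennreal (max 0 b + \<bar>r\<bar>)" by (intro ennreal_leI) auto
  also have "\<dots> = ennreal (max 0 b) + ennreal \<bar>r\<bar>" by (intro ennreal_plus) auto
  also have "ennreal (max 0 b) = e2ennreal a" using real by (simp add: max_def ennreal_neg)
  finally show ?thesis .
qed (auto simp: e2ennreal_neg)

section \<open>The tilted integrand\<close>

locale subgradient_setting = finite_measure M + complete_measure M for M :: "'t measure" +
  fixes \<phi> :: "'t \<Rightarrow> 'a::euclidean_space \<times> 'b::euclidean_space \<Rightarrow> ereal" and \<nu> :: "'t \<Rightarrow> real"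
    and xb xs :: 'a and yb ys :: "'t \<Rightarrow> 'b"
  assumes normal: "normal_integrand M \<phi>"
    and \<nu>: "integrable M \<nu>" and lower: "\<And>t v w. t \<in> space M \<Longrightarrow> - ereal (\<nu> t) \<le> \<phi> t (v, w)"
    and dom: "(xb, yb) \<in> dom_functional M (integral_functional M \<phi>)"
    and subgrad: "(xs, ys) \<in> regular_subdiff_functional M (integral_functional M \<phi>) xb yb"
    and inf_int: "ext_integrable M (\<lambda>t. INF (v, w)\<in>UNIV. \<phi> t (v, w) - ereal (ys t \<bullet> w))"
begin

text \<open>
  The infimum is finite almost everywhere; elsewhere \<^const>\<open>real_of_ereal\<close> replaces it by \<open>0\<close>.
\<close>

definition offset :: "'t \<Rightarrow> real" where
  "offset t = real_of_ereal (INF (v, w)\<in>UNIV. \<phi> t (v, w) - ereal (ys t \<bullet> w))"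

text \<open>
  Almost everywhere the argument of \<^const>\<open>e2ennreal\<close> is nonnegative, so nothing is truncated; elsewhere
  the truncation keeps the integrand lower semicontinuous and nonnegative.
\<close>

definition tilt :: "'t \<Rightarrow> 'a \<times> 'b \<Rightarrow> ennreal" where
  "tilt t z = e2ennreal (\<phi> t z + ereal (- (ys t \<bullet> snd z) - offset t))"

lemma ys_Linf: "ys \<in> Linf_space M"
  using subgrad by (simp add: regular_subdiff_functional_def)

lemma ys_meas [measurable]: "ys \<in> borel_measurable M"
  using ys_Linf by (simp add: Linf_space_def)

lemma ys_bounded: "\<exists>L\<ge>0. AE t in M. norm (ys t) \<le> L"
proof (intro exI conjI)
  have fin: "Linf_norm M ys < \<infinity>" using ys_Linf by (simp add: Linf_space_def)
  show "AE t in M. norm (ys t) \<le> enn2real (Linf_norm M ys)"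
    using esssup_AE[of "\<lambda>t. ennreal (norm (ys t))" M]
  proof eventually_elim
    case (elim t)
    then have "ennreal (norm (ys t)) \<le> ennreal (enn2real (Linf_norm M ys))"
      using fin by (simp add: Linf_norm_def)
    then show ?case by (subst (asm) ennreal_le_iff) auto
  qed
qed simp

lemma ys_inner_integrable:
  assumes y: "integrable M y"
  shows "integrable M (\<lambda>t. ys t \<bullet> y t)"
proof -
  obtain L where L: "0 \<le> L" "AE t in M. norm (ys t) \<le> L" using ys_bounded by blast
  note [measurable] = borel_measurable_integrable[OF y]
  show ?thesis
  proof (rule Bochner_Integration.integrable_bound)
    show "integrable M (\<lambda>t. L * norm (y t))" using y by (intro integrable_mult_right integrable_norm)
    show "AE t in M. norm (ys t \<bullet> y t) \<le> norm (L * norm (y t))"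
      using L(2)
    proof eventually_elim
      case (elim t)
      have "\<bar>ys t \<bullet> y t\<bar> \<le> norm (ys t) * norm (y t)" by (rule Cauchy_Schwarz_ineq2)
      also have "\<dots> \<le> L * norm (y t)" using elim by (intro mult_right_mono) auto
      finally show ?case using L(1) by simp
    qed
  qed measurable
qed

lemma yb_int: "integrable M yb"
  using dom by (simp add: dom_functional_def Lp_1_iff)

lemma inf_AE: "AE t in M. \<bar>INF (v, w)\<in>UNIV. \<phi> t (v, w) - ereal (ys t \<bullet> w)\<bar> \<noteq> \<infinity>" (is "AE t in M. \<bar>?k t\<bar> \<noteq> \<infinity>")
proof -
  have [measurable]: "?k \<in> borel_measurable M" using inf_int by (simp add: ext_integrable_def)
  have "(\<integral>\<^sup>+t. e2ennreal \<bar>?k t\<bar> \<partial>M) < \<infinity>" using inf_int by (simp add: ext_integrable_def)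
  then have "AE t in M. e2ennreal \<bar>?k t\<bar> \<noteq> \<infinity>" by (intro nn_integral_PInf_AE) auto
  then show ?thesis
  proof eventually_elim
    case (elim t)
    then show ?case by (cases "?k t") (auto simp: e2ennreal_infty)
  qed
qed

lemma offset_integrable: "integrable M offset"
proof (rule integrableI_bounded)
  let ?k = "\<lambda>t. INF (v, w)\<in>UNIV. \<phi> t (v, w) - ereal (ys t \<bullet> w)"
  have [measurable]: "?k \<in> borel_measurable M" using inf_int by (simp add: ext_integrable_def)
  show "offset \<in> borel_measurable M" unfolding offset_def by measurable
  have "(\<integral>\<^sup>+t. ennreal (norm (offset t)) \<partial>M) = (\<integral>\<^sup>+t. e2ennreal \<bar>?k t\<bar> \<partial>M)"
    using inf_AE
  proof (intro nn_integral_cong_AE, eventually_elim)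
    case (elim t)
    then obtain c where "?k t = ereal c" by (cases "?k t") auto
    then show ?case by (simp add: offset_def)
  qed
  also have "\<dots> < \<infinity>" using inf_int by (simp add: ext_integrable_def)
  finally show "(\<integral>\<^sup>+t. ennreal (norm (offset t)) \<partial>M) < \<infinity>" .
qed

lemma tilt_eq:
  "AE t in M. \<forall>z. enn2ereal (tilt t z) = \<phi> t z + ereal (- (ys t \<bullet> snd z) - offset t)"
  using inf_AE
proof eventually_elim
  case (elim t)
  let ?k = "INF (v, w)\<in>UNIV. \<phi> t (v, w) - ereal (ys t \<bullet> w)"
  obtain c where c: "?k = ereal c" using elim by (cases ?k) auto
  then have off: "offset t = c" by (simp add: offset_def)
  show ?case
  proof
    fix z
    have "?k \<le> \<phi> t z - ereal (ys t \<bullet> snd z)" by (rule INF_lower2[of z]) (auto split: prod.split)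
    then have "0 \<le> \<phi> t z + ereal (- (ys t \<bullet> snd z) - offset t)"
      unfolding c off by (cases "\<phi> t z") auto
    then show "enn2ereal (tilt t z) = \<phi> t z + ereal (- (ys t \<bullet> snd z) - offset t)"
      unfolding tilt_def by (rule enn2ereal_e2ennreal)
  qed
qed

lemma tilt_integrand: "lsc_integrand M tilt"
  unfolding lsc_integrand_def
proof (intro conjI ballI)
  have 1: "(\<lambda>x. \<phi> (fst x) (snd x)) \<in> borel_measurable (M \<Otimes>\<^sub>M (borel :: ('a \<times> 'b) measure))"
    using normal by (simp add: normal_integrand_def split_beta')
  have 2: "(\<lambda>x. - (ys (fst x) \<bullet> snd (snd x)) - offset (fst x)) \<in> borel_measurable (M \<Otimes>\<^sub>M (borel :: ('a \<times> 'b) measure))"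
    by (intro borel_measurable_diff borel_measurable_uminus borel_measurable_inner measurable_fst_snd_borel
        measurable_compose[OF measurable_fst ys_meas]
        measurable_compose[OF measurable_fst borel_measurable_integrable[OF offset_integrable]])
  note [measurable] = 1 borel_measurable_ereal[OF 2]
  show "(\<lambda>x. tilt (fst x) (snd x)) \<in> borel_measurable (M \<Otimes>\<^sub>M (borel :: ('a \<times> 'b) measure))"
    unfolding tilt_def
    by (rule measurable_compose[OF borel_measurable_ereal_add[OF 1 borel_measurable_ereal[OF 2]] measurable_e2ennreal])
  fix t assume t: "t \<in> space M"
  have lsc: "lower_semicontinuous (\<phi> t)" using normal t by (simp add: normal_integrand_def)
  show "seq_lsc (tilt t)"
    unfolding seq_lsc_def
  proof (intro allI impI)
    fix u :: "nat \<Rightarrow> 'a \<times> 'b" and l assume u: "u \<longlonglongrightarrow> l"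
    let ?a = "\<lambda>z::'a \<times> 'b. ereal (- (ys t \<bullet> snd z) - offset t)"
    have a: "(\<lambda>j. ?a (u j)) \<longlonglongrightarrow> ?a l" by (intro tendsto_intros u)
    have "\<phi> t l + ?a l \<le> liminf (\<lambda>j. \<phi> t (u j)) + ?a l"
      by (intro add_right_mono lower_semicontinuous_seq[OF lsc u])
    also have "\<dots> = liminf (\<lambda>j. ?a (u j) + \<phi> t (u j))"
      by (subst ereal_liminf_lim_add[OF a]) (auto simp: add.commute)
    finally have "tilt t l \<le> e2ennreal (liminf (\<lambda>j. ?a (u j) + \<phi> t (u j)))"
      unfolding tilt_def by (rule e2ennreal_mono)
    also have "\<dots> = liminf (\<lambda>j. e2ennreal (?a (u j) + \<phi> t (u j)))"
      by (rule Liminf_compose_continuous_mono[symmetric]) (auto simp: continuous_on_e2ennreal mono_def e2ennreal_mono)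
    finally show "tilt t l \<le> liminf (\<lambda>j. tilt t (u j))"
      unfolding tilt_def by (simp add: add.commute)
  qed
qed

lemma tilt_real:
  assumes y: "integrable M y" and X: "X \<in> borel_measurable M" and fin: "(\<integral>\<^sup>+t. tilt t (X t, y t) \<partial>M) < \<infinity>"
  shows "AE t in M. \<phi> t (X t, y t) = ereal (enn2real (tilt t (X t, y t)) + ys t \<bullet> y t + offset t)"
    and "integrable M (\<lambda>t. enn2real (tilt t (X t, y t)))"
    and "(\<integral>t. enn2real (tilt t (X t, y t)) \<partial>M) = enn2real (\<integral>\<^sup>+t. tilt t (X t, y t) \<partial>M)"
proof -
  have meas: "(\<lambda>t. tilt t (X t, y t)) \<in> borel_measurable M"
    by (rule measurable_integrand_comp[OF tilt_integrand X borel_measurable_integrable[OF y]])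
  note r = enn2real_integral_finite[OF meas fin]
  show "integrable M (\<lambda>t. enn2real (tilt t (X t, y t)))"
    "(\<integral>t. enn2real (tilt t (X t, y t)) \<partial>M) = enn2real (\<integral>\<^sup>+t. tilt t (X t, y t) \<partial>M)" by (fact r(3) r(4))+
  show "AE t in M. \<phi> t (X t, y t) = ereal (enn2real (tilt t (X t, y t)) + ys t \<bullet> y t + offset t)"
    using tilt_eq r(1)
  proof eventually_elim
    case (elim t)
    obtain c where c: "tilt t (X t, y t) = ennreal c" "0 \<le> c" using elim(2) by (cases "tilt t (X t, y t)") auto
    have "ereal c = \<phi> t (X t, y t) + ereal (- (ys t \<bullet> y t) - offset t)"
      using elim(1)[rule_format, of "(X t, y t)"] c by simp
    then show ?case using c by (cases "\<phi> t (X t, y t)") auto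
  qed
qed

lemma functional_value:
  assumes y: "integrable M y" and fin: "(\<integral>\<^sup>+t. tilt t (x, y t) \<partial>M) < \<infinity>"
  shows "integral_functional M \<phi> x y
    = ereal (enn2real (\<integral>\<^sup>+t. tilt t (x, y t) \<partial>M) + (\<integral>t. ys t \<bullet> y t \<partial>M) + (\<integral>t. offset t \<partial>M))"
proof -
  note r = tilt_real[OF y borel_measurable_const fin]
  have "integrable M (\<lambda>t. enn2real (tilt t (x, y t)) + ys t \<bullet> y t + offset t)"
    using r(2) ys_inner_integrable[OF y] offset_integrable by auto
  from ext_integral_real[OF this r(1)] show ?thesis
    unfolding integral_functional_def
    using r(2,3) ys_inner_integrable[OF y] offset_integrable by (simp add: Bochner_Integration.integral_add)
qed

text \<open>
  Since \<open>\<phi>\<close> is bounded below by \<open>- \<nu>\<close>, the negative part of its integral is finite; so the value of the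
  functional can be less than \<open>\<infinity>\<close> only if the positive part is finite too.
\<close>

lemma tilt_base_finite: "(\<integral>\<^sup>+t. tilt t (xb, yb t) \<partial>M) < \<infinity>"
proof -
  have lt: "integral_functional M \<phi> xb yb < \<infinity>" using dom by (simp add: dom_functional_def)
  have "(\<integral>\<^sup>+t. e2ennreal (- \<phi> t (xb, yb t)) \<partial>M) \<le> (\<integral>\<^sup>+t. ennreal (norm (\<nu> t)) \<partial>M)"
  proof (rule nn_integral_mono)
    fix t assume "t \<in> space M"
    then have "- \<phi> t (xb, yb t) \<le> ereal (\<nu> t)" using lower by (simp add: ereal_uminus_le_reorder)
    then have "e2ennreal (- \<phi> t (xb, yb t)) \<le> ennreal (\<nu> t)" using e2ennreal_mono by fastforce
    also have "\<dots> \<le> ennreal (norm (\<nu> t))" by (intro ennreal_leI) simp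
    finally show "e2ennreal (- \<phi> t (xb, yb t)) \<le> ennreal (norm (\<nu> t))" .
  qed
  also have "\<dots> < \<infinity>" using \<nu> by (simp add: integrable_iff_bounded)
  finally have neg: "(\<integral>\<^sup>+t. e2ennreal (- \<phi> t (xb, yb t)) \<partial>M) < \<infinity>" .
  then obtain b where b: "(\<integral>\<^sup>+t. e2ennreal (- \<phi> t (xb, yb t)) \<partial>M) = ennreal b" "0 \<le> b"
    by (cases "\<integral>\<^sup>+t. e2ennreal (- \<phi> t (xb, yb t)) \<partial>M") auto
  have pos: "(\<integral>\<^sup>+t. e2ennreal (\<phi> t (xb, yb t)) \<partial>M) < \<infinity>"
  proof (rule ccontr)
    assume "\<not> ?thesis"
    then have "(\<integral>\<^sup>+t. e2ennreal (\<phi> t (xb, yb t)) \<partial>M) = \<infinity>" by (simp add: less_top[symmetric])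
    then have "integral_functional M \<phi> xb yb = \<infinity>"
      unfolding integral_functional_def ext_integral_def b(1) using b(2) by simp
    then show False using lt by simp
  qed
  note [measurable] = borel_measurable_integrable[OF yb_int] borel_measurable_integrable[OF offset_integrable]
  let ?d = "\<lambda>t. - (ys t \<bullet> yb t) - offset t"
  have d: "integrable M ?d" using ys_inner_integrable[OF yb_int] offset_integrable by auto
  have "(\<lambda>t. (t, (xb, yb t))) \<in> measurable M (M \<Otimes>\<^sub>M borel)" by measurable
  from measurable_compose[OF this, of "\<lambda>x. \<phi> (fst x) (snd x)"] normal
  have \<phi>_meas: "(\<lambda>t. \<phi> t (xb, yb t)) \<in> borel_measurable M"
    by (simp add: normal_integrand_def split_beta')
  have "(\<integral>\<^sup>+t. tilt t (xb, yb t) \<partial>M) \<le> (\<integral>\<^sup>+t. e2ennreal (\<phi> t (xb, yb t)) + ennreal (norm (?d t)) \<partial>M)"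
    unfolding tilt_def using e2ennreal_add_le by (intro nn_integral_mono) simp
  also have "\<dots> = (\<integral>\<^sup>+t. e2ennreal (\<phi> t (xb, yb t)) \<partial>M) + (\<integral>\<^sup>+t. ennreal (norm (?d t)) \<partial>M)"
    by (intro nn_integral_add measurable_compose[OF \<phi>_meas measurable_e2ennreal]) measurable
  also have "\<dots> < \<infinity>" using pos d by (simp add: integrable_iff_bounded)
  finally show ?thesis .
qed

text \<open>
  The linear term in \<open>y\<close> that belongs to \<open>ys\<close> cancels against the one contained in \<open>tilt\<close>.
\<close>

lemma local_inequality:
  assumes \<epsilon>: "0 < \<epsilon>"
  shows "\<exists>\<delta>0>0. \<forall>x y. integrable M y \<longrightarrow>
      0 < norm (x - xb) + (\<integral>t. norm (y t - yb t) \<partial>M) \<longrightarrow>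
      norm (x - xb) + (\<integral>t. norm (y t - yb t) \<partial>M) < \<delta>0 \<longrightarrow>
      (\<integral>\<^sup>+t. tilt t (x, y t) \<partial>M) < \<infinity> \<longrightarrow>
      enn2real (\<integral>\<^sup>+t. tilt t (xb, yb t) \<partial>M) + xs \<bullet> (x - xb)
        \<le> enn2real (\<integral>\<^sup>+t. tilt t (x, y t) \<partial>M) + \<epsilon> * (norm (x - xb) + (\<integral>t. norm (y t - yb t) \<partial>M))"
proof -
  let ?E = "integral_functional M \<phi>"
  let ?q = "\<lambda>x y. (?E x y - ?E xb yb - ereal (xs \<bullet> (x - xb)) - ereal (LINT t|M. ys t \<bullet> (y t - yb t)))
            / ereal (norm (x - xb) + Lp_norm M 1 (\<lambda>t. y t - yb t))"
  let ?S = "\<lambda>e. {(x, y). y \<in> Lp_space M 1 \<and>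
        0 < norm (x - xb) + Lp_norm M 1 (\<lambda>t. y t - yb t) \<and>
        norm (x - xb) + Lp_norm M 1 (\<lambda>t. y t - yb t) < e}"
  have "0 \<le> Liminf (at_L1 M xb yb) (\<lambda>(x, y). ?q x y)"
    using subgrad unfolding regular_subdiff_functional_def by simp
  moreover have "ereal (- \<epsilon>) < 0" using \<epsilon> by simp
  ultimately have "eventually (\<lambda>z. ereal (- \<epsilon>) < (\<lambda>(x, y). ?q x y) z) (at_L1 M xb yb)"
    unfolding le_Liminf_iff by blast
  moreover have "eventually P (at_L1 M xb yb) \<longleftrightarrow> (\<exists>e\<in>{0<..}. eventually P (principal (?S e)))" for P
    unfolding at_L1_def
  proof (rule eventually_INF_base)
    fix a b :: real assume "a \<in> {0<..}" "b \<in> {0<..}"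
    then show "\<exists>e\<in>{0<..}. principal (?S e) \<le> inf (principal (?S a)) (principal (?S b))"
      by (intro bexI[of _ "min a b"]) auto
  qed auto
  ultimately obtain \<delta>0 where \<delta>0: "0 < \<delta>0" and q: "\<And>x y. (x, y) \<in> ?S \<delta>0 \<Longrightarrow> ereal (- \<epsilon>) < ?q x y"
    by (auto simp: eventually_principal)
  show ?thesis
  proof (intro exI[of _ \<delta>0] conjI allI impI \<delta>0)
    fix x y assume y: "integrable M y"
      and d0: "0 < norm (x - xb) + (\<integral>t. norm (y t - yb t) \<partial>M)"
      and d1: "norm (x - xb) + (\<integral>t. norm (y t - yb t) \<partial>M) < \<delta>0"
      and fin: "(\<integral>\<^sup>+t. tilt t (x, y t) \<partial>M) < \<infinity>"
    define d where "d = norm (x - xb) + (\<integral>t. norm (y t - yb t) \<partial>M)"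
    have "(x, y) \<in> ?S \<delta>0" using y d0 d1 by (simp add: Lp_1_iff Lp_norm_1)
    from q[OF this] have 1: "ereal (- \<epsilon>) < ?q x y" .
    have inner: "(LINT t|M. ys t \<bullet> (y t - yb t)) = (\<integral>t. ys t \<bullet> y t \<partial>M) - (\<integral>t. ys t \<bullet> yb t \<partial>M)"
      using ys_inner_integrable[OF y] ys_inner_integrable[OF yb_int]
      by (simp add: inner_diff_right Bochner_Integration.integral_diff)
    define I where "I = enn2real (\<integral>\<^sup>+t. tilt t (x, y t) \<partial>M)"
    define I0 where "I0 = enn2real (\<integral>\<^sup>+t. tilt t (xb, yb t) \<partial>M)"
    have "?q x y = ereal ((I - I0 - xs \<bullet> (x - xb)) / d)"
      unfolding functional_value[OF y fin] functional_value[OF yb_int tilt_base_finite] inner Lp_norm_1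
        I_def[symmetric] I0_def[symmetric] d_def[symmetric]
      using d0 by (simp add: d_def[symmetric] ereal_divide)
    then have "- \<epsilon> < (I - I0 - xs \<bullet> (x - xb)) / d" using 1 by simp
    then have "- \<epsilon> * d < I - I0 - xs \<bullet> (x - xb)" using d0 by (simp add: d_def[symmetric] pos_less_divide_eq)
    then show "enn2real (\<integral>\<^sup>+t. tilt t (xb, yb t) \<partial>M) + xs \<bullet> (x - xb)
        \<le> enn2real (\<integral>\<^sup>+t. tilt t (x, y t) \<partial>M) + \<epsilon> * (norm (x - xb) + (\<integral>t. norm (y t - yb t) \<partial>M))"
      unfolding I_def[symmetric] I0_def[symmetric] d_def[symmetric] by simp
  qed
qed

lemma locally_minimal: "0 < \<epsilon> \<Longrightarrow> \<exists>\<delta>0. locally_minimal_integrand M tilt xb yb xs \<epsilon> \<delta>0"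
proof -
  assume \<epsilon>: "0 < \<epsilon>"
  obtain \<delta>0 where \<delta>0: "0 < \<delta>0" and ineq: "\<And>x y. integrable M y \<Longrightarrow>
      0 < norm (x - xb) + (\<integral>t. norm (y t - yb t) \<partial>M) \<Longrightarrow>
      norm (x - xb) + (\<integral>t. norm (y t - yb t) \<partial>M) < \<delta>0 \<Longrightarrow>
      (\<integral>\<^sup>+t. tilt t (x, y t) \<partial>M) < \<infinity> \<Longrightarrow>
      enn2real (\<integral>\<^sup>+t. tilt t (xb, yb t) \<partial>M) + xs \<bullet> (x - xb)
        \<le> enn2real (\<integral>\<^sup>+t. tilt t (x, y t) \<partial>M) + \<epsilon> * (norm (x - xb) + (\<integral>t. norm (y t - yb t) \<partial>M))"
    using local_inequality[OF \<epsilon>] by blast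
  have "locally_minimal_integrand M tilt xb yb xs \<epsilon> \<delta>0"
    by unfold_locales (fact tilt_integrand yb_int tilt_base_finite \<epsilon> \<delta>0 ineq)+
  then show ?thesis by blast
qed

end

section \<open>Pointwise subgradients\<close>

lemma conjugate_exponent:
  fixes p q :: real
  assumes "1 < p" "1 < q" "1 / p + 1 / q = 1"
  shows "(p - 1) * q = p"
  using assms by (simp add: field_simps)

text \<open>
  Because \<open>(p - 1) q = p\<close>, the \<open>q\<close>-th power of the gradient of the penalty is a multiple of the
  \<open>p\<close>-th power of the distance.
\<close>

lemma Lq_norm_power_grad:
  fixes X :: "'t \<Rightarrow> 'a::euclidean_space"
  assumes p: "1 < p" and q: "1 < q" and pq: "1 / p + 1 / q = 1" and r: "0 < r"
    and X: "X \<in> borel_measurable M" and int: "integrable M (\<lambda>t. norm (X t - x) powr p)"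
  shows "(\<lambda>t. r *\<^sub>R power_grad p (x - X t)) \<in> Lp_space M q"
    and "Lp_norm M q (\<lambda>t. r *\<^sub>R power_grad p (x - X t)) * Lp_norm M p (\<lambda>t. X t - x)
      = p * (r * (\<integral>t. norm (X t - x) powr p \<partial>M))"
proof -
  note [measurable] = X
  have eq: "norm (r *\<^sub>R power_grad p (x - X t)) powr q = (r * p) powr q * norm (X t - x) powr p" for t
  proof -
    have "norm (r *\<^sub>R power_grad p (x - X t)) = (r * p) * norm (X t - x) powr (p - 1)"
      using r p by (simp add: norm_power_grad norm_minus_commute)
    then have "norm (r *\<^sub>R power_grad p (x - X t)) powr q = (r * p) powr q * (norm (X t - x) powr (p - 1)) powr q"
      using r p by (simp add: powr_mult)
    also have "(norm (X t - x) powr (p - 1)) powr q = norm (X t - x) powr p"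
      by (simp add: powr_powr conjugate_exponent[OF p q pq])
    finally show ?thesis .
  qed
  have "(\<lambda>t. r *\<^sub>R power_grad p (x - X t)) \<in> borel_measurable M" by measurable
  then show "(\<lambda>t. r *\<^sub>R power_grad p (x - X t)) \<in> Lp_space M q"
    unfolding Lp_space_def mem_Collect_eq eq using int by (intro conjI integrable_mult_right)
  define N where "N = (\<integral>t. norm (X t - x) powr p \<partial>M)"
  have N: "0 \<le> N" by (simp add: N_def)
  have "Lp_norm M q (\<lambda>t. r *\<^sub>R power_grad p (x - X t)) = ((r * p) powr q * N) powr (1 / q)"
    unfolding Lp_norm_def eq N_def by simp
  also have "\<dots> = (r * p) * N powr (1 / q)"
    using r p q N by (simp add: powr_mult powr_powr)
  finally have "Lp_norm M q (\<lambda>t. r *\<^sub>R power_grad p (x - X t)) * Lp_norm M p (\<lambda>t. X t - x)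
      = (r * p) * (N powr (1 / q) * N powr (1 / p))"
    by (simp add: Lp_norm_def N_def)
  also have "N powr (1 / q) * N powr (1 / p) = N"
    using N pq by (simp add: powr_add[symmetric] add.commute)
  finally show "Lp_norm M q (\<lambda>t. r *\<^sub>R power_grad p (x - X t)) * Lp_norm M p (\<lambda>t. X t - x)
      = p * (r * (\<integral>t. norm (X t - x) powr p \<partial>M))"
    by (simp add: N_def)
qed

context growing_integrand
begin

lemma has_derivative_penalty:
  assumes p: "1 < p" and s: "0 < s"
  shows "(penalty p r s x t has_derivative
     (\<lambda>h. 2 * \<epsilon> * (smooth_norm_grad s (snd z - yb t) \<bullet> snd h) + r * (power_grad p (fst z - x) \<bullet> fst h))) (at z)"
proof -
  have "((\<lambda>z. snd z - yb t) has_derivative snd) (at z)" by (auto intro!: derivative_eq_intros)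
  from has_derivative_compose[OF this has_derivative_smooth_norm[OF s]]
  have 1: "((\<lambda>z. 2 * \<epsilon> * smooth_norm s (snd z - yb t)) has_derivative
      (\<lambda>h. 2 * \<epsilon> * (smooth_norm_grad s (snd z - yb t) \<bullet> snd h))) (at z)"
    by (rule has_derivative_mult_right)
  have "((\<lambda>z. fst z - x) has_derivative fst) (at z)" by (auto intro!: derivative_eq_intros)
  from has_derivative_compose[OF this has_derivative_norm_powr[OF p]]
  have 2: "((\<lambda>z. r * norm (fst z - x) powr p) has_derivative (\<lambda>h. r * (power_grad p (fst z - x) \<bullet> fst h))) (at z)"
    by (rule has_derivative_mult_right)
  show ?thesis unfolding penalty_def[abs_def] by (rule has_derivative_add[OF 1 2])
qed

end

context subgradient_setting
begin

text \<open>
  Minimality of \<open>z0\<close> says that the linear term of \<open>ys\<close> minus the penalty touches \<open>\<phi> t\<close> from below at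
  \<open>z0\<close>. The constraint does not interfere, since \<open>z0\<close> lies in the interior of the admissible ball.
\<close>

lemma pointwise_subgradient:
  assumes growing: "growing_integrand M (constrain tilt B r0 yb) xb yb xs \<epsilon> \<delta>0"
    and p: "1 < p" and s: "0 < s" and r: "0 < r"
    and eq: "\<And>z. enn2ereal (tilt t z) = \<phi> t z + ereal (- (ys t \<bullet> snd z) - offset t)"
    and fin: "constrain tilt B r0 yb t z0 < \<infinity>"
    and inactive: "t \<in> B \<Longrightarrow> norm (snd z0 - yb t) < r0"
    and min: "\<And>z. constrain tilt B r0 yb t z0 + ennreal (growing_integrand.penalty yb \<epsilon> p r s x t z0)
      \<le> constrain tilt B r0 yb t z + ennreal (growing_integrand.penalty yb \<epsilon> p r s x t z)"
  shows "(r *\<^sub>R power_grad p (x - fst z0), ys t - (2 * \<epsilon>) *\<^sub>R smooth_norm_grad s (snd z0 - yb t))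
    \<in> regular_subdiff (\<phi> t) z0"
proof -
  interpret H: growing_integrand M "constrain tilt B r0 yb" xb yb xs \<epsilon> \<delta>0 by (rule growing)
  let ?G = "constrain tilt B r0 yb"
  let ?P = "H.penalty p r s x t"
  have P0: "0 \<le> ?P z" for z using H.penalty_nonneg[of r s] r s by simp
  define Q where "Q z = ys t \<bullet> snd z - ?P z" for z
  have tilt0: "?G t z0 = tilt t z0" using fin by (auto simp: constrain_def split: if_splits)
  obtain c where c: "tilt t z0 = ennreal c" "0 \<le> c" using fin unfolding tilt0 by (cases "tilt t z0") auto
  have \<phi>0: "\<phi> t z0 = ereal (c + ys t \<bullet> snd z0 + offset t)"
    using eq[of z0] c by (cases "\<phi> t z0") auto
  have near: "eventually (\<lambda>z. t \<in> B \<longrightarrow> norm (snd z - yb t) < r0) (nhds z0)"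
  proof (cases "t \<in> B")
    case True
    have "((\<lambda>z. norm (snd z - yb t)) \<longlongrightarrow> norm (snd z0 - yb t)) (nhds z0)"
      by (intro tendsto_intros filterlim_ident)
    then have "eventually (\<lambda>z. norm (snd z - yb t) < r0) (nhds z0)"
      using inactive[OF True] by (rule order_tendstoD)
    then show ?thesis by eventually_elim simp
  qed simp
  show ?thesis
  proof (rule regular_subdiffI[where Q = Q])
    show "\<bar>\<phi> t z0\<bar> \<noteq> \<infinity>" by (simp add: \<phi>0)
    show "eventually (\<lambda>z. \<phi> t z0 + ereal (Q z - Q z0) \<le> \<phi> t z) (nhds z0)"
      using near
    proof eventually_elim
      case (elim z)
      then have Gz: "?G t z = tilt t z" by (auto simp: constrain_def)
      show ?case
      proof (cases "tilt t z = \<infinity>")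
        case True
        then have "\<phi> t z = \<infinity>" using eq[of z] by (cases "\<phi> t z") auto
        then show ?thesis by simp
      next
        case False
        then obtain a where a: "tilt t z = ennreal a" "0 \<le> a" by (cases "tilt t z") auto
        have \<phi>z: "\<phi> t z = ereal (a + ys t \<bullet> snd z + offset t)"
          using eq[of z] a by (cases "\<phi> t z") auto
        have "ennreal (c + ?P z0) \<le> ennreal (a + ?P z)"
          using min[of z] c a P0 unfolding Gz tilt0 by (simp add: ennreal_plus)
        then have "c + ?P z0 \<le> a + ?P z" using a P0[of z] by (subst (asm) ennreal_le_iff) auto
        then show ?thesis unfolding \<phi>0 \<phi>z Q_def by simp
      qed
    qed
    have "((\<lambda>z. ys t \<bullet> snd z) has_derivative (\<lambda>h. ys t \<bullet> snd h)) (at z0)"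
      by (auto intro!: derivative_eq_intros)
    from has_derivative_diff[OF this H.has_derivative_penalty[OF p s, of r x t z0]]
    have "(Q has_derivative (\<lambda>h. ys t \<bullet> snd h -
        (2 * \<epsilon> * (smooth_norm_grad s (snd z0 - yb t) \<bullet> snd h) + r * (power_grad p (fst z0 - x) \<bullet> fst h)))) (at z0)"
      unfolding Q_def .
    moreover have "power_grad p (x - fst z0) = - power_grad p (fst z0 - x)"
      using power_grad_minus[of p "fst z0 - x"] by simp
    then have "ys t \<bullet> snd h -
        (2 * \<epsilon> * (smooth_norm_grad s (snd z0 - yb t) \<bullet> snd h) + r * (power_grad p (fst z0 - x) \<bullet> fst h))
      = (r *\<^sub>R power_grad p (x - fst z0), ys t - (2 * \<epsilon>) *\<^sub>R smooth_norm_grad s (snd z0 - yb t)) \<bullet> h" for h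
      by (simp add: inner_prod_def inner_diff_left)
    ultimately show "(Q has_derivative
        (\<lambda>h. (r *\<^sub>R power_grad p (x - fst z0), ys t - (2 * \<epsilon>) *\<^sub>R smooth_norm_grad s (snd z0 - yb t)) \<bullet> h)) (at z0)"
      by simp
  qed
qed

definition approximates ::
    "real \<Rightarrow> real \<Rightarrow> real \<Rightarrow> 'a \<Rightarrow> ('t \<Rightarrow> 'a) \<Rightarrow> ('t \<Rightarrow> 'a) \<Rightarrow> ('t \<Rightarrow> 'b) \<Rightarrow> ('t \<Rightarrow> 'b) \<Rightarrow> bool" where
  "approximates p q \<eta> x X X' Y Y' \<longleftrightarrow>
      (X \<in> Lp_space M p \<and> X' \<in> Lp_space M q \<and> Y \<in> Lp_space M 1 \<and> Y' \<in> Linf_space M) \<and>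
      (AE t in M. (X' t, Y' t) \<in> regular_subdiff (\<phi> t) (X t, Y t)) \<and>
      norm (xb - x) < \<eta> \<and>
      Lp_norm M p (\<lambda>t. xb - X t) < \<eta> \<and>
      Lp_norm M 1 (\<lambda>t. yb t - Y t) < \<eta> \<and>
      Linf_norm M (\<lambda>t. ys t - Y' t) \<le> ennreal \<eta> \<and>
      norm ((LINT t|M. X' t) - xs) < \<eta> \<and>
      Lp_norm M q X' * Lp_norm M p (\<lambda>t. X t - x) < \<eta> \<and>
      (\<exists>v. 0 \<le> v \<and> v < \<eta> \<and> ext_integral M (\<lambda>t. \<bar>\<phi> t (X t, Y t) - \<phi> t (xb, yb t)\<bar>) = ereal v)"

text \<open>
  Pick one member of the sequence of \<open>approximate_solutions\<close> far enough out, with \<open>\<epsilon> = \<eta> / 4\<close> so that the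
  errors \<open>2\<epsilon>\<close> stay below \<open>\<eta>\<close>. The set \<open>D j\<close> on which the constraint of \<open>localization\<close> is active shrinks
  with \<open>j\<close>; as soon as the integral of \<open>\<parallel>s - yb\<parallel>\<close> over it is small, \<open>D j\<close> is null.
\<close>

lemma approximate_subgradients:
  assumes p: "1 < p" and q: "1 < q" and pq: "1 / p + 1 / q = 1" and \<eta>: "0 < \<eta>"
  shows "\<exists>x X X' Y Y'. approximates p q \<eta> x X X' Y Y'"
proof -
  define \<epsilon> where "\<epsilon> = \<eta> / 4"
  have \<epsilon>: "0 < \<epsilon>" using \<eta> by (simp add: \<epsilon>_def)
  obtain \<delta>0 where L: "locally_minimal_integrand M tilt xb yb xs \<epsilon> \<delta>0" using locally_minimal[OF \<epsilon>] by blast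
  interpret L: locally_minimal_integrand M tilt xb yb xs \<epsilon> \<delta>0 by (rule L)
  obtain B s r0 where B [measurable]: "B \<in> sets M" and s_meas [measurable]: "s \<in> borel_measurable M" and r0: "0 < r0"
    and s_fin: "(\<integral>\<^sup>+t. ennreal (norm (s t - yb t)) * indicator B t \<partial>M) < \<infinity>"
    and null: "\<forall>D\<in>sets M. D \<subseteq> B \<longrightarrow> (\<integral>\<^sup>+t. ennreal (norm (s t - yb t)) * indicator D t \<partial>M) < ennreal \<delta>0 \<longrightarrow> emeasure M D = 0"
    and growing: "growing_integrand M (constrain tilt B r0 yb) xb yb xs \<epsilon> \<delta>0"
    using L.localization by blast
  let ?G = "constrain tilt B r0 yb"
  interpret H: growing_integrand M ?G xb yb xs \<epsilon> \<delta>0 by (rule growing)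
  from H.approximate_solutions[OF p] obtain \<delta> x Z r \<sigma> where \<delta>: "0 < \<delta>"
    and opt: "\<forall>j. 0 < r j \<and> 0 < \<sigma> j \<and> H.optimal p (r j) (\<sigma> j) \<delta> (x j) (Z j)"
    and x_lim: "x \<longlonglongrightarrow> xb"
    and Y_int: "\<forall>j. integrable M (\<lambda>t. snd (Z j t))"
    and Y_AE: "AE t in M. (\<lambda>j. snd (Z j t)) \<longlonglongrightarrow> yb t"
    and Y_L1: "(\<lambda>j. \<integral>t. norm (snd (Z j t) - yb t) \<partial>M) \<longlonglongrightarrow> 0"
    and rN_lim: "(\<lambda>j. r j * H.power_part p (x j) (Z j)) \<longlonglongrightarrow> 0"
    and N_lim: "(\<lambda>j. H.power_part p (x j) (Z j)) \<longlonglongrightarrow> 0"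
    and G_L1: "(\<lambda>j. \<integral>t. \<bar>enn2real (?G t (fst (Z j t), snd (Z j t))) - enn2real (?G t (xb, yb t))\<bar> \<partial>M) \<longlonglongrightarrow> 0"
    by (elim exE conjE) (rule that; assumption)
  have rj: "0 < r j" and \<sigma>j: "0 < \<sigma> j" and optj: "H.optimal p (r j) (\<sigma> j) \<delta> (x j) (Z j)" for j
    using opt by blast+
  have Z: "Z j \<in> borel_measurable M" for j using optj[of j] unfolding H.optimal_def by blast
  note [measurable] = borel_measurable_fst_snd[OF Z]
  note cons = H.optimal_consequences[OF p rj \<sigma>j \<delta> optj]
  obtain K where K: "0 \<le> K" "AE t in M. norm (ys t) \<le> K" using ys_bounded by blast
  have ev_x: "eventually (\<lambda>j. norm (x j - xb) < min \<delta> \<eta>) sequentially"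
    using tendsto_norm_zero[OF LIM_zero[OF x_lim]] \<delta> \<eta> by (intro order_tendstoD(2)) auto
  have ev_Y: "eventually (\<lambda>j. (\<integral>t. norm (snd (Z j t) - yb t) \<partial>M) < \<eta>) sequentially"
    using Y_L1 \<eta> by (rule order_tendstoD(2))
  have "(\<lambda>j. p * (r j * H.power_part p (x j) (Z j))) \<longlonglongrightarrow> 0" by (rule tendsto_mult_right_zero[OF rN_lim])
  then have ev_rN: "eventually (\<lambda>j. p * (r j * H.power_part p (x j) (Z j)) < \<eta>) sequentially"
    using \<eta> by (rule order_tendstoD(2))
  have ev_G: "eventually (\<lambda>j. (\<integral>t. \<bar>enn2real (?G t (fst (Z j t), snd (Z j t))) - enn2real (?G t (xb, yb t))\<bar> \<partial>M)
      + K * (\<integral>t. norm (snd (Z j t) - yb t) \<partial>M) < \<eta>) sequentially"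
    using tendsto_add[OF G_L1 tendsto_mult_right_zero[OF Y_L1, of K]] \<eta> by (intro order_tendstoD(2)) auto
  have ev_X: "eventually (\<lambda>j. Lp_norm M p (\<lambda>t. xb - fst (Z j t)) < \<eta>) sequentially"
  proof (rule order_tendstoD(2)[OF _ \<eta>])
    have "(\<lambda>j. \<integral>t. norm (xb - fst (Z j t)) powr p \<partial>M) \<longlonglongrightarrow> 0"
    proof (rule tendsto_sandwich[where f = "\<lambda>_. 0" and
          h = "\<lambda>j. 2 powr p * (H.power_part p (x j) (Z j) + norm (x j - xb) powr p * measure M (space M))"])
      have "(\<lambda>j. norm (x j - xb) powr p) \<longlonglongrightarrow> 0"
        by (rule tendsto_zero_powrI[OF tendsto_norm_zero[OF LIM_zero[OF x_lim]] tendsto_const]) (use p in auto)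
      then have "(\<lambda>j. 2 powr p * (H.power_part p (x j) (Z j) + norm (x j - xb) powr p * measure M (space M)))
          \<longlonglongrightarrow> 2 powr p * (0 + 0 * measure M (space M))"
        by (intro tendsto_intros N_lim)
      then show "(\<lambda>j. 2 powr p * (H.power_part p (x j) (Z j) + norm (x j - xb) powr p * measure M (space M))) \<longlonglongrightarrow> 0"
        by simp
      show "eventually (\<lambda>j. (\<integral>t. norm (xb - fst (Z j t)) powr p \<partial>M)
          \<le> 2 powr p * (H.power_part p (x j) (Z j) + norm (x j - xb) powr p * measure M (space M))) sequentially"
      proof (intro always_eventually allI)
        fix j
        note int = cons(2)[of j]
        have int2: "integrable M (\<lambda>t. norm (fst (Z j t) - xb) powr p)"
          by (rule integrable_shifted_power(2)[OF finite_measure_axioms _ p int]) measurable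
        have "(\<integral>t. norm (xb - fst (Z j t)) powr p \<partial>M)
            \<le> (\<integral>t. 2 powr p * (norm (fst (Z j t) - x j) powr p + norm (x j - xb) powr p) \<partial>M)"
        proof (rule integral_mono)
          show "integrable M (\<lambda>t. norm (xb - fst (Z j t)) powr p)" using int2 by (simp add: norm_minus_commute)
          fix t
          have "norm (xb - fst (Z j t)) powr p \<le> (norm (fst (Z j t) - x j) + norm (x j - xb)) powr p"
            using p norm_triangle_ineq[of "fst (Z j t) - x j" "x j - xb"]
            by (intro powr_mono2) (auto simp: norm_minus_commute)
          also have "\<dots> \<le> 2 powr p * (norm (fst (Z j t) - x j) powr p + norm (x j - xb) powr p)"
            using p by (intro sum_powr_le) auto
          finally show "norm (xb - fst (Z j t)) powr p
              \<le> 2 powr p * (norm (fst (Z j t) - x j) powr p + norm (x j - xb) powr p)" .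
        qed (use int in auto)
        also have "\<dots> = 2 powr p * (H.power_part p (x j) (Z j) + norm (x j - xb) powr p * measure M (space M))"
          using int by (simp add: H.power_part_def Bochner_Integration.integral_add mult.commute)
        finally show "(\<integral>t. norm (xb - fst (Z j t)) powr p \<partial>M)
            \<le> 2 powr p * (H.power_part p (x j) (Z j) + norm (x j - xb) powr p * measure M (space M))" .
      qed
    qed auto
    then show "(\<lambda>j. Lp_norm M p (\<lambda>t. xb - fst (Z j t))) \<longlonglongrightarrow> 0"
      unfolding Lp_norm_def by (rule tendsto_zero_powrI[OF _ tendsto_const]) (use p in auto)
  qed
  define D where "D j = {t \<in> space M. t \<in> B \<and> r0 \<le> norm (snd (Z j t) - yb t)}" for j
  have D [measurable]: "D j \<in> sets M" for j unfolding D_def by measurable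
  have D_B: "D j \<subseteq> B" for j by (auto simp: D_def)
  have "(\<lambda>j. \<integral>\<^sup>+t. ennreal (norm (s t - yb t)) * indicator (D j) t \<partial>M) \<longlonglongrightarrow> (\<integral>\<^sup>+t. 0 \<partial>M)"
  proof (rule nn_integral_dominated_convergence[where w = "\<lambda>t. ennreal (norm (s t - yb t)) * indicator B t"])
    show "AE t in M. (\<lambda>j. ennreal (norm (s t - yb t)) * indicator (D j) t) \<longlonglongrightarrow> 0"
      using Y_AE
    proof eventually_elim
      case (elim t)
      have "(\<lambda>j. norm (snd (Z j t) - yb t)) \<longlonglongrightarrow> 0" by (rule tendsto_norm_zero[OF LIM_zero[OF elim]])
      then have "eventually (\<lambda>j. norm (snd (Z j t) - yb t) < r0) sequentially" using r0 by (rule order_tendstoD(2))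
      then have "eventually (\<lambda>j. ennreal (norm (s t - yb t)) * indicator (D j) t = 0) sequentially"
        by eventually_elim (auto simp: D_def indicator_def)
      then show ?case by (rule tendsto_eventually)
    qed
    show "AE t in M. ennreal (norm (s t - yb t)) * indicator (D j) t \<le> ennreal (norm (s t - yb t)) * indicator B t" for j
      using D_B[of j] by (intro AE_I2) (auto simp: indicator_def)
  qed (use s_fin in measurable)
  then have "eventually (\<lambda>j. (\<integral>\<^sup>+t. ennreal (norm (s t - yb t)) * indicator (D j) t \<partial>M) < ennreal \<delta>0) sequentially"
    using L.\<delta>0 by (intro order_tendstoD(2)) (auto simp: ennreal_less_zero_iff)
  then have ev_D: "eventually (\<lambda>j. emeasure M (D j) = 0) sequentially"
    by eventually_elim (use null D D_B in blast)
  have "eventually (\<lambda>j. norm (x j - xb) < min \<delta> \<eta> \<and> (\<integral>t. norm (snd (Z j t) - yb t) \<partial>M) < \<eta> \<and>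
      p * (r j * H.power_part p (x j) (Z j)) < \<eta> \<and>
      (\<integral>t. \<bar>enn2real (?G t (fst (Z j t), snd (Z j t))) - enn2real (?G t (xb, yb t))\<bar> \<partial>M)
        + K * (\<integral>t. norm (snd (Z j t) - yb t) \<partial>M) < \<eta> \<and>
      Lp_norm M p (\<lambda>t. xb - fst (Z j t)) < \<eta> \<and> emeasure M (D j) = 0) sequentially"
    by (intro eventually_conj ev_x ev_Y ev_rN ev_G ev_X ev_D)
  then obtain j where j_x: "norm (x j - xb) < min \<delta> \<eta>" and j_Y: "(\<integral>t. norm (snd (Z j t) - yb t) \<partial>M) < \<eta>"
    and j_rN: "p * (r j * H.power_part p (x j) (Z j)) < \<eta>"
    and j_G: "(\<integral>t. \<bar>enn2real (?G t (fst (Z j t), snd (Z j t))) - enn2real (?G t (xb, yb t))\<bar> \<partial>M)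
        + K * (\<integral>t. norm (snd (Z j t) - yb t) \<partial>M) < \<eta>"
    and j_X: "Lp_norm M p (\<lambda>t. xb - fst (Z j t)) < \<eta>" and j_D: "emeasure M (D j) = 0"
    using eventually_happens'[OF sequentially_bot] by blast
  define X where "X t = fst (Z j t)" for t
  define Y where "Y t = snd (Z j t)" for t
  define X' where "X' t = r j *\<^sub>R power_grad p (x j - X t)" for t
  define Y' where "Y' t = ys t - (2 * \<epsilon>) *\<^sub>R smooth_norm_grad (\<sigma> j) (Y t - yb t)" for t
  have X [measurable]: "X \<in> borel_measurable M" and Y [measurable]: "Y \<in> borel_measurable M"
    unfolding X_def Y_def by measurable
  have Yi: "integrable M Y" unfolding Y_def using Y_int by blast
  have Xint: "integrable M (\<lambda>t. norm (X t - x j) powr p)" unfolding X_def by (rule cons(2))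
  have value_fin: "(\<integral>\<^sup>+t. H.value_part (\<sigma> j) (Z j) t \<partial>M) < \<infinity>" by (rule cons(1))
  have "(\<integral>\<^sup>+t. ?G t (X t, Y t) \<partial>M) \<le> (\<integral>\<^sup>+t. H.value_part (\<sigma> j) (Z j) t \<partial>M)"
    unfolding X_def Y_def H.value_part_def by (intro nn_integral_mono) simp
  then have G_fin: "(\<integral>\<^sup>+t. ?G t (X t, Y t) \<partial>M) < \<infinity>" using value_fin by (rule le_less_trans)
  have "(\<integral>\<^sup>+t. tilt t (X t, Y t) \<partial>M) \<le> (\<integral>\<^sup>+t. ?G t (X t, Y t) \<partial>M)"
    by (intro nn_integral_mono) (simp add: constrain_def)
  then have tilt_fin: "(\<integral>\<^sup>+t. tilt t (X t, Y t) \<partial>M) < \<infinity>" using G_fin by (rule le_less_trans)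
  have G_fin_AE: "AE t in M. ?G t (X t, Y t) < \<infinity>"
    by (rule enn2real_integral_finite(1)[OF H.G_meas[OF X Y] G_fin])
  have G_eq_AE: "AE t in M. ?G t (X t, Y t) = tilt t (X t, Y t)"
    using G_fin_AE by eventually_elim (auto simp: constrain_def split: if_splits)
  have G_base: "?G t (xb, yb t) = tilt t (xb, yb t)" for t using r0 by (simp add: constrain_def)
  have "AE t in M. t \<notin> D j" using j_D D[of j] by (intro AE_not_in) (simp add: null_sets_def)
  then have subdiff: "AE t in M. (X' t, Y' t) \<in> regular_subdiff (\<phi> t) (X t, Y t)"
    using tilt_eq G_fin_AE AE_space
  proof eventually_elim
    case (elim t)
    have min: "?G t (Z j t) + ennreal (H.penalty p (r j) (\<sigma> j) (x j) t (Z j t))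
        \<le> ?G t z + ennreal (H.penalty p (r j) (\<sigma> j) (x j) t z)" for z
      using optj[of j] elim(4) unfolding H.optimal_def by blast
    have inactive: "norm (snd (Z j t) - yb t) < r0" if "t \<in> B"
      using elim(1,4) that by (simp add: D_def)
    have fin: "?G t (Z j t) < \<infinity>" using elim(3) by (simp add: X_def Y_def)
    show ?case
      using pointwise_subgradient[OF growing p \<sigma>j rj elim(2)[rule_format] fin inactive min]
      by (simp add: X'_def Y'_def X_def Y_def)
  qed
  have X_Lp: "X \<in> Lp_space M p"
    using integrable_shifted_power(2)[OF finite_measure_axioms X p Xint, of 0] by (simp add: Lp_space_def)
  note Lq = Lq_norm_power_grad[OF p q pq rj X Xint]
  have Y_L1: "Y \<in> Lp_space M 1" using Yi by (simp add: Lp_1_iff)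
  have Y'_meas [measurable]: "Y' \<in> borel_measurable M" unfolding Y'_def by measurable
  have grad_le: "norm ((2 * \<epsilon>) *\<^sub>R smooth_norm_grad (\<sigma> j) u) \<le> 2 * \<epsilon>" for u :: 'b
    using \<epsilon> norm_smooth_norm_grad[of "\<sigma> j" u] by (simp add: mult_left_le)
  have grad_le': "norm ((2 * \<epsilon>) *\<^sub>R smooth_norm_grad (\<sigma> j) u) \<le> 2 * \<epsilon>" for u :: 'a
    using \<epsilon> norm_smooth_norm_grad[of "\<sigma> j" u] by (simp add: mult_left_le)
  have "AE t in M. ennreal (norm (Y' t)) \<le> ennreal (K + 2 * \<epsilon>)"
    using K(2)
  proof eventually_elim
    case (elim t)
    have "norm (Y' t) \<le> norm (ys t) + norm ((2 * \<epsilon>) *\<^sub>R smooth_norm_grad (\<sigma> j) (Y t - yb t))"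
      unfolding Y'_def by (rule norm_triangle_ineq4)
    then show ?case using elim grad_le[of "Y t - yb t"] by (intro ennreal_leI) linarith
  qed
  then have "Linf_norm M Y' \<le> ennreal (K + 2 * \<epsilon>)" unfolding Linf_norm_def by (intro esssup_I) measurable
  then have Y'_Linf: "Y' \<in> Linf_space M"
    using Y'_meas le_less_trans[OF _ ennreal_less_top] by (auto simp: Linf_space_def)
  have "Linf_norm M (\<lambda>t. ys t - Y' t) \<le> ennreal (2 * \<epsilon>)"
    unfolding Linf_norm_def
  proof (rule esssup_I)
    show "AE t in M. ennreal (norm (ys t - Y' t)) \<le> ennreal (2 * \<epsilon>)"
      using grad_le by (intro AE_I2 ennreal_leI) (simp only: Y'_def diff_diff_eq2 add_diff_cancel_left')
  qed measurable
  also have "ennreal (2 * \<epsilon>) \<le> ennreal \<eta>" using \<eta> by (intro ennreal_leI) (simp add: \<epsilon>_def)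
  finally have Y'_close: "Linf_norm M (\<lambda>t. ys t - Y' t) \<le> ennreal \<eta>" .
  have X'_int: "norm ((LINT t|M. X' t) - xs) < \<eta>"
  proof -
    have "(LINT t|M. X' t) = r j *\<^sub>R (\<integral>t. power_grad p (x j - fst (Z j t)) \<partial>M)"
      unfolding X'_def X_def by simp
    also have "\<dots> = xs - (2 * \<epsilon>) *\<^sub>R smooth_norm_grad (\<sigma> j) (x j - xb)" using cons(4)[of j] j_x by simp
    finally have "norm ((LINT t|M. X' t) - xs) = norm ((2 * \<epsilon>) *\<^sub>R smooth_norm_grad (\<sigma> j) (x j - xb))" by simp
    also have "\<dots> \<le> 2 * \<epsilon>" by (rule grad_le')
    finally show ?thesis using \<eta> by (simp add: \<epsilon>_def)
  qed
  have prod: "Lp_norm M q X' * Lp_norm M p (\<lambda>t. X t - x j) < \<eta>"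
    unfolding X'_def Lq(2) using j_rN by (simp add: H.power_part_def X_def)
  note tX = tilt_real[OF Yi X tilt_fin] and tb = tilt_real[OF yb_int borel_measurable_const tilt_base_finite]
  (* the difference of the original integrands, in which the offsets cancel *)
  define g where "g t = enn2real (tilt t (X t, Y t)) - enn2real (tilt t (xb, yb t)) + ys t \<bullet> (Y t - yb t)" for t
  have diff_int: "integrable M (\<lambda>t. Y t - yb t)" using Yi yb_int by simp
  have g_int: "integrable M g"
    unfolding g_def using tX(2) tb(2) ys_inner_integrable[OF diff_int] by auto
  have g_eq: "AE t in M. \<bar>\<phi> t (X t, Y t) - \<phi> t (xb, yb t)\<bar> = ereal \<bar>g t\<bar>"
    using tX(1) tb(1) by eventually_elim (simp add: g_def inner_diff_right algebra_simps)
  have ext: "ext_integral M (\<lambda>t. \<bar>\<phi> t (X t, Y t) - \<phi> t (xb, yb t)\<bar>) = ereal (\<integral>t. \<bar>g t\<bar> \<partial>M)"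
    by (rule ext_integral_real[OF _ g_eq]) (use g_int in auto)
  have "integrable M (\<lambda>t. enn2real (?G t (X t, Y t)))" by (rule enn2real_integral_finite(3)[OF H.G_meas[OF X Y] G_fin])
  then have Gdiff_int: "integrable M (\<lambda>t. \<bar>enn2real (?G t (X t, Y t)) - enn2real (?G t (xb, yb t))\<bar>)"
    using tb(2) by (intro integrable_abs Bochner_Integration.integrable_diff) (simp_all add: G_base)
  have Ydiff_int: "integrable M (\<lambda>t. K * norm (Y t - yb t))"
    by (intro integrable_mult_right integrable_norm diff_int)
  have "(\<integral>t. \<bar>g t\<bar> \<partial>M) \<le> (\<integral>t. \<bar>enn2real (?G t (X t, Y t)) - enn2real (?G t (xb, yb t))\<bar> + K * norm (Y t - yb t) \<partial>M)"
  proof (rule integral_mono_AE)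
    show "integrable M (\<lambda>t. \<bar>enn2real (?G t (X t, Y t)) - enn2real (?G t (xb, yb t))\<bar> + K * norm (Y t - yb t))"
      by (rule Bochner_Integration.integrable_add[OF Gdiff_int Ydiff_int])
    show "AE t in M. \<bar>g t\<bar> \<le> \<bar>enn2real (?G t (X t, Y t)) - enn2real (?G t (xb, yb t))\<bar> + K * norm (Y t - yb t)"
      using G_eq_AE K(2)
    proof eventually_elim
      case (elim t)
      have "\<bar>ys t \<bullet> (Y t - yb t)\<bar> \<le> norm (ys t) * norm (Y t - yb t)" by (rule Cauchy_Schwarz_ineq2)
      also have "\<dots> \<le> K * norm (Y t - yb t)" using elim(2) by (intro mult_right_mono) auto
      finally show ?case unfolding g_def elim(1) G_base by linarith
    qed
  qed (use g_int in auto)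
  also have "\<dots> = (\<integral>t. \<bar>enn2real (?G t (X t, Y t)) - enn2real (?G t (xb, yb t))\<bar> \<partial>M) + K * (\<integral>t. norm (Y t - yb t) \<partial>M)"
    using Bochner_Integration.integral_add[OF Gdiff_int Ydiff_int] by simp
  also have "\<dots> < \<eta>" using j_G by (simp add: X_def Y_def)
  finally have g_small: "(\<integral>t. \<bar>g t\<bar> \<partial>M) < \<eta>" .
  have "norm (xb - x j) < \<eta>" using j_x by (simp add: norm_minus_commute)
  moreover have "Lp_norm M p (\<lambda>t. xb - X t) < \<eta>" using j_X by (simp add: X_def)
  moreover have "Lp_norm M 1 (\<lambda>t. yb t - Y t) < \<eta>" using j_Y by (simp add: Lp_norm_1 Y_def norm_minus_commute)
  moreover have "X' \<in> Lp_space M q" unfolding X'_def by (rule Lq(1))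
  moreover have "0 \<le> (\<integral>t. \<bar>g t\<bar> \<partial>M)" by simp
  ultimately have "approximates p q \<eta> (x j) X X' Y Y'"
    unfolding approximates_def using X_Lp Y_L1 Y'_Linf subdiff Y'_close X'_int prod ext g_small by blast
  then show ?thesis by blast
qed

end

section \<open>Sequential subgradients of the integral functional\<close>

theorem theorem5p2:
  fixes M :: "'t measure"
    and Tpa Tna :: "'t set"
    and \<phi> :: "'t \<Rightarrow> (real ^ 'n) \<times> (real ^ 'm) \<Rightarrow> ereal"
    and \<nu> :: "'t \<Rightarrow> real"
    and p q \<rho> :: real
    and xbar xbar' :: "real ^ 'n"
    and ybar ybar' :: "'t \<Rightarrow> real ^ 'm"
  assumes "finite_measure M" and "complete_measure M"
    and "atomic_decomposition M Tpa Tna"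
    and "normal_integrand M \<phi>"
    and "integrable M \<nu>" and "\<forall>t\<in>space M. 0 \<le> \<nu> t"
    and "\<forall>t\<in>space M. \<forall>v w. - ereal (\<nu> t) \<le> \<phi> t (v, w)"
    and "1 < p" and "1 < q" and "1 / p + 1 / q = 1"
    and "(xbar, ybar) \<in> dom_functional M (integral_functional M \<phi>)"
    and "0 < \<rho>" and "\<forall>v\<in>cball xbar \<rho>. \<forall>t\<in>Tna. ext_convex (\<lambda>w. \<phi> t (v, w))"
    and "(xbar', ybar') \<in> regular_subdiff_functional M (integral_functional M \<phi>) xbar ybar"
    and "ext_integrable M (\<lambda>t. INF (v, w)\<in>UNIV. \<phi> t (v, w) - ereal (ybar' t \<bullet> w))"
  shows "\<exists>(x :: nat \<Rightarrow> real ^ 'n) (X :: nat \<Rightarrow> 't \<Rightarrow> real ^ 'n) (X' :: nat \<Rightarrow> 't \<Rightarrow> real ^ 'n)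
            (Y :: nat \<Rightarrow> 't \<Rightarrow> real ^ 'm) (Y' :: nat \<Rightarrow> 't \<Rightarrow> real ^ 'm).
      (\<forall>k. X k \<in> Lp_space M p \<and> X' k \<in> Lp_space M q \<and> Y k \<in> Lp_space M 1 \<and> Y' k \<in> Linf_space M) \<and>
      (\<forall>k. AE t in M. (X' k t, Y' k t) \<in> regular_subdiff (\<phi> t) (X k t, Y k t)) \<and>
      (\<lambda>k. norm (xbar - x k)) \<longlonglongrightarrow> 0 \<and>
      (\<lambda>k. Lp_norm M p (\<lambda>t. xbar - X k t)) \<longlonglongrightarrow> 0 \<and>
      (\<lambda>k. Lp_norm M 1 (\<lambda>t. ybar t - Y k t)) \<longlonglongrightarrow> 0 \<and>
      (\<lambda>k. Linf_norm M (\<lambda>t. ybar' t - Y' k t)) \<longlonglongrightarrow> 0 \<and>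
      (\<lambda>k. norm ((LINT t|M. X' k t) - xbar')) \<longlonglongrightarrow> 0 \<and>
      (\<lambda>k. Lp_norm M q (X' k) * Lp_norm M p (\<lambda>t. X k t - x k)) \<longlonglongrightarrow> 0 \<and>
      (\<lambda>k. ext_integral M (\<lambda>t. \<bar>\<phi> t (X k t, Y k t) - \<phi> t (xbar, ybar t)\<bar>)) \<longlonglongrightarrow> 0"
proof -
  interpret subgradient_setting M \<phi> \<nu> xbar xbar' ybar ybar'
    using assms unfolding subgradient_setting_def subgradient_setting_axioms_def by blast
  define \<eta> where "\<eta> k = 1 / real (Suc k)" for k
  have \<eta>: "0 < \<eta> k" for k by (simp add: \<eta>_def)
  have \<eta>_lim: "\<eta> \<longlonglongrightarrow> 0"
    unfolding \<eta>_def using LIMSEQ_inverse_real_of_nat by (simp add: inverse_eq_divide)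
  have squeeze: "u \<longlonglongrightarrow> 0" if "\<And>k. 0 \<le> u k" "\<And>k. u k < \<eta> k" for u :: "nat \<Rightarrow> real"
    by (rule tendsto_sandwich[OF _ _ tendsto_const \<eta>_lim]) (use that in \<open>auto intro!: always_eventually less_imp_le\<close>)
  obtain x X X' Y Y' where "\<And>k. approximates p q (\<eta> k) (x k) (X k) (X' k) (Y k) (Y' k)"
    using approximate_subgradients[OF \<open>1 < p\<close> \<open>1 < q\<close> \<open>1 / p + 1 / q = 1\<close> \<eta>] by metis
  note g = this[unfolded approximates_def]
  have spaces: "\<forall>k. X k \<in> Lp_space M p \<and> X' k \<in> Lp_space M q \<and> Y k \<in> Lp_space M 1 \<and> Y' k \<in> Linf_space M"
    using g by blast
  have subdiff: "\<forall>k. AE t in M. (X' k t, Y' k t) \<in> regular_subdiff (\<phi> t) (X k t, Y k t)"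
    using g by blast
  have x_lt: "norm (xbar - x k) < \<eta> k" and X_lt: "Lp_norm M p (\<lambda>t. xbar - X k t) < \<eta> k"
    and Y_lt: "Lp_norm M 1 (\<lambda>t. ybar t - Y k t) < \<eta> k"
    and Y'_le: "Linf_norm M (\<lambda>t. ybar' t - Y' k t) \<le> ennreal (\<eta> k)"
    and X'_lt: "norm ((LINT t|M. X' k t) - xbar') < \<eta> k"
    and prod_lt: "Lp_norm M q (X' k) * Lp_norm M p (\<lambda>t. X k t - x k) < \<eta> k"
    and ext: "\<exists>v. 0 \<le> v \<and> v < \<eta> k \<and>
      ext_integral M (\<lambda>t. \<bar>\<phi> t (X k t, Y k t) - \<phi> t (xbar, ybar t)\<bar>) = ereal v" for k
    using g[of k] by blast+
  have 1: "(\<lambda>k. norm (xbar - x k)) \<longlonglongrightarrow> 0" by (rule squeeze[OF norm_ge_zero x_lt])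
  have 2: "(\<lambda>k. Lp_norm M p (\<lambda>t. xbar - X k t)) \<longlonglongrightarrow> 0" by (rule squeeze[OF _ X_lt]) (simp add: Lp_norm_def)
  have 3: "(\<lambda>k. Lp_norm M 1 (\<lambda>t. ybar t - Y k t)) \<longlonglongrightarrow> 0" by (rule squeeze[OF _ Y_lt]) (simp add: Lp_norm_def)
  have 4: "(\<lambda>k. Linf_norm M (\<lambda>t. ybar' t - Y' k t)) \<longlonglongrightarrow> 0"
  proof (rule tendsto_sandwich[OF _ _ tendsto_const])
    show "(\<lambda>k. ennreal (\<eta> k)) \<longlonglongrightarrow> 0" using tendsto_ennrealI[OF \<eta>_lim] by simp
  qed (use Y'_le in \<open>auto intro: always_eventually\<close>)
  have 5: "(\<lambda>k. norm ((LINT t|M. X' k t) - xbar')) \<longlonglongrightarrow> 0" by (rule squeeze[OF norm_ge_zero X'_lt])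
  have 6: "(\<lambda>k. Lp_norm M q (X' k) * Lp_norm M p (\<lambda>t. X k t - x k)) \<longlonglongrightarrow> 0"
    by (rule squeeze[OF _ prod_lt]) (simp add: Lp_norm_def)
  obtain v where v: "\<And>k. 0 \<le> v k" "\<And>k. v k < \<eta> k"
    "\<And>k. ext_integral M (\<lambda>t. \<bar>\<phi> t (X k t, Y k t) - \<phi> t (xbar, ybar t)\<bar>) = ereal (v k)"
    using ext by metis
  have 7: "(\<lambda>k. ext_integral M (\<lambda>t. \<bar>\<phi> t (X k t, Y k t) - \<phi> t (xbar, ybar t)\<bar>)) \<longlonglongrightarrow> 0"
    unfolding v(3) using squeeze[OF v(1,2)] by (simp add: zero_ereal_def)
  show ?thesis
    by (intro exI[of _ x] exI[of _ X] exI[of _ X'] exI[of _ Y] exI[of _ Y'] conjI spaces subdiff 1 2 3 4 5 6 7)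
qed

end
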